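(* Suppose that $\omega=\omega(n)\gg1$. If the edge-probability $p=p(n)$ satisfies $(\log n)^{\omega}n^{-2/5}\le p\ll n^{-1/3}$, then with high probability the clique chromatic number of the binomial random graph $G_{n,p}$ satisfies $$\chi_c(G_{n,p})=\bigl(\tfrac52+o(1)\bigr)\log\bigl(n^{2/5}p\bigr)/p.$$
   Context: $G_{n,p}$ is the binomial random graph on vertex set $\{1,\dots,n\}$, in which each pair of vertices is an edge independently with probability $p=p(n)\in(0,1)$. The clique chromatic number $\chi_c(G)$ of a graph $G$ is the smallest number of colors in a vertex coloring of $G$ so that no inclusion-maximal clique is monochromatic, where isolated vertices are ignored (i.e., only inclusion-maximal cliques with at least two vertices matter). All asymptotics are as $n\to\infty$; $f\ll g$ (equivalently $g\gg f$) means $f/g\to0$; $\log$ is the natural logarithm. "With high probability" means with probability tending to $1$ as $n\to\infty$. The conclusion means that there is a deterministic $\eta(n)\to0$ such that with high probability $|\chi_c(G_{n,p})\,p/\log(n^{2/5}p)-\tfrac52|\le\eta(n)$. *)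

theory Defs
  imports "HOL-Probability.Probability" "HOL-Library.Ramsey" "HOL-Library.Landau_Symbols"
begin

text \<open>
  A finite simple graph is given by its vertex set \<open>V\<close> and its edge set \<open>E \<subseteq> nsets V 2\<close>;
  \<^term>\<open>clique K E\<close> says that all pairs of distinct elements of \<open>K\<close> are edges.
\<close>

definition maximal_clique :: "'a set \<Rightarrow> 'a set set \<Rightarrow> 'a set \<Rightarrow> bool" where
  "maximal_clique V E K \<longleftrightarrow>
     K \<subseteq> V \<and> clique K E \<and> (\<forall>L. K \<subseteq> L \<and> L \<subseteq> V \<and> clique L E \<longrightarrow> L = K)"

definition monochromatic :: "('a \<Rightarrow> 'b) \<Rightarrow> 'a set \<Rightarrow> bool" where
  "monochromatic c K \<longleftrightarrow> (\<exists>a. \<forall>v\<in>K. c v = a)"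

text \<open>
  The condition \<^term>\<open>card K \<ge> 2\<close> discards isolated vertices, which form
  inclusion-maximal cliques with a single vertex.
\<close>
definition clique_coloring :: "'a set \<Rightarrow> 'a set set \<Rightarrow> nat \<Rightarrow> ('a \<Rightarrow> nat) \<Rightarrow> bool" where
  "clique_coloring V E k c \<longleftrightarrow>
     c \<in> V \<rightarrow> {..<k} \<and> (\<forall>K. maximal_clique V E K \<and> card K \<ge> 2 \<longrightarrow> \<not> monochromatic c K)"

definition clique_chromatic_number :: "'a set \<Rightarrow> 'a set set \<Rightarrow> nat" where
  "clique_chromatic_number V E = (LEAST k. \<exists>c. clique_coloring V E k c)"

text \<open>The minimum is over a nonempty set: give all vertices distinct colors.\<close>
lemma clique_coloring_exists:
  assumes "finite V"
  shows "\<exists>c. clique_coloring V E (card V) c"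
proof -
  obtain c where c: "bij_betw c V {..<card V}"
    using assms ex_bij_betw_finite_nat[of V] by (auto simp: atLeast0LessThan)
  have "\<not> monochromatic c K" if "K \<subseteq> V" "card K \<ge> 2" for K
  proof
    assume "monochromatic c K"
    then obtain a where "c ` K \<subseteq> {a}"
      by (auto simp: monochromatic_def)
    then have "card (c ` K) \<le> 1"
      using card_mono[of "{a}" "c ` K"] by simp
    moreover have "card (c ` K) = card K"
      using c that(1) by (intro card_image) (auto simp: bij_betw_def intro: inj_on_subset)
    ultimately show False using that(2) by simp
  qed
  then have "clique_coloring V E (card V) c"
    using c by (auto simp: clique_coloring_def maximal_clique_def bij_betw_def)
  then show ?thesis by blast
qed

text \<open>
  The binomial random graph on \<open>{1..n}\<close>, as the distribution of its random edge set.  The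
  default value \<^const>\<open>False\<close> ensures that sets that are not pairs of vertices are never edges.
\<close>
definition binomial_random_graph :: "nat \<Rightarrow> real \<Rightarrow> nat set set pmf" where
  "binomial_random_graph n p =
     map_pmf (\<lambda>f. {e. f e}) (Pi_pmf (nsets {1..n} 2) False (\<lambda>_. bernoulli_pmf p))"

end

theory Submission
  imports Defs "HOL-Real_Asymp.Real_Asymp"
begin

text \<open>
  Write \<open>L = ln n\<close>, \<open>D = n^(2/5) p\<close> and \<open>r = p^(-1/2)\<close>.  Since \<open>n p^3\<close> tends to 0, three vertices
  typically have no common neighbour, so most triangles are maximal cliques; since \<open>n p^2\<close> is at least
  \<open>n^(1/5)\<close>, every edge lies in a triangle.  Two kinds of vertex sets are therefore safe as color classes:
  subsets of a neighbourhood (the centre extends every clique inside it) and triangle-free sets (a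
  clique inside has at most two vertices and can be extended).  The theorem says that the first kind does
  essentially all the work.

  Upper bound.  Fix \<open>k = (5/2 + e) ln D / p\<close> vertices and use their neighbourhoods as the first \<open>k\<close>
  classes.  About \<open>n exp (- p k) = p^(-5/2) D^(-e)\<close> vertices remain, and \<open>D^e\<close> exceeds every fixed power of
  \<open>L\<close>.  Cut the rest into blocks of size at most \<open>r^3\<close>.  In such a block a vertex lies in boundedly
  many triangles on average, and greedy coloring produces triangle-free classes with \<open>O(L)\<close> colors per
  block: if it fails, some vertex sees \<open>O(L)\<close> disjoint edges of its block
  (\<open>triangle_free_coloring_if_no_book\<close>), which is too unlikely (\<open>rprob_book\<close>).  All blocks together
  need only \<open>o(1/p)\<close> colors (\<open>rprob_many_colors\<close>).

  Lower bound.  The key claim is that with high probability every set \<open>C\<close> without a maximal triangle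
  satisfies \<open>card (C - nbrs E v) < s\<close> for some vertex \<open>v\<close>, where \<open>s\<close> is \<open>r^3\<close> times a power of \<open>L\<close>
  (\<open>rprob_exists_set_far_from_nbrs\<close>).  Hence \<open>k\<close> color classes cover at most \<open>k s\<close> vertices
  besides the union of \<open>k\<close> neighbourhoods.  With \<open>k = (5/2 - e) ln D / p\<close>, however, any \<open>k\<close>
  neighbourhoods miss about \<open>n (1 - p)^k = p^(-5/2) D^e\<close> vertices, up to powers of \<open>L\<close>
  (\<open>rprob_few_uncovered\<close>), which is more than \<open>k s\<close>.

  For the key claim, a violating \<open>C\<close> contains disjoint sets \<open>A\<close>, \<open>Y\<close>, \<open>Z\<close> of size \<open>a\<close> slightly above
  \<open>r^3\<close> such that no vertex has many neighbours in \<open>A\<close> and at the same time a neighbour in \<open>Y\<close>.  For fixed sets it suffices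
  to find a maximal triangle across them with failure probability below \<open>n^(-3a)\<close>, the inverse number
  of choices.  Expose first all pairs except those between the three sets; the previous condition makes most
  triples of \<open>A \<times> Y \<times> Z\<close> free of common neighbours outside the three sets.  Next expose the pairs between \<open>A\<close>
  and \<open>Y \<union> Z\<close>.  A pair \<open>(y, z)\<close> is good if some \<open>x\<close> in \<open>A\<close> is adjacent to both and nothing exposed
  prevents \<open>{x, y, z}\<close> from being a maximal clique once \<open>{y, z}\<close> is an edge.  The rows of the
  vertices \<open>x\<close> are independent, and a typical row fails with probability at most \<open>n^(-100)\<close>, so there
  are at least \<open>5 a L / p\<close> good pairs (\<open>many_good_pairs\<close>,
  \<open>rprob_few_good_rows\<close>).  Finally expose the pairs between \<open>Y\<close> and \<open>Z\<close>: the probability that no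
  good pair becomes an edge is at most \<open>exp (- 5 a L)\<close>.
\<close>

section \<open>Random subsets of a finite set\<close>

text \<open>
  The edge set of the random graph is the case \<open>I = nsets V 2\<close>.  Arbitrary index sets are allowed so
  that different groups of vertex pairs can be exposed one after the other.
\<close>
definition random_subset :: "'a set \<Rightarrow> real \<Rightarrow> 'a set pmf" where
  "random_subset I p = map_pmf Collect (Pi_pmf I False (\<lambda>_. bernoulli_pmf p))"

definition rprob :: "'a set \<Rightarrow> real \<Rightarrow> ('a set \<Rightarrow> bool) \<Rightarrow> real" where
  "rprob I p P = measure_pmf.prob (random_subset I p) {E. P E}"

lemma rprob_nonneg [simp]: "0 \<le> rprob I p P"
  by (simp add: rprob_def)

lemma rprob_le_1 [simp]: "rprob I p P \<le> 1"
  by (simp add: rprob_def)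

lemma set_pmf_random_subset:
  assumes "finite I"
  shows "set_pmf (random_subset I p) \<subseteq> Pow I"
  using set_Pi_pmf_subset[OF assms] by (fastforce simp: random_subset_def)

lemma rprob_mono:
  assumes "finite I" "\<And>E. E \<subseteq> I \<Longrightarrow> P E \<Longrightarrow> Q E"
  shows "rprob I p P \<le> rprob I p Q"
proof -
  have "rprob I p P = measure_pmf.prob (random_subset I p) ({E. P E} \<inter> set_pmf (random_subset I p))"
    by (simp add: rprob_def measure_Int_set_pmf)
  also have "\<dots> \<le> rprob I p Q"
    unfolding rprob_def using set_pmf_random_subset[OF assms(1), of p] assms(2)
    by (intro measure_pmf.finite_measure_mono) auto
  finally show ?thesis .
qed

lemma rprob_cong:
  assumes "finite I" "\<And>E. E \<subseteq> I \<Longrightarrow> P E = Q E"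
  shows "rprob I p P = rprob I p Q"
  by (intro antisym rprob_mono assms) (use assms in auto)

lemma rprob_disj: "rprob I p (\<lambda>E. P E \<or> Q E) \<le> rprob I p P + rprob I p Q"
proof -
  have "{E. P E \<or> Q E} = {E. P E} \<union> {E. Q E}" by auto
  then show ?thesis
    unfolding rprob_def by (simp add: measure_Un_le)
qed

lemma rprob_bex:
  assumes "finite X"
  shows "rprob I p (\<lambda>E. \<exists>x\<in>X. P x E) \<le> (\<Sum>x\<in>X. rprob I p (P x))"
proof -
  have "{E. \<exists>x\<in>X. P x E} = (\<Union>x\<in>X. {E. P x E})" by auto
  then show ?thesis
    unfolding rprob_def
    using measure_pmf.finite_measure_subadditive_finite[OF assms, of "\<lambda>x. {E. P x E}"] by simp
qed

lemma rprob_bex_le: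
  assumes "finite X" "\<And>x. x \<in> X \<Longrightarrow> rprob I p (P x) \<le> e" "real (card X) \<le> N" "0 \<le> e"
  shows "rprob I p (\<lambda>E. \<exists>x\<in>X. P x E) \<le> N * e"
proof -
  have "rprob I p (\<lambda>E. \<exists>x\<in>X. P x E) \<le> (\<Sum>x\<in>X. rprob I p (P x))"
    by (rule rprob_bex[OF assms(1)])
  also have "\<dots> \<le> (\<Sum>x\<in>X. e)"
    by (intro sum_mono assms)
  also have "\<dots> \<le> N * e"
    using assms by (simp add: mult_right_mono)
  finally show ?thesis .
qed

lemma rprob_not: "rprob I p (\<lambda>E. \<not> P E) = 1 - rprob I p P"
proof -
  have "{E. \<not> P E} = UNIV - {E. P E}" by auto
  then show ?thesis
    using measure_pmf.prob_compl[of "{E. P E}" "random_subset I p"] by (simp add: rprob_def)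
qed

lemma random_subset_union:
  assumes "finite I" "finite J" "I \<inter> J = {}"
  shows "random_subset (I \<union> J) p =
    map_pmf (\<lambda>(E, F). E \<union> F) (pair_pmf (random_subset I p) (random_subset J p))"
proof -
  let ?P = "\<lambda>I. Pi_pmf I False (\<lambda>_. bernoulli_pmf p)"
  have "random_subset (I \<union> J) p =
      map_pmf (\<lambda>(f, g). {x. if x \<in> I then f x else g x}) (pair_pmf (?P I) (?P J))"
    by (simp add: random_subset_def Pi_pmf_union[OF assms] pmf.map_comp o_def case_prod_unfold)
  also have "\<dots> = map_pmf (\<lambda>(f, g). {x. f x} \<union> {x. g x}) (pair_pmf (?P I) (?P J))"
  proof (intro map_pmf_cong refl)
    fix fg assume fg: "fg \<in> set_pmf (pair_pmf (?P I) (?P J))"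
    obtain f g where [simp]: "fg = (f, g)" by (cases fg)
    have "\<forall>x. x \<notin> I \<longrightarrow> \<not> f x" "\<forall>x. x \<notin> J \<longrightarrow> \<not> g x"
      using fg set_Pi_pmf_subset[OF assms(1)] set_Pi_pmf_subset[OF assms(2)] by fastforce+
    then have "{x. if x \<in> I then f x else g x} = {x. f x} \<union> {x. g x}"
      using assms(3) by auto
    then show "(case fg of (f, g) \<Rightarrow> {x. if x \<in> I then f x else g x}) =
        (case fg of (f, g) \<Rightarrow> {x. f x} \<union> {x. g x})"
      by simp
  qed
  also have "\<dots> = map_pmf (\<lambda>(E, F). E \<union> F) (pair_pmf (random_subset I p) (random_subset J p))"
    by (simp add: random_subset_def map_pair[symmetric] pmf.map_comp o_def case_prod_unfold)
  finally show ?thesis .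
qed

lemma prob_pair_pmf_le:
  assumes "\<And>a. a \<in> set_pmf A \<Longrightarrow> measure_pmf.prob B {b. P a b} \<le> e" "0 \<le> e"
  shows "measure_pmf.prob (pair_pmf A B) {x. P (fst x) (snd x)} \<le> e"
proof -
  have "emeasure (pair_pmf A B) {x. P (fst x) (snd x)} =
      (\<integral>\<^sup>+x. indicator {x. P (fst x) (snd x)} x \<partial>pair_pmf A B)"
    by simp
  also have "\<dots> = (\<integral>\<^sup>+a. \<integral>\<^sup>+b. indicator {x. P (fst x) (snd x)} (a, b) \<partial>B \<partial>A)"
    by (rule nn_integral_pair_pmf')
  also have "\<dots> = (\<integral>\<^sup>+a. \<integral>\<^sup>+b. indicator {b. P a b} b \<partial>B \<partial>A)"
    by (simp add: indicator_def)
  also have "\<dots> = (\<integral>\<^sup>+a. emeasure B {b. P a b} \<partial>A)"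
    by simp
  also have "\<dots> \<le> (\<integral>\<^sup>+a. ennreal e \<partial>A)"
    by (intro nn_integral_mono_AE AE_pmfI)
      (use assms in \<open>auto simp: measure_pmf.emeasure_eq_measure\<close>)
  also have "\<dots> = ennreal e"
    by simp
  finally show ?thesis
    using assms(2) by (simp add: measure_pmf.emeasure_eq_measure)
qed

text \<open>
  Exposure in two steps: a bound that holds for every outcome of the coordinates outside \<open>J\<close> holds
  overall.
\<close>
lemma rprob_cond:
  assumes "finite I" "J \<subseteq> I" "\<And>E. E \<subseteq> I - J \<Longrightarrow> rprob J p (\<lambda>F. P (E \<union> F)) \<le> e" "0 \<le> e"
  shows "rprob I p P \<le> e"
proof -
  have IJ: "I = (I - J) \<union> J" and fin: "finite (I - J)" "finite J"
    using assms(1,2) by (auto intro: finite_subset)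
  have "rprob I p P = measure_pmf.prob (pair_pmf (random_subset (I - J) p) (random_subset J p))
      {x. P (fst x \<union> snd x)}"
    unfolding rprob_def by (subst IJ, subst random_subset_union)
      (use fin in \<open>auto simp: vimage_def case_prod_unfold\<close>)
  also have "\<dots> \<le> e"
  proof (rule prob_pair_pmf_le[where P = "\<lambda>a b. P (a \<union> b)"])
    fix a assume "a \<in> set_pmf (random_subset (I - J) p)"
    then have "a \<subseteq> I - J" using set_pmf_random_subset[OF fin(1)] by blast
    then show "measure_pmf.prob (random_subset J p) {b. P (a \<union> b)} \<le> e"
      using assms(3) by (simp add: rprob_def)
  qed fact
  finally show ?thesis .
qed

lemma prob_pair_pmf_Times:
  "measure_pmf.prob (pair_pmf M N) (A \<times> B) = measure_pmf.prob M A * measure_pmf.prob N B"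
proof -
  have "measure_pmf.prob (pair_pmf M N) (A \<times> B) =
      measure_pmf.prob (pair_pmf M N) ((A \<inter> set_pmf M) \<times> (B \<inter> set_pmf N))"
    by (subst (1 2) measure_Int_set_pmf[symmetric]) (auto intro!: arg_cong[where f = "measure _"])
  also have "\<dots> = measure_pmf.prob M (A \<inter> set_pmf M) * measure_pmf.prob N (B \<inter> set_pmf N)"
    by (rule measure_pmf_prob_product) (auto intro: countable_Int2)
  finally show ?thesis by (simp add: measure_Int_set_pmf)
qed

lemma rprob_prod:
  assumes "finite I" "finite J" "I \<inter> J = {}"
  shows "rprob (I \<union> J) p (\<lambda>E. P (E \<inter> I) \<and> Q (E \<inter> J)) = rprob I p P * rprob J p Q"
proof -
  let ?M = "pair_pmf (random_subset I p) (random_subset J p)"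
  have "rprob (I \<union> J) p (\<lambda>E. P (E \<inter> I) \<and> Q (E \<inter> J)) =
      measure_pmf.prob ?M {x. P ((fst x \<union> snd x) \<inter> I) \<and> Q ((fst x \<union> snd x) \<inter> J)}"
    unfolding rprob_def by (subst random_subset_union)
      (use assms in \<open>auto simp: vimage_def case_prod_unfold\<close>)
  also have "\<dots> = measure_pmf.prob ?M ({x. P ((fst x \<union> snd x) \<inter> I) \<and> Q ((fst x \<union> snd x) \<inter> J)} \<inter> set_pmf ?M)"
    by (simp only: measure_Int_set_pmf)
  also have "{x. P ((fst x \<union> snd x) \<inter> I) \<and> Q ((fst x \<union> snd x) \<inter> J)} \<inter> set_pmf ?M =
      ({E. P E} \<times> {E. Q E}) \<inter> set_pmf ?M"
  proof (intro set_eqI, goal_cases)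
    case (1 x)
    show ?case
    proof (cases "x \<in> set_pmf ?M")
      case True
      then have "fst x \<subseteq> I" "snd x \<subseteq> J"
        using set_pmf_random_subset[OF assms(1), of p] set_pmf_random_subset[OF assms(2), of p]
        by (auto simp: subset_iff)
      then have "(fst x \<union> snd x) \<inter> I = fst x" "(fst x \<union> snd x) \<inter> J = snd x"
        using assms(3) by auto
      then show ?thesis by (cases x) auto
    qed auto
  qed
  also have "measure_pmf.prob ?M \<dots> = measure_pmf.prob ?M ({E. P E} \<times> {E. Q E})"
    by (simp only: measure_Int_set_pmf)
  also have "\<dots> = rprob I p P * rprob J p Q"
    by (simp add: prob_pair_pmf_Times rprob_def)
  finally show ?thesis .
qed

lemma rprob_True [simp]: "rprob I p (\<lambda>_. True) = 1"
  by (simp add: rprob_def)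

text \<open>
  Coordinates on which the event does not depend can be dropped, because the two parts of a random
  subset are independent.
\<close>
lemma rprob_local:
  assumes "finite I" "J \<subseteq> I" "\<And>E. E \<subseteq> I \<Longrightarrow> P E = P (E \<inter> J)"
  shows "rprob I p P = rprob J p P"
proof -
  have IJ: "I = J \<union> (I - J)" and fin: "finite (I - J)" "finite J"
    using assms(1,2) by (auto intro: finite_subset)
  have "rprob I p P = rprob I p (\<lambda>E. P (E \<inter> J) \<and> True)"
    using assms by (intro rprob_cong) auto
  also have "\<dots> = rprob J p P"
    using rprob_prod[of J "I - J" p P "\<lambda>_. True"] fin IJ[symmetric] by auto
  finally show ?thesis .
qed

text \<open>
  Events that depend on disjoint blocks of coordinates are independent; only this half of the product
  formula is needed.
\<close>
lemma rprob_indep_le: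
  assumes "finite I" "finite X" "\<And>x. x \<in> X \<Longrightarrow> J x \<subseteq> I" "disjoint_family_on J X"
    and "\<And>x E. x \<in> X \<Longrightarrow> E \<subseteq> I \<Longrightarrow> P x E = P x (E \<inter> J x)"
    and "\<And>x. x \<in> X \<Longrightarrow> rprob I p (P x) \<le> e" "0 \<le> e"
  shows "rprob I p (\<lambda>E. \<forall>x\<in>X. P x E) \<le> e ^ card X"
  using assms(2-6)
proof (induction X rule: finite_induct)
  case (insert x X)
  define K where "K = (\<Union>y\<in>X. J y)"
  have disj: "J x \<inter> K = {}"
    using insert.prems(2) insert.hyps by (fastforce simp: disjoint_family_on_def K_def)
  have sub: "K \<subseteq> I" "J x \<subseteq> I"
    using insert.prems(1) by (auto simp: K_def)
  then have fin: "finite K" "finite (J x)"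
    using assms(1) by (auto intro: finite_subset)
  have loc: "P y (E \<inter> L) = P y E" if "y \<in> insert x X" "E \<subseteq> I" "J y \<subseteq> L" for y E L
  proof -
    have "P y (E \<inter> L) = P y (E \<inter> L \<inter> J y)" using insert.prems(3)[OF that(1), of "E \<inter> L"] that(2) by auto
    also have "E \<inter> L \<inter> J y = E \<inter> J y" using that(3) by auto
    also have "P y \<dots> = P y E" using insert.prems(3)[OF that(1,2)] by simp
    finally show ?thesis .
  qed
  have "rprob I p (\<lambda>E. \<forall>y\<in>insert x X. P y E) = rprob (J x \<union> K) p (\<lambda>E. \<forall>y\<in>insert x X. P y E)"
  proof (rule rprob_local)
    fix E assume "E \<subseteq> I"
    then show "(\<forall>y\<in>insert x X. P y E) = (\<forall>y\<in>insert x X. P y (E \<inter> (J x \<union> K)))"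
      by (intro ball_cong refl loc[symmetric]) (auto simp: K_def)
  qed (use sub assms(1) in auto)
  also have "\<dots> = rprob (J x \<union> K) p (\<lambda>E. P x (E \<inter> J x) \<and> (\<forall>y\<in>X. P y (E \<inter> K)))"
  proof (rule rprob_cong)
    fix E assume "E \<subseteq> J x \<union> K"
    then have E: "E \<subseteq> I" using sub by auto
    have "P x (E \<inter> J x) = P x E" by (rule loc) (use E in auto)
    moreover have "P y (E \<inter> K) = P y E" if "y \<in> X" for y
      by (rule loc) (use E that in \<open>auto simp: K_def\<close>)
    ultimately show "(\<forall>y\<in>insert x X. P y E) = (P x (E \<inter> J x) \<and> (\<forall>y\<in>X. P y (E \<inter> K)))"
      by auto
  qed (use fin in auto)
  also have "\<dots> = rprob (J x) p (P x) * rprob K p (\<lambda>E. \<forall>y\<in>X. P y E)"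
    by (rule rprob_prod[OF fin(2,1) disj])
  also have "rprob (J x) p (P x) = rprob I p (P x)"
    by (rule rprob_local[symmetric]) (use assms(1) insert.prems(3) sub in auto)
  also have "rprob K p (\<lambda>E. \<forall>y\<in>X. P y E) = rprob I p (\<lambda>E. \<forall>y\<in>X. P y E)"
  proof (rule rprob_local[symmetric])
    fix E assume "E \<subseteq> I"
    then show "(\<forall>y\<in>X. P y E) = (\<forall>y\<in>X. P y (E \<inter> K))"
      by (intro ball_cong refl loc[symmetric]) (auto simp: K_def)
  qed (use sub assms(1) in auto)
  also have "rprob I p (P x) * \<dots> \<le> e * e ^ card X"
    by (intro mult_mono insert.IH) (use insert.prems assms(7) in \<open>auto simp: disjoint_family_on_def\<close>)
  finally show ?case
    using insert.hyps by simp
qed simp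

text \<open>
  Union bound over the set of indices at which the event happens.  The factor \<open>2 ^ card X\<close> is harmless
  in the application, where \<open>e\<close> is a large negative power of \<open>n\<close>.
\<close>
lemma rprob_many_le:
  fixes k :: real
  assumes "finite I" "finite X" "\<And>x. x \<in> X \<Longrightarrow> J x \<subseteq> I" "disjoint_family_on J X"
    and "\<And>x E. x \<in> X \<Longrightarrow> E \<subseteq> I \<Longrightarrow> P x E = P x (E \<inter> J x)"
    and "\<And>x. x \<in> X \<Longrightarrow> rprob I p (P x) \<le> e" "0 < e" "e \<le> 1"
  shows "rprob I p (\<lambda>E. k \<le> real (card {x\<in>X. P x E})) \<le> 2 ^ card X * e powr k"
proof -
  have "rprob I p (\<lambda>E. k \<le> real (card {x\<in>X. P x E})) \<le>
      rprob I p (\<lambda>E. \<exists>Y\<in>{Y. Y \<subseteq> X \<and> k \<le> real (card Y)}. \<forall>x\<in>Y. P x E)"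
    by (rule rprob_mono[OF assms(1)], rule bexI[where x = "{x\<in>X. P x E}" for E]) auto
  also have "\<dots> \<le> 2 ^ card X * e powr k"
  proof (rule rprob_bex_le)
    show "finite {Y. Y \<subseteq> X \<and> k \<le> real (card Y)}" using assms(2) by auto
    have "card {Y. Y \<subseteq> X \<and> k \<le> real (card Y)} \<le> card (Pow X)"
      using assms(2) by (intro card_mono) auto
    then show "real (card {Y. Y \<subseteq> X \<and> k \<le> real (card Y)}) \<le> 2 ^ card X"
      using assms(2) by (simp add: card_Pow flip: of_nat_le_iff)
    fix Y assume Y: "Y \<in> {Y. Y \<subseteq> X \<and> k \<le> real (card Y)}"
    have YX: "Y \<subseteq> X" using Y by simp
    have "rprob I p (\<lambda>E. \<forall>x\<in>Y. P x E) \<le> e ^ card Y"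
    proof (rule rprob_indep_le[where J = J])
      show "finite Y" using YX assms(2) by (rule finite_subset)
      show "disjoint_family_on J Y" using disjoint_family_on_mono[OF YX assms(4)] .
      show "P x E = P x (E \<inter> J x)" if "x \<in> Y" "E \<subseteq> I" for x E
        using assms(5)[of x E] that YX by blast
    qed (use YX assms in auto)
    also have "\<dots> = e powr card Y"
      using assms by (simp add: powr_realpow)
    also have "\<dots> \<le> e powr k"
      using Y assms by (intro powr_mono') auto
    finally show "rprob I p (\<lambda>E. \<forall>x\<in>Y. P x E) \<le> e powr k" .
  qed auto
  finally show ?thesis .
qed

lemma rprob_subset:
  assumes "finite I" "F \<subseteq> I" "0 \<le> p" "p \<le> 1"
  shows "rprob I p (\<lambda>E. F \<subseteq> E) = p ^ card F"
proof -
  have fin: "finite F" using assms finite_subset by blast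
  have "rprob I p (\<lambda>E. F \<subseteq> E) = rprob F p (\<lambda>E. F \<subseteq> E)"
    by (rule rprob_local) (use assms in auto)
  also have "\<dots> = measure_pmf.prob (Pi_pmf F False (\<lambda>_. bernoulli_pmf p)) (Pi F (\<lambda>_. {True}))"
    unfolding rprob_def random_subset_def measure_map_pmf
    by (intro arg_cong2[where f = measure] refl) auto
  also have "\<dots> = p ^ card F"
    using assms by (simp add: measure_Pi_pmf_Pi[OF fin] measure_pmf_single)
  finally show ?thesis .
qed

lemma rprob_avoid:
  assumes "finite I" "F \<subseteq> I" "0 \<le> p" "p \<le> 1"
  shows "rprob I p (\<lambda>E. F \<inter> E = {}) = (1 - p) ^ card F"
proof -
  have fin: "finite F" using assms finite_subset by blast
  have "rprob I p (\<lambda>E. F \<inter> E = {}) = rprob F p (\<lambda>E. F \<inter> E = {})"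
    by (rule rprob_local) (use assms in auto)
  also have "\<dots> = measure_pmf.prob (Pi_pmf F False (\<lambda>_. bernoulli_pmf p)) (Pi F (\<lambda>_. {False}))"
    unfolding rprob_def random_subset_def measure_map_pmf
    by (intro arg_cong2[where f = measure] refl) auto
  also have "\<dots> = (1 - p) ^ card F"
    using assms by (simp add: measure_Pi_pmf_Pi[OF fin] measure_pmf_single)
  finally show ?thesis .
qed

lemma expectation_power_card:
  assumes "finite F" "0 \<le> p" "p \<le> 1" "0 \<le> z"
  shows "measure_pmf.expectation (random_subset F p) (\<lambda>E. z ^ card (E \<inter> F)) = (1 + p * (z - 1)) ^ card F"
proof -
  have eq: "z ^ card ({x. f x} \<inter> F) = (\<Prod>x\<in>F. if f x then z else 1)" for f
    using assms(1) by (simp add: prod.If_cases Int_commute)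
  have "measure_pmf.expectation (random_subset F p) (\<lambda>E. z ^ card (E \<inter> F)) =
      measure_pmf.expectation (Pi_pmf F False (\<lambda>_. bernoulli_pmf p)) (\<lambda>f. \<Prod>x\<in>F. if f x then z else 1)"
    by (simp add: random_subset_def eq)
  also have "\<dots> = (\<Prod>x\<in>F. measure_pmf.expectation (bernoulli_pmf p) (\<lambda>b. if b then z else 1))"
    by (rule expectation_prod_Pi_pmf)
      (use assms in \<open>auto intro!: integrable_measure_pmf_finite\<close>)
  also have "\<dots> = (1 + p * (z - 1)) ^ card F"
    using assms by (simp add: integral_bernoulli_pmf algebra_simps)
  finally show ?thesis .
qed

text \<open>
  First moments have the form of the left-hand side.  It is, up to the factor \<open>exp (2 t)\<close>, one term of the binomial
  expansion of \<open>(1 + exp 2 * q) ^ n\<close>, and \<open>exp 2 \<le> 9\<close>.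
\<close>
lemma choose_times_power_le:
  assumes "0 \<le> q" "9 * real n * q \<le> real t"
  shows "real (n choose t) * q ^ t \<le> exp (- real t)"
proof (cases "t \<le> n")
  case True
  have e2: "exp 2 \<le> (9 :: real)"
    using mult_mono[OF exp_le exp_le] by (simp flip: exp_add)
  have "real (n choose t) * (exp 2 * q) ^ t \<le> (\<Sum>k\<le>n. real (n choose k) * (exp 2 * q) ^ k)"
    using True assms(1) by (intro member_le_sum) auto
  also have "\<dots> = (exp 2 * q + 1) ^ n"
    by (subst binomial_ring) simp
  also have "\<dots> \<le> exp (exp 2 * q) ^ n"
    using assms(1) exp_ge_add_one_self[of "exp 2 * q"] by (intro power_mono) (auto simp: add.commute)
  also have "\<dots> = exp (real n * q * exp 2)"
    by (simp add: mult_ac flip: exp_of_nat_mult)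
  also have "\<dots> \<le> exp (real t)"
    using mult_left_mono[OF e2, of "real n * q"] assms by (simp add: mult_ac)
  finally have "real (n choose t) * q ^ t * exp (2 * real t) \<le> exp (real t)"
    by (simp add: power_mult_distrib mult_ac flip: exp_of_nat_mult)
  then have "real (n choose t) * q ^ t \<le> exp (real t) / exp (2 * real t)"
    by (simp add: field_simps)
  also have "\<dots> = exp (- real t)"
    by (simp flip: exp_diff)
  finally show ?thesis .
qed (simp add: binomial_eq_0)

text \<open>
  Markov's inequality for the moment generating function of the binomial variable \<open>card (E \<inter> F)\<close>.
\<close>
lemma rprob_card_moment:
  fixes p z c :: real
  assumes "finite I" "F \<subseteq> I" "0 \<le> p" "p \<le> 1" "0 < z"
    and "\<And>E. P E \<Longrightarrow> c \<le> z ^ card (E \<inter> F)" "0 < c"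
  shows "rprob I p P \<le> exp (p * (z - 1) * card F) / c"
proof -
  have fin: "finite F" using assms finite_subset by blast
  let ?M = "random_subset F p"
  have int: "integrable ?M (\<lambda>E. z ^ card (E \<inter> F))"
    using set_pmf_random_subset[OF fin, of p] fin
    by (intro integrable_measure_pmf_finite) (auto intro: finite_subset)
  have "rprob I p P \<le> rprob I p (\<lambda>E. c \<le> z ^ card (E \<inter> F))"
    by (rule rprob_mono[OF assms(1)]) (use assms in auto)
  also have "\<dots> = rprob F p (\<lambda>E. c \<le> z ^ card (E \<inter> F))"
    by (rule rprob_local) (use assms in \<open>auto simp: Int_assoc\<close>)
  also have "\<dots> \<le> measure_pmf.expectation ?M (\<lambda>E. z ^ card (E \<inter> F)) / c"
    unfolding rprob_def
    using integral_Markov_inequality_measure[OF int, of "{}" c] assms(5,7) by simp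
  also have "\<dots> = (1 + p * (z - 1)) ^ card F / c"
    using expectation_power_card[OF fin assms(3,4)] assms(5) by simp
  also have "\<dots> \<le> exp (p * (z - 1)) ^ card F / c"
  proof -
    have "0 \<le> (1 - p) + p * z" using assms by simp
    then have "0 \<le> 1 + p * (z - 1)" by (simp add: algebra_simps)
    then show ?thesis using assms(7) by (intro divide_right_mono power_mono exp_ge_add_one_self) auto
  qed
  also have "\<dots> = exp (p * (z - 1) * card F) / c"
    by (simp add: mult_ac flip: exp_of_nat_mult)
  finally show ?thesis .
qed

text \<open>
  The exponential moment bound at \<open>z = exp 2\<close>; the constant comes from \<open>exp 2 - 1 \<le> 8\<close>.
\<close>
lemma rprob_upper_tail:
  fixes p t :: real
  assumes "finite I" "F \<subseteq> I" "0 \<le> p" "p \<le> 1" "8 * p * card F \<le> t"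
  shows "rprob I p (\<lambda>E. t \<le> card (E \<inter> F)) \<le> exp (- t)"
proof -
  have e2: "exp 2 - 1 \<le> (8 :: real)"
    using mult_mono[OF exp_le exp_le] by (simp flip: exp_add)
  have "rprob I p (\<lambda>E. t \<le> card (E \<inter> F)) \<le> exp (p * (exp 2 - 1) * card F) / exp (2 * t)"
    by (rule rprob_card_moment) (use assms in \<open>auto simp flip: exp_of_nat_mult\<close>)
  also have "\<dots> \<le> exp t / exp (2 * t)"
    using mult_left_mono[OF e2, of "p * card F"] assms by (intro divide_right_mono) (auto simp: mult_ac)
  also have "\<dots> = exp (- t)" by (simp flip: exp_diff)
  finally show ?thesis .
qed

text \<open>
  The exponential moment bound at \<open>z = exp (- 1)\<close>, using \<open>exp (- 1) \<le> 4/9\<close>.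
\<close>
lemma rprob_lower_tail:
  fixes p :: real
  assumes "finite I" "F \<subseteq> I" "0 \<le> p" "p \<le> 1"
  shows "rprob I p (\<lambda>E. card (E \<inter> F) \<le> p * card F / 2) \<le> exp (- p * card F / 20)"
proof -
  have "3 / 2 \<le> exp (1 / 2 :: real)" using exp_ge_add_one_self[of "1/2 :: real"] by simp
  then have "(3/2) * (3/2) \<le> exp (1/2) * exp (1 / 2 :: real)" by (intro mult_mono) auto
  then have "9 / 4 \<le> exp (1 :: real)" by (simp flip: exp_add)
  then have e1: "exp (- 1) \<le> (4 / 9 :: real)" by (simp add: exp_minus field_simps)
  have "rprob I p (\<lambda>E. card (E \<inter> F) \<le> p * card F / 2)
      \<le> exp (p * (exp (- 1) - 1) * card F) / exp (- (p * card F / 2))"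
    by (rule rprob_card_moment) (use assms in \<open>auto simp flip: exp_of_nat_mult\<close>)
  also have "\<dots> = exp (p * card F * (exp (- 1) - 1 / 2))"
    by (simp add: algebra_simps flip: exp_diff exp_add)
  also have "\<dots> \<le> exp (p * card F * (- 1 / 20))"
    using e1 assms by (intro iffD2[OF exp_le_cancel_iff] mult_left_mono) auto
  finally show ?thesis by simp
qed

section \<open>Neighbourhoods and stars\<close>

definition nbrs :: "'a set set \<Rightarrow> 'a \<Rightarrow> 'a set" where
  "nbrs E v = {u. {v, u} \<in> E}"

definition star :: "'a \<Rightarrow> 'a set \<Rightarrow> 'a set set" where
  "star x Y = (\<lambda>u. {x, u}) ` Y"

lemma inj_pair: "inj_on (\<lambda>u. {x, u}) Y"
  by (auto simp: inj_on_def doubleton_eq_iff)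

lemma card_star [simp]: "card (star x Y) = card Y"
  by (simp add: star_def card_image inj_pair)

lemma card_Int_star: "card (E \<inter> star x Y) = card (Y \<inter> nbrs E x)"
proof -
  have "E \<inter> star x Y = (\<lambda>u. {x, u}) ` (Y \<inter> nbrs E x)"
    by (auto simp: star_def nbrs_def)
  then show ?thesis by (simp add: card_image inj_pair)
qed

lemma star_mono: "Y \<subseteq> Z \<Longrightarrow> star x Y \<subseteq> star x Z"
  by (auto simp: star_def)

lemma nbrs_Int_star: "Y \<subseteq> Z \<Longrightarrow> Y \<inter> nbrs (E \<inter> star x Z) x = Y \<inter> nbrs E x"
  by (auto simp: nbrs_def star_def)

lemma star_subset_iff: "star x Y \<subseteq> E \<longleftrightarrow> Y \<subseteq> nbrs E x"
  by (auto simp: star_def nbrs_def)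

lemma sym_nbrs: "u \<in> nbrs E v \<longleftrightarrow> v \<in> nbrs E u"
  by (simp add: nbrs_def insert_commute)

lemma card_Union_nsets2:
  assumes "M \<subseteq> nsets Y 2" "disjoint M" "finite M"
  shows "card (\<Union>M) = 2 * card M"
proof -
  have "card (\<Union>M) = (\<Sum>e\<in>M. card e)"
    using assms by (intro card_Union_disjoint) (auto simp: nsets_def disjnt_def disjoint_def pairwise_def)
  also have "\<dots> = (\<Sum>e\<in>M. 2)"
    using assms by (intro sum.cong) (auto simp: nsets_def)
  finally show ?thesis by simp
qed

text \<open>
  The vertices of a maximum matching form a cover.
\<close>
lemma obtain_vertex_cover:
  assumes "finite H" "H \<subseteq> nsets Y 2"
    and mat: "\<And>M. M \<subseteq> H \<Longrightarrow> disjoint M \<Longrightarrow> card M \<le> m"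
  obtains K where "K \<subseteq> Y" "finite K" "card K \<le> 2 * m" "\<And>e. e \<in> H \<Longrightarrow> e \<inter> K \<noteq> {}"
proof -
  define MM where "MM = {M. M \<subseteq> H \<and> disjoint M}"
  have "finite MM"
    by (rule finite_subset[of _ "Pow H"]) (use assms(1) in \<open>auto simp: MM_def\<close>)
  moreover have "{} \<in> MM" by (auto simp: MM_def)
  ultimately have "Max (card ` MM) \<in> card ` MM" by (intro Max_in) auto
  then obtain M where M: "M \<in> MM" and Mmax: "Max (card ` MM) = card M" by auto
  have max: "card N \<le> card M" if "N \<in> MM" for N
    using that \<open>finite MM\<close> by (simp flip: Mmax)
  have finM: "finite M" and MH: "M \<subseteq> H" and dM: "disjoint M"
    using M assms(1) by (auto simp: MM_def intro: finite_subset)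
  have MY: "M \<subseteq> nsets Y 2" using MH assms(2) by blast
  show thesis
  proof (rule that[of "\<Union>M"])
    show "\<Union>M \<subseteq> Y" "finite (\<Union>M)"
      using MY finM by (auto simp: nsets_def)
    show "card (\<Union>M) \<le> 2 * m"
      using card_Union_nsets2[OF MY dM finM] mat[OF MH dM] by simp
    fix e assume e: "e \<in> H"
    show "e \<inter> \<Union>M \<noteq> {}"
    proof
      assume no: "e \<inter> \<Union>M = {}"
      have "e \<noteq> {}" using e assms(2) by (auto simp: nsets_def)
      then have "e \<notin> M" using no by auto
      have "disjoint (insert e M)"
        using dM no by (auto simp: disjoint_def)
      then have "insert e M \<in> MM"
        using e MH by (simp add: MM_def)
      then show False using max[of "insert e M"] finM \<open>e \<notin> M\<close> by simp
    qed
  qed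
qed

text \<open>
  A non-isolated vertex belongs to a small vertex cover or is adjacent to it.
\<close>
lemma card_nonisolated_le:
  assumes "finite R" "H \<subseteq> nsets Y 2" "finite H"
    and mat: "\<And>M. M \<subseteq> H \<Longrightarrow> disjoint M \<Longrightarrow> \<Union>M \<subseteq> R \<Longrightarrow> card M \<le> m"
    and deg: "\<And>v. v \<in> R \<Longrightarrow> card (R \<inter> nbrs H v) \<le> c"
  shows "card {y\<in>R. \<exists>w\<in>R. {y, w} \<in> H} \<le> 2 * m * (1 + c)"
proof -
  let ?H = "{e\<in>H. e \<subseteq> R}"
  have H: "finite ?H" "?H \<subseteq> nsets R 2" using assms(2,3) by (auto simp: nsets_def)
  have m: "card M \<le> m" if "M \<subseteq> ?H" "disjoint M" for M
    by (rule mat) (use that in blast)+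
  obtain K where K: "K \<subseteq> R" "finite K" "card K \<le> 2 * m"
    and cover: "\<And>e. e \<in> ?H \<Longrightarrow> e \<inter> K \<noteq> {}"
    using obtain_vertex_cover[OF H m] by blast
  have "{y\<in>R. \<exists>w\<in>R. {y, w} \<in> H} \<subseteq> K \<union> (\<Union>v\<in>K. R \<inter> nbrs H v)"
  proof safe
    fix y w assume yw: "y \<in> R" "w \<in> R" "{y, w} \<in> H" and y: "y \<notin> (\<Union>v\<in>K. R \<inter> nbrs H v)"
    have "w \<notin> K" using y yw by (auto simp: nbrs_def insert_commute)
    then show "y \<in> K" using cover[of "{y, w}"] yw by auto
  qed
  then have "card {y\<in>R. \<exists>w\<in>R. {y, w} \<in> H} \<le> card (K \<union> (\<Union>v\<in>K. R \<inter> nbrs H v))"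
    using K(2) assms(1) by (intro card_mono) auto
  also have "\<dots> \<le> card K + card (\<Union>v\<in>K. R \<inter> nbrs H v)"
    by (rule card_Un_le)
  also have "card (\<Union>v\<in>K. R \<inter> nbrs H v) \<le> (\<Sum>v\<in>K. card (R \<inter> nbrs H v))"
    by (rule card_UN_le[OF K(2)])
  also have "\<dots> \<le> (\<Sum>v\<in>K. c)"
    by (rule sum_mono) (use deg K in auto)
  also have "card K + (\<Sum>v\<in>K. c) = card K * (1 + c)" by simp
  also have "\<dots> \<le> 2 * m * (1 + c)"
    using K(3) by (intro mult_right_mono) auto
  finally show ?thesis by simp
qed

text \<open>
  The neighbours of \<open>x\<close> in \<open>Y\<close> form a random subset of \<open>Y\<close> of density \<open>p\<close>.  It contains a given
  matching of size \<open>m\<close> with probability \<open>p ^ (2 * m)\<close>, and at least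
  \<open>c\<close> neighbours of a given vertex with probability at most \<open>exp (- c)\<close>; otherwise few of its vertices are non-isolated.
\<close>
lemma rprob_many_nonisolated:
  assumes I: "finite I" "star x Y \<subseteq> I" and p: "0 \<le> p" "p \<le> 1"
    and Y: "finite Y" "H \<subseteq> nsets Y 2"
    and m: "9 * real (card H) * p\<^sup>2 \<le> real m"
    and c: "\<And>y. y \<in> Y \<Longrightarrow> 8 * p * card (Y \<inter> nbrs H y) \<le> real c"
  shows "rprob I p (\<lambda>E. 2 * m * (1 + c) < card {y\<in>Y \<inter> nbrs E x. \<exists>w\<in>Y \<inter> nbrs E x. {y, w} \<in> H})
    \<le> exp (- real m) + real (card Y) * exp (- real c)"
proof -
  have finH: "finite H"
    using Y finite_imp_finite_nsets finite_subset by blast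
  define MM where "MM = {M. M \<subseteq> H \<and> card M = m \<and> disjoint M}"
  have "rprob I p (\<lambda>E. 2 * m * (1 + c) < card {y\<in>Y \<inter> nbrs E x. \<exists>w\<in>Y \<inter> nbrs E x. {y, w} \<in> H})
      \<le> rprob I p (\<lambda>E. (\<exists>M\<in>MM. star x (\<Union>M) \<subseteq> E) \<or>
          (\<exists>y\<in>Y. real c \<le> card (E \<inter> star x (Y \<inter> nbrs H y))))"
  proof (rule rprob_mono[OF I(1)], rule ccontr)
    fix E
    let ?R = "Y \<inter> nbrs E x"
    assume big: "2 * m * (1 + c) < card {y\<in>?R. \<exists>w\<in>?R. {y, w} \<in> H}"
    assume "\<not> ((\<exists>M\<in>MM. star x (\<Union>M) \<subseteq> E) \<or> (\<exists>y\<in>Y. real c \<le> card (E \<inter> star x (Y \<inter> nbrs H y))))"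
    then have noM: "\<And>M. M \<in> MM \<Longrightarrow> \<not> \<Union>M \<subseteq> nbrs E x"
      and nod: "\<And>y. y \<in> Y \<Longrightarrow> card (Y \<inter> nbrs H y \<inter> nbrs E x) < c"
      by (simp_all add: star_subset_iff card_Int_star not_le)
    have "card {y\<in>?R. \<exists>w\<in>?R. {y, w} \<in> H} \<le> 2 * m * (1 + c)"
    proof (rule card_nonisolated_le[OF _ Y(2) finH])
      fix M assume M: "M \<subseteq> H" "disjoint M" "\<Union>M \<subseteq> ?R"
      show "card M \<le> m"
      proof (rule ccontr)
        assume "\<not> card M \<le> m"
        then have "m \<le> card M" by simp
        then obtain N where N: "N \<subseteq> M" "card N = m"
          using obtain_subset_with_card_n[of m M] by metis
        have "N \<in> MM"
          using N M(1) pairwise_subset[OF M(2) N(1)] by (simp add: MM_def)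
        then show False using noM N M by blast
      qed
    next
      fix v assume "v \<in> ?R"
      then show "card (?R \<inter> nbrs H v) \<le> c"
        using nod[of v] by (simp add: Int_ac)
    qed (use Y in auto)
    then show False using big by simp
  qed
  also have "\<dots> \<le> rprob I p (\<lambda>E. \<exists>M\<in>MM. star x (\<Union>M) \<subseteq> E) +
      rprob I p (\<lambda>E. \<exists>y\<in>Y. real c \<le> card (E \<inter> star x (Y \<inter> nbrs H y)))"
    by (rule rprob_disj)
  also have "rprob I p (\<lambda>E. \<exists>M\<in>MM. star x (\<Union>M) \<subseteq> E) \<le> real (card H choose m) * (p\<^sup>2) ^ m"
  proof (rule rprob_bex_le)
    show "finite MM" by (rule finite_subset[of _ "Pow H"]) (use finH in \<open>auto simp: MM_def\<close>)
    have "card MM \<le> card {M. M \<subseteq> H \<and> card M = m}"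
      by (rule card_mono) (use finH in \<open>auto simp: MM_def\<close>)
    then show "real (card MM) \<le> real (card H choose m)"
      by (simp add: n_subsets[OF finH])
    fix M assume M: "M \<in> MM"
    have sub: "M \<subseteq> nsets Y 2" "finite M" "disjoint M" "card M = m"
      using M Y(2) finH by (auto simp: MM_def intro: finite_subset)
    have "\<Union>M \<subseteq> Y" using sub(1) by (auto simp: nsets_def)
    then have "star x (\<Union>M) \<subseteq> I"
      using I(2) star_mono[of "\<Union>M" Y x] by simp
    then have "rprob I p (\<lambda>E. star x (\<Union>M) \<subseteq> E) = p ^ card (star x (\<Union>M))"
      by (intro rprob_subset I p)
    also have "\<dots> = (p\<^sup>2) ^ m"
      using card_Union_nsets2[OF sub(1,3,2)] sub(4) by (simp add: power_mult)
    finally show "rprob I p (\<lambda>E. star x (\<Union>M) \<subseteq> E) \<le> (p\<^sup>2) ^ m" by simp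
  qed (use p in auto)
  also have "\<dots> \<le> exp (- real m)"
    by (rule choose_times_power_le) (use m p in auto)
  also have "rprob I p (\<lambda>E. \<exists>y\<in>Y. real c \<le> card (E \<inter> star x (Y \<inter> nbrs H y)))
      \<le> real (card Y) * exp (- real c)"
  proof (rule rprob_bex_le)
    fix y assume y: "y \<in> Y"
    show "rprob I p (\<lambda>E. real c \<le> card (E \<inter> star x (Y \<inter> nbrs H y))) \<le> exp (- real c)"
    proof (rule rprob_upper_tail)
      show "star x (Y \<inter> nbrs H y) \<subseteq> I" using I(2) star_mono[of "Y \<inter> nbrs H y" Y x] by auto
    qed (use I p c[OF y] in auto)
  qed (use Y in auto)
  finally show ?thesis by simp
qed

text \<open>
  The pairs that the vertex \<open>x\<close> contributes: \<open>T\<close> collects restrictions from outside, and the last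
  two conditions exclude that a vertex of \<open>Y\<close> or \<open>Z\<close> becomes a common neighbour of \<open>x\<close>, \<open>y\<close> and \<open>z\<close>,
  whatever the pairs between \<open>Y\<close> and \<open>Z\<close> turn out to be.
\<close>
definition row_pairs :: "'a set set \<Rightarrow> 'a \<Rightarrow> 'a set \<Rightarrow> 'a set \<Rightarrow> 'a set set \<Rightarrow> 'a set set \<Rightarrow> ('a \<Rightarrow> 'a set)
    \<Rightarrow> ('a \<times> 'a) set" where
  "row_pairs E x Y Z H K T = {(y, z). y \<in> Y \<inter> nbrs E x \<and> z \<in> Z \<inter> nbrs E x \<and> z \<in> T y \<and>
      \<not> (\<exists>w\<in>Y \<inter> nbrs E x. {y, w} \<in> H) \<and> \<not> (\<exists>w\<in>Z \<inter> nbrs E x. {z, w} \<in> K)}"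

lemma row_pairs_local:
  "row_pairs (E \<inter> star x (Y \<union> Z)) x Y Z H K T = row_pairs E x Y Z H K T"
  by (simp add: row_pairs_def nbrs_Int_star)

text \<open>
  By the lower tail bound, \<open>x\<close> has at least \<open>9/20 * p * a\<close> neighbours \<open>y\<close> that are typical for \<open>T\<close>, and
  for each of them at least \<open>9/20 * p * a\<close> neighbours \<open>z\<close> in \<open>T y\<close>.  At most \<open>p * a / 20\<close> of either kind are
  lost because they are non-isolated, and \<open>(9/20 - 1/20)\<^sup>2 = 4/25\<close>.
\<close>
lemma rprob_few_row_pairs:
  fixes p :: real and a :: nat
  assumes I: "finite I" "star x (Y \<union> Z) \<subseteq> I" and p: "0 \<le> p" "p \<le> 1"
    and Y: "finite Y" "card Y = a" "H \<subseteq> nsets Y 2" and Z: "finite Z" "card Z = a" "K \<subseteq> nsets Z 2"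
    and m: "9 * real (card H) * p\<^sup>2 \<le> real m" "9 * real (card K) * p\<^sup>2 \<le> real m"
    and c: "\<And>y. y \<in> Y \<Longrightarrow> 8 * p * card (Y \<inter> nbrs H y) \<le> real c"
      "\<And>z. z \<in> Z \<Longrightarrow> 8 * p * card (Z \<inter> nbrs K z) \<le> real c"
    and T: "\<And>y. y \<in> Y \<Longrightarrow> T y \<subseteq> Z" "9/10 * real a \<le> card {y\<in>Y. 9/10 * real a \<le> card (T y)}"
    and b: "real (2 * m * (1 + c)) \<le> p * a / 20"
  shows "rprob I p (\<lambda>E. real (card (row_pairs E x Y Z H K T)) < 4/25 * (p * a)\<^sup>2)
    \<le> 2 * exp (- real m) + 2 * real a * exp (- real c) + (real a + 1) * exp (- p * a / 25)"
proof -
  \<comment> \<open>The vertices of \<open>Y\<close> that are typical for \<open>T\<close>.\<close>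
  define Y' where "Y' = {y\<in>Y. 9/10 * real a \<le> card (T y)}"
  let ?NI = "\<lambda>E Y H. {y\<in>Y \<inter> nbrs E x. \<exists>w\<in>Y \<inter> nbrs E x. {y, w} \<in> H}"
  let ?b = "2 * m * (1 + c)"
  let ?few = "\<lambda>E Y. real (card (E \<inter> star x Y)) \<le> p * card (star x Y) / 2"
  have Y'Y: "Y' \<subseteq> Y" "finite Y'" and cY': "9/10 * real a \<le> card Y'"
    using T(2) Y(1) by (auto simp: Y'_def)
  have "rprob I p (\<lambda>E. real (card (row_pairs E x Y Z H K T)) < 4/25 * (p * a)\<^sup>2) \<le>
      rprob I p (\<lambda>E. (?b < card (?NI E Y H) \<or> ?b < card (?NI E Z K)) \<or>
         (?few E Y' \<or> (\<exists>y\<in>Y'. ?few E (T y))))"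
  proof (rule rprob_mono[OF I(1)], rule ccontr)
    fix E
    assume few: "real (card (row_pairs E x Y Z H K T)) < 4/25 * (p * a)\<^sup>2"
    assume "\<not> ((?b < card (?NI E Y H) \<or> ?b < card (?NI E Z K)) \<or>
         (?few E Y' \<or> (\<exists>y\<in>Y'. ?few E (T y))))"
    then have 1: "card (?NI E Y H) \<le> ?b" "card (?NI E Z K) \<le> ?b"
      and 2: "p * card Y' / 2 < card (Y' \<inter> nbrs E x)"
      and 3: "\<And>y. y \<in> Y' \<Longrightarrow> p * card (T y) / 2 < card (T y \<inter> nbrs E x)"
      by (auto simp: card_Int_star not_le not_less)
    have 4: "real (card (?NI E Y H)) \<le> p * a / 20" "real (card (?NI E Z K)) \<le> p * a / 20"
      using 1 b by (meson of_nat_le_iff order_trans)+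
    define A where "A = (Y' \<inter> nbrs E x) - ?NI E Y H"
    define B where "B = (\<lambda>y. (T y \<inter> nbrs E x) - ?NI E Z K)"
    have pa: "0 \<le> p * a" using p by simp
    have dA: "2/5 * (p * a) \<le> card A"
    proof -
      have "real (card (Y' \<inter> nbrs E x)) \<le> card A + card (?NI E Y H)"
        unfolding A_def using Y'Y Y(1) diff_card_le_card_Diff[of "?NI E Y H" "Y' \<inter> nbrs E x"] by simp
      moreover have "9/20 * (p * a) \<le> p * card Y' / 2"
        using mult_left_mono[OF cY' p(1)] by simp
      ultimately show ?thesis using 4(1) 2 by linarith
    qed
    have dB: "2/5 * (p * a) \<le> card (B y)" if "y \<in> A" for y
    proof -
      have y: "y \<in> Y'" using that by (auto simp: A_def)
      have "finite (T y)" using T(1)[of y] y Z(1) Y'Y by (auto intro: finite_subset)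
      then have "real (card (T y \<inter> nbrs E x)) \<le> card (B y) + card (?NI E Z K)"
        unfolding B_def using Z(1) diff_card_le_card_Diff[of "?NI E Z K" "T y \<inter> nbrs E x"] by simp
      moreover have "9/20 * (p * a) \<le> p * card (T y) / 2"
        using mult_left_mono[OF _ p(1), of "9/10 * real a" "card (T y)"] y by (simp add: Y'_def)
      ultimately show ?thesis using 4(2) 3[OF y] by linarith
    qed
    have finA: "finite A" using Y'Y by (auto simp: A_def)
    have finB: "finite (B y)" if "y \<in> A" for y
      using T(1)[of y] that Z(1) Y'Y by (auto simp: A_def B_def intro!: finite_Diff intro: finite_subset)
    have "Sigma A B \<subseteq> row_pairs E x Y Z H K T"
      using T(1) Y'Y by (fastforce simp: row_pairs_def A_def B_def)
    moreover have "finite (row_pairs E x Y Z H K T)"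
      by (rule finite_subset[of _ "Y \<times> Z"]) (use Y Z in \<open>auto simp: row_pairs_def\<close>)
    ultimately have "card (Sigma A B) \<le> card (row_pairs E x Y Z H K T)"
      by (rule card_mono[rotated])
    moreover have "4/25 * (p * a)\<^sup>2 \<le> card (Sigma A B)"
    proof -
      have "4/25 * (p * a)\<^sup>2 = (2/5 * (p * a)) * (2/5 * (p * a))" by (simp add: power2_eq_square)
      also have "\<dots> \<le> real (card A) * (2/5 * (p * a))"
        using dA pa by (intro mult_right_mono) auto
      also have "\<dots> = (\<Sum>y\<in>A. 2/5 * (p * a))" by simp
      also have "\<dots> \<le> (\<Sum>y\<in>A. real (card (B y)))"
        using dB by (rule sum_mono)
      also have "\<dots> = card (Sigma A B)"
        using finA finB by simp
      finally show ?thesis .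
    qed
    ultimately show False using few by simp
  qed
  also have "\<dots> \<le> (rprob I p (\<lambda>E. ?b < card (?NI E Y H)) + rprob I p (\<lambda>E. ?b < card (?NI E Z K))) +
      (rprob I p (\<lambda>E. ?few E Y') + rprob I p (\<lambda>E. \<exists>y\<in>Y'. ?few E (T y)))"
    by (intro order.trans[OF rprob_disj] add_mono) auto
  also have "rprob I p (\<lambda>E. ?b < card (?NI E Y H)) \<le> exp (- real m) + real a * exp (- real c)"
    using rprob_many_nonisolated[OF I(1) _ p Y(1,3) m(1) c(1), of x] I(2) Y(2) by (auto simp: star_def)
  also have "rprob I p (\<lambda>E. ?b < card (?NI E Z K)) \<le> exp (- real m) + real a * exp (- real c)"
    using rprob_many_nonisolated[OF I(1) _ p Z(1,3) m(2) c(2), of x] I(2) Z(2) by (auto simp: star_def)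
  also have few: "rprob I p (\<lambda>E. ?few E W) \<le> exp (- p * a / 25)"
    if W: "W \<subseteq> Y \<union> Z" "9/10 * real a \<le> card W" for W
  proof -
    have "rprob I p (\<lambda>E. ?few E W) \<le> exp (- p * card (star x W) / 20)"
      by (rule rprob_lower_tail) (use I p star_mono[OF W(1), of x] in auto)
    also have "\<dots> \<le> exp (- p * a / 25)"
      using mult_left_mono[OF W(2) p(1)] mult_nonneg_nonneg[OF p(1), of "real a"] by simp
    finally show ?thesis .
  qed
  then have "rprob I p (\<lambda>E. ?few E Y') \<le> exp (- p * a / 25)"
    using Y'Y cY' by auto
  also have "rprob I p (\<lambda>E. \<exists>y\<in>Y'. ?few E (T y)) \<le> real a * exp (- p * a / 25)"
  proof (rule rprob_bex_le)
    fix y assume "y \<in> Y'"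
    then show "rprob I p (\<lambda>E. ?few E (T y)) \<le> exp (- p * a / 25)"
      by (intro few) (use T(1) in \<open>auto simp: Y'_def\<close>)
  qed (use Y'Y Y card_mono[OF Y(1), of Y'] in auto)
  finally show ?thesis by (simp add: algebra_simps)
qed

section \<open>Maximal triangles across three given sets\<close>

text \<open>
  In a graph without loops the common neighbourhood avoids \<open>x\<close>, \<open>y\<close> and \<open>z\<close>, so the last condition
  expresses inclusion-maximality.
\<close>
definition maximal_triangle :: "'a set set \<Rightarrow> 'a \<Rightarrow> 'a \<Rightarrow> 'a \<Rightarrow> bool" where
  "maximal_triangle E x y z \<longleftrightarrow> {x, y} \<in> E \<and> {x, z} \<in> E \<and> {y, z} \<in> E \<and>
     nbrs E x \<inter> nbrs E y \<inter> nbrs E z = {}"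

definition bip :: "'a set \<Rightarrow> 'a set \<Rightarrow> 'a set set" where
  "bip X Y = (\<lambda>(x, y). {x, y}) ` (X \<times> Y)"

lemma inj_on_bip: "X \<inter> Y = {} \<Longrightarrow> inj_on (\<lambda>(x, y). {x, y}) (X \<times> Y)"
  by (fastforce simp: inj_on_def doubleton_eq_iff)

lemma card_bip: "X \<inter> Y = {} \<Longrightarrow> card (bip X Y) = card X * card Y"
  by (simp add: bip_def card_image inj_on_bip card_cartesian_product)

lemma bip_subset_nsets: "X \<subseteq> V \<Longrightarrow> Y \<subseteq> V \<Longrightarrow> X \<inter> Y = {} \<Longrightarrow> bip X Y \<subseteq> nsets V 2"
  by (auto simp: bip_def)

lemma star_subset_bip: "x \<in> X \<Longrightarrow> star x Y \<subseteq> bip X Y"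
  by (auto simp: star_def bip_def)

lemma nbrs_subset: "E \<subseteq> nsets V 2 \<Longrightarrow> nbrs E v \<subseteq> V"
  by (auto simp: nbrs_def dest!: subsetD)

lemma nbrs_irrefl: "E \<subseteq> nsets V 2 \<Longrightarrow> v \<notin> nbrs E v"
  by (auto simp: nbrs_def nsets_def)

lemma nbrs_Un: "nbrs (E \<union> F) v = nbrs E v \<union> nbrs F v"
  by (auto simp: nbrs_def)

lemma sum_degree_le:
  assumes "finite A" "E \<subseteq> nsets V 2"
  shows "(\<Sum>x\<in>A. card (A \<inter> nbrs E x)) \<le> 2 * card (E \<inter> nsets A 2)"
proof -
  let ?P = "SIGMA x:A. A \<inter> nbrs E x"
  let ?N = "E \<inter> nsets A 2"
  have fin: "finite ?N" using assms(1) finite_imp_finite_nsets by blast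
  have "?P \<subseteq> (\<Union>e\<in>?N. {xy. {fst xy, snd xy} = e})"
    using assms(2) by (fastforce simp: nbrs_def)
  moreover have c: "finite {xy. {fst xy, snd xy} = e} \<and> card {xy. {fst xy, snd xy} = e} \<le> 2"
    if "e \<in> ?N" for e
  proof -
    obtain u v where e: "e = {u, v}" using \<open>e \<in> ?N\<close> by (auto elim: nsets2_E)
    have "{xy. {fst xy, snd xy} = e} \<subseteq> {(u, v), (v, u)}"
      by (auto simp: e doubleton_eq_iff)
    then show ?thesis
      using card_mono[of "{(u, v), (v, u)}" "{xy. {fst xy, snd xy} = e}"]
        card_insert_le_m1[of 2 "{(v, u)}" "(u, v)"] by (auto intro: finite_subset)
  qed
  ultimately have "card ?P \<le> card (\<Union>e\<in>?N. {xy. {fst xy, snd xy} = e})"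
    using fin by (intro card_mono) auto
  also have "\<dots> \<le> (\<Sum>e\<in>?N. card {xy. {fst xy, snd xy} = e})"
    by (rule card_UN_le[OF fin])
  also have "\<dots> \<le> (\<Sum>e\<in>?N. 2)"
    using c by (intro sum_mono) auto
  finally show ?thesis using assms(1) by simp
qed

lemma card_ge_le_sum:
  fixes f :: "'a \<Rightarrow> nat" and t :: real
  assumes "finite A" "\<And>x. x \<in> B \<Longrightarrow> t \<le> f x" "B \<subseteq> A"
  shows "card B * t \<le> (\<Sum>x\<in>A. f x)"
proof -
  have "card B * t = (\<Sum>x\<in>B. t)" by simp
  also have "\<dots> \<le> (\<Sum>x\<in>B. real (f x))" using assms(2) by (rule sum_mono)
  also have "\<dots> \<le> (\<Sum>x\<in>A. real (f x))" using assms by (intro sum_mono2) auto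
  finally show ?thesis by simp
qed

text \<open>
  The three sets across which a maximal triangle is sought.  The pairs between \<open>A\<close> and \<open>Y \<union> Z\<close> are
  exposed after all others except those between \<open>Y\<close> and \<open>Z\<close>, which come last.
\<close>
locale three_parts =
  fixes V A Y Z :: "'a set" and a :: nat
  assumes finV: "finite V"
    and sub: "A \<subseteq> V" "Y \<subseteq> V" "Z \<subseteq> V"
    and disj: "A \<inter> Y = {}" "A \<inter> Z = {}" "Y \<inter> Z = {}"
    and card: "card A = a" "card Y = a" "card Z = a"
begin

abbreviation "W \<equiv> V - (A \<union> Y \<union> Z)"

text \<open>
  The \<open>z\<close> for which \<open>x\<close>, \<open>y\<close>, \<open>z\<close> have no common neighbour outside the three parts.
\<close>
definition open_pairs :: "'a set set \<Rightarrow> 'a \<Rightarrow> 'a \<Rightarrow> 'a set" where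
  "open_pairs E x y = {z\<in>Z. W \<inter> nbrs E x \<inter> nbrs E y \<inter> nbrs E z = {}}"

definition row :: "'a set set \<Rightarrow> 'a \<Rightarrow> ('a \<times> 'a) set" where
  "row E x = row_pairs E x Y Z (E \<inter> nsets Y 2) (E \<inter> nsets Z 2) (open_pairs E x)"

text \<open>
  A good pair closes a maximal triangle as soon as it is an edge, but goodness is already decided by
  the remaining pairs of vertices.
\<close>
definition good_pairs :: "'a set set \<Rightarrow> ('a \<times> 'a) set" where
  "good_pairs E = {(y, z). \<exists>x\<in>A. (y, z) \<in> row E x \<and> A \<inter> nbrs E x \<inter> nbrs E y \<inter> nbrs E z = {}}"

lemma fin: "finite A" "finite Y" "finite Z"
  using finV sub by (auto intro: finite_subset)

lemma row_subset: "row E x \<subseteq> (Y \<inter> nbrs E x) \<times> (Z \<inter> nbrs E x)"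
  by (auto simp: row_def row_pairs_def)

lemma good_pairs_subset: "good_pairs E \<subseteq> Y \<times> Z"
  using row_subset by (fastforce simp: good_pairs_def)

lemma finite_row: "finite (row E x)"
  by (rule finite_subset[OF row_subset]) (use fin in auto)

lemma finite_good_pairs: "finite (good_pairs E)"
  by (rule finite_subset[OF good_pairs_subset]) (use fin in auto)

lemma nbrs_bip_YZ:
  assumes "F \<subseteq> bip Y Z"
  shows "x \<notin> Y \<union> Z \<Longrightarrow> nbrs F x = {}" "y \<in> Y \<Longrightarrow> nbrs F y \<subseteq> Z" "z \<in> Z \<Longrightarrow> nbrs F z \<subseteq> Y"
  using assms disj by (auto simp: nbrs_def bip_def doubleton_eq_iff dest!: subsetD)

text \<open>
  No condition in the definition looks at a pair between \<open>Y\<close> and \<open>Z\<close>.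
\<close>
lemma good_pairs_local:
  assumes F: "F \<subseteq> bip Y Z"
  shows "good_pairs (E \<union> F) = good_pairs E"
proof -
  have A: "nbrs (E \<union> F) x = nbrs E x" if "x \<in> A" for x
    using nbrs_bip_YZ(1)[OF F, of x] that disj by (auto simp: nbrs_Un)
  have Y: "S \<inter> nbrs (E \<union> F) y = S \<inter> nbrs E y" if "y \<in> Y" "S \<inter> Z = {}" for y S
    using nbrs_bip_YZ(2)[OF F that(1)] that(2) by (auto simp: nbrs_Un)
  have Z: "S \<inter> nbrs (E \<union> F) z = S \<inter> nbrs E z" if "z \<in> Z" "S \<inter> Y = {}" for z S
    using nbrs_bip_YZ(3)[OF F that(1)] that(2) by (auto simp: nbrs_Un)
  have no: "F \<inter> nsets Y 2 = {}" "F \<inter> nsets Z 2 = {}"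
  proof -
    have "e \<notin> nsets Y 2 \<and> e \<notin> nsets Z 2" if eF: "e \<in> F" for e
    proof -
      obtain y z where "e = {y, z}" "y \<in> Y" "z \<in> Z"
        using subsetD[OF F eF] by (auto simp: bip_def)
      then show ?thesis using disj by auto
    qed
    then show "F \<inter> nsets Y 2 = {}" "F \<inter> nsets Z 2 = {}" by auto
  qed
  have op: "open_pairs (E \<union> F) x y = open_pairs E x y" if "x \<in> A" "y \<in> Y" for x y
  proof -
    have "W \<inter> nbrs (E \<union> F) x \<inter> nbrs (E \<union> F) y \<inter> nbrs (E \<union> F) z = W \<inter> nbrs E x \<inter> nbrs E y \<inter> nbrs E z"
      if "z \<in> Z" for z
    proof -
      have "W \<inter> nbrs (E \<union> F) y = W \<inter> nbrs E y" "W \<inter> nbrs (E \<union> F) z = W \<inter> nbrs E z"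
        by (rule Y[OF \<open>y \<in> Y\<close>], blast, rule Z[OF that], blast)
      then show ?thesis using A[OF \<open>x \<in> A\<close>] by blast
    qed
    then show ?thesis by (simp add: open_pairs_def cong: conj_cong)
  qed
  have ns: "(E \<union> F) \<inter> nsets Y 2 = E \<inter> nsets Y 2" "(E \<union> F) \<inter> nsets Z 2 = E \<inter> nsets Z 2"
    using no by blast+
  have row: "row (E \<union> F) x = row E x" if "x \<in> A" for x
    unfolding row_def row_pairs_def A[OF that] ns using op[OF that]
    by (simp cong: conj_cong)
  have last: "A \<inter> nbrs (E \<union> F) x \<inter> nbrs (E \<union> F) y \<inter> nbrs (E \<union> F) z = A \<inter> nbrs E x \<inter> nbrs E y \<inter> nbrs E z"
    if "x \<in> A" "y \<in> Y" "z \<in> Z" for x y z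
  proof -
    have "A \<inter> nbrs (E \<union> F) y = A \<inter> nbrs E y" "A \<inter> nbrs (E \<union> F) z = A \<inter> nbrs E z"
      by (rule Y[OF that(2) disj(2)], rule Z[OF that(3) disj(1)])
    then show ?thesis using A[OF \<open>x \<in> A\<close>] by blast
  qed
  have eq: "((y, z) \<in> row (E \<union> F) x \<and> A \<inter> nbrs (E \<union> F) x \<inter> nbrs (E \<union> F) y \<inter> nbrs (E \<union> F) z = {}) \<longleftrightarrow>
      ((y, z) \<in> row E x \<and> A \<inter> nbrs E x \<inter> nbrs E y \<inter> nbrs E z = {})" if x: "x \<in> A" for x y z
  proof (cases "(y, z) \<in> row E x")
    case True
    then have "y \<in> Y" "z \<in> Z" using row_subset[of E x] by auto
    then show ?thesis using row[OF x] last[OF x] by simp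
  qed (simp add: row[OF x])
  have "(\<exists>x\<in>A. (y, z) \<in> row (E \<union> F) x \<and> A \<inter> nbrs (E \<union> F) x \<inter> nbrs (E \<union> F) y \<inter> nbrs (E \<union> F) z = {}) \<longleftrightarrow>
      (\<exists>x\<in>A. (y, z) \<in> row E x \<and> A \<inter> nbrs E x \<inter> nbrs E y \<inter> nbrs E z = {})" for y z
    using eq by (rule bex_cong[OF refl])
  then show ?thesis
    unfolding good_pairs_def by presburger
qed

text \<open>
  A common neighbour would lie outside the parts, in \<open>A\<close>, in \<open>Y\<close> or in \<open>Z\<close>, and each of these
  possibilities is excluded by one condition on good pairs.
\<close>
lemma good_pair_maximal_triangle:
  assumes E: "E \<subseteq> nsets V 2" and yz: "(y, z) \<in> good_pairs E" "{y, z} \<in> E"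
  obtains x where "x \<in> A" "maximal_triangle E x y z"
proof -
  obtain x where x: "x \<in> A" "(y, z) \<in> row E x" "A \<inter> nbrs E x \<inter> nbrs E y \<inter> nbrs E z = {}"
    using yz by (auto simp: good_pairs_def)
  have xyz: "y \<in> Y" "z \<in> Z" "{x, y} \<in> E" "{x, z} \<in> E" "z \<in> open_pairs E x y"
    and Yx: "\<And>w. w \<in> Y \<Longrightarrow> w \<in> nbrs E x \<Longrightarrow> {y, w} \<notin> E \<inter> nsets Y 2"
    and Zx: "\<And>w. w \<in> Z \<Longrightarrow> w \<in> nbrs E x \<Longrightarrow> {z, w} \<notin> E \<inter> nsets Z 2"
    using x(2) by (auto simp: row_def row_pairs_def nbrs_def)
  have "w \<notin> nbrs E x \<inter> nbrs E y \<inter> nbrs E z" for w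
  proof
    assume w: "w \<in> nbrs E x \<inter> nbrs E y \<inter> nbrs E z"
    then have ne: "w \<noteq> y" "w \<noteq> z" "w \<in> V"
      using nbrs_irrefl[OF E] nbrs_subset[OF E] by auto
    consider "w \<in> W" | "w \<in> A" | "w \<in> Y" | "w \<in> Z" using ne(3) by blast
    then show False
    proof cases
      case 1
      then show ?thesis using w xyz(5) by (auto simp: open_pairs_def)
    next
      case 2
      then show ?thesis using w x(3) by auto
    next
      case 3
      then show ?thesis using w Yx[of w] xyz(1) ne by (auto simp: nbrs_def)
    next
      case 4
      then show ?thesis using w Zx[of w] xyz(2) ne by (auto simp: nbrs_def)
    qed
  qed
  then have "maximal_triangle E x y z"
    using xyz yz(2) by (auto simp: maximal_triangle_def)
  then show thesis using x(1) that by blast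
qed

definition codegrees_le :: "nat \<Rightarrow> 'a set set \<Rightarrow> bool" where
  "codegrees_le c E \<longleftrightarrow>
    (\<forall>x\<in>A. \<forall>w\<in>A. x \<noteq> w \<longrightarrow> card (Y \<inter> nbrs E x \<inter> nbrs E w) \<le> c \<and> card (Z \<inter> nbrs E x \<inter> nbrs E w) \<le> c) \<and>
    (\<forall>y\<in>Y. \<forall>z\<in>Z. card (A \<inter> nbrs E y \<inter> nbrs E z) \<le> c)"

text \<open>
  A good row loses at most \<open>c\<^sup>2\<close> pairs for each neighbour of \<open>x\<close> in \<open>A\<close>, which is little for all but
  a tenth of the \<open>x\<close> by the bound on the edges inside \<open>A\<close>.  So half of the rows keep \<open>(p a)\<^sup>2 / 10\<close> pairs.  A pair
  occurs in at most \<open>c\<close> rows, since these correspond to common neighbours in \<open>A\<close>.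
\<close>
lemma many_good_pairs:
  fixes p :: real
  assumes E: "E \<subseteq> nsets V 2" and p: "0 < p"
    and cod: "codegrees_le c E"
    and eA: "card (E \<inter> nsets A 2) \<le> 16 * p * (real a)\<^sup>2"
    and c: "320 * p * a * (real c)\<^sup>2 \<le> 3/50 * (p * a)\<^sup>2" "1 \<le> c"
    and rows: "4/5 * real a \<le> card {x\<in>A. 4/25 * (p * a)\<^sup>2 \<le> card (row E x)}"
  shows "a * (p * a)\<^sup>2 / (20 * c) \<le> card (good_pairs E)"
proof -
  define X0 where "X0 = {x\<in>A. 4/25 * (p * a)\<^sup>2 \<le> card (row E x)}"
  define X1 where "X1 = {x\<in>A. card (A \<inter> nbrs E x) \<le> 320 * p * a}"
  define G where "G = (\<lambda>x. {(y, z) \<in> row E x. A \<inter> nbrs E x \<inter> nbrs E y \<inter> nbrs E z = {}})"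
  have a0: "0 \<le> p * a" using p by simp
  \<comment> \<open>By the handshake lemma few \<open>x\<close> have degree above ten times the bound on the average degree in \<open>A\<close>.\<close>
  have cX1: "real (card (A - X1)) \<le> a / 10"
  proof (cases "a = 0")
    case True
    then show ?thesis using fin(1) card(1) by simp
  next
    case False
    have "card (A - X1) * (320 * p * a) \<le> (\<Sum>x\<in>A. card (A \<inter> nbrs E x))"
      by (rule card_ge_le_sum) (use fin in \<open>auto simp: X1_def\<close>)
    also have "\<dots> \<le> real (2 * card (E \<inter> nsets A 2))"
      using sum_degree_le[OF fin(1) E] by (rule of_nat_mono)
    also have "\<dots> \<le> 32 * p * (real a)\<^sup>2" using eA by simp
    finally have "card (A - X1) * (320 * (p * a)) \<le> (a / 10) * (320 * (p * a))"
      by (simp add: power2_eq_square mult_ac)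
    then show ?thesis
      using p False by (subst (asm) mult_le_cancel_right_pos) auto
  qed
  have "card A \<le> card (X0 \<inter> X1) + card (A - X0) + card (A - X1)"
  proof -
    have "A = (X0 \<inter> X1) \<union> (A - X0) \<union> (A - X1)" by (auto simp: X0_def X1_def)
    then show ?thesis
      using card_Un_le[of "(X0 \<inter> X1) \<union> (A - X0)" "A - X1"] card_Un_le[of "X0 \<inter> X1" "A - X0"] by simp
  qed
  moreover have "card (A - X0) = card A - card X0"
    by (rule card_Diff_subset) (use fin in \<open>auto simp: X0_def\<close>)
  moreover have "card X0 \<le> card A" by (rule card_mono) (use fin in \<open>auto simp: X0_def\<close>)
  ultimately have X01: "real a / 2 \<le> card (X0 \<inter> X1)"
    using cX1 rows card(1) unfolding X0_def[symmetric] by simp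
  have G: "(p * a)\<^sup>2 / 10 \<le> card (G x)" if x: "x \<in> X0 \<inter> X1" for x
  proof -
    have xA: "x \<in> A" using x by (auto simp: X0_def)
    define Bl where "Bl = (\<lambda>w. (Y \<inter> nbrs E x \<inter> nbrs E w) \<times> (Z \<inter> nbrs E x \<inter> nbrs E w))"
    have xx: "x \<notin> nbrs E x" using E by (rule nbrs_irrefl)
    have finN: "finite (A \<inter> nbrs E x)" using fin by simp
    have "row E x - G x \<subseteq> (\<Union>w\<in>A \<inter> nbrs E x. Bl w)"
    proof
      fix yz assume yz: "yz \<in> row E x - G x"
      obtain y z where [simp]: "yz = (y, z)" by (cases yz)
      obtain w where w: "w \<in> A" "w \<in> nbrs E x" "w \<in> nbrs E y" "w \<in> nbrs E z"
        using yz by (auto simp: G_def)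
      have "y \<in> nbrs E w" "z \<in> nbrs E w" using w sym_nbrs by metis+
      moreover have "y \<in> Y \<inter> nbrs E x" "z \<in> Z \<inter> nbrs E x"
        using yz row_subset[of E x] by auto
      ultimately show "yz \<in> (\<Union>w\<in>A \<inter> nbrs E x. Bl w)"
        using w(1,2) by (auto simp: Bl_def)
    qed
    then have "card (row E x - G x) \<le> card (\<Union>w\<in>A \<inter> nbrs E x. Bl w)"
      using finN fin by (intro card_mono) (auto simp: Bl_def)
    also have "\<dots> \<le> (\<Sum>w\<in>A \<inter> nbrs E x. card (Bl w))"
      by (rule card_UN_le[OF finN])
    also have "\<dots> \<le> (\<Sum>w\<in>A \<inter> nbrs E x. c * c)"
    proof (rule sum_mono)
      fix w assume "w \<in> A \<inter> nbrs E x"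
      then have "card (Y \<inter> nbrs E x \<inter> nbrs E w) \<le> c" "card (Z \<inter> nbrs E x \<inter> nbrs E w) \<le> c"
        using cod xA xx by (auto simp: codegrees_le_def)
      then show "card (Bl w) \<le> c * c"
        unfolding Bl_def by (simp add: card_cartesian_product mult_le_mono)
    qed
    finally have "real (card (row E x - G x)) \<le> card (A \<inter> nbrs E x) * (real c)\<^sup>2"
      by (simp add: power2_eq_square flip: of_nat_mult)
    also have "\<dots> \<le> 320 * p * a * (real c)\<^sup>2"
      using x by (intro mult_right_mono) (auto simp: X1_def)
    finally have "real (card (row E x - G x)) \<le> 3/50 * (p * a)\<^sup>2" using c(1) by linarith
    moreover have "card (row E x) \<le> card (row E x - G x) + card (G x)"
    proof -
      have "row E x = (row E x - G x) \<union> G x" by (auto simp: G_def)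
      then show ?thesis using card_Un_le[of "row E x - G x" "G x"] by simp
    qed
    moreover have "4/25 * (p * a)\<^sup>2 \<le> card (row E x)" using x by (auto simp: X0_def)
    ultimately show ?thesis by simp
  qed
  have finG: "finite (G x)" for x
    by (rule finite_subset[OF _ finite_row]) (auto simp: G_def)
  \<comment> \<open>Double counting of the incidences between rows and good pairs.\<close>
  let ?T = "SIGMA yz:good_pairs E. A \<inter> nbrs E (fst yz) \<inter> nbrs E (snd yz)"
  have "a / 2 * ((p * a)\<^sup>2 / 10) \<le> card (X0 \<inter> X1) * ((p * a)\<^sup>2 / 10)"
    using X01 by (intro mult_right_mono) auto
  also have "\<dots> \<le> (\<Sum>x\<in>X0 \<inter> X1. card (G x))"
    by (rule card_ge_le_sum) (use fin G in \<open>auto simp: X0_def\<close>)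
  also have "(\<Sum>x\<in>X0 \<inter> X1. card (G x)) = card (SIGMA x:X0 \<inter> X1. G x)"
    using finG fin by (intro card_SigmaI[symmetric]) (auto simp: X0_def)
  also have "real \<dots> \<le> card ?T"
  proof (intro of_nat_mono card_inj_on_le[where f = "\<lambda>(x, yz). (yz, x)"])
    show "(\<lambda>(x, yz). (yz, x)) ` (SIGMA x:X0 \<inter> X1. G x) \<subseteq> ?T"
    proof
      fix t assume "t \<in> (\<lambda>(x, yz). (yz, x)) ` (SIGMA x:X0 \<inter> X1. G x)"
      then obtain x y z where t: "t = ((y, z), x)" and x: "x \<in> X0" and yz: "(y, z) \<in> G x"
        by auto
      have "y \<in> nbrs E x" "z \<in> nbrs E x" and xA: "x \<in> A"
        using yz x row_subset[of E x] by (auto simp: G_def X0_def)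
      then have "x \<in> nbrs E y" "x \<in> nbrs E z" using sym_nbrs by metis+
      moreover have "(y, z) \<in> good_pairs E"
        using yz xA by (auto simp: G_def good_pairs_def)
      ultimately show "t \<in> ?T" using xA by (simp add: t)
    qed
    show "finite ?T" using finite_good_pairs fin by auto
  qed (auto simp: inj_on_def)
  also have "card ?T = (\<Sum>yz\<in>good_pairs E. card (A \<inter> nbrs E (fst yz) \<inter> nbrs E (snd yz)))"
    using finite_good_pairs fin by (intro card_SigmaI) auto
  also have "real \<dots> \<le> real (\<Sum>yz\<in>good_pairs E. c)"
  proof (intro of_nat_mono sum_mono)
    fix yz assume "yz \<in> good_pairs E"
    then have "fst yz \<in> Y" "snd yz \<in> Z" using good_pairs_subset[of E] by auto
    then show "card (A \<inter> nbrs E (fst yz) \<inter> nbrs E (snd yz)) \<le> c"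
      using cod by (simp add: codegrees_le_def)
  qed
  also have "\<dots> = card (good_pairs E) * real c" by simp
  finally have "a * (p * a)\<^sup>2 / 20 \<le> card (good_pairs E) * real c" by simp
  then show ?thesis using c(2) by (simp add: field_simps)
qed

text \<open>
  The pairs between \<open>Y\<close> and \<open>Z\<close> are exposed last and must avoid all good pairs.
\<close>
lemma rprob_good_pairs_no_triangle:
  fixes p M :: real
  assumes p: "0 \<le> p" "p \<le> 1"
  shows "rprob (nsets V 2) p (\<lambda>E. M \<le> card (good_pairs E) \<and>
      (\<forall>x\<in>A. \<forall>y\<in>Y. \<forall>z\<in>Z. \<not> maximal_triangle E x y z)) \<le> exp (- p * M)"
proof (rule rprob_cond)
  show "finite (nsets V 2)" using finV by (rule finite_imp_finite_nsets)
  show J: "bip Y Z \<subseteq> nsets V 2" using sub disj by (intro bip_subset_nsets)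
  fix E assume E: "E \<subseteq> nsets V 2 - bip Y Z"
  let ?g = "good_pairs E"
  let ?F = "(\<lambda>(y, z). {y, z}) ` ?g"
  have finJ: "finite (bip Y Z)" using J finV finite_imp_finite_nsets finite_subset by blast
  show "rprob (bip Y Z) p (\<lambda>F. M \<le> card (good_pairs (E \<union> F)) \<and>
      (\<forall>x\<in>A. \<forall>y\<in>Y. \<forall>z\<in>Z. \<not> maximal_triangle (E \<union> F) x y z)) \<le> exp (- p * M)" (is "?lhs \<le> _")
  proof (cases "M \<le> card ?g")
    case True
    have "?lhs \<le> rprob (bip Y Z) p (\<lambda>F. ?F \<inter> F = {})"
    proof (rule rprob_mono[OF finJ], elim conjE)
      fix F assume F: "F \<subseteq> bip Y Z"
        and no: "\<forall>x\<in>A. \<forall>y\<in>Y. \<forall>z\<in>Z. \<not> maximal_triangle (E \<union> F) x y z"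
      have EF: "E \<union> F \<subseteq> nsets V 2" using E F J by blast
      show "?F \<inter> F = {}"
      proof (rule ccontr)
        assume "?F \<inter> F \<noteq> {}"
        then obtain y z where yz: "(y, z) \<in> ?g" "{y, z} \<in> F" by auto
        then have "(y, z) \<in> good_pairs (E \<union> F)" "{y, z} \<in> E \<union> F"
          using good_pairs_local[OF F] by auto
        then obtain x where "x \<in> A" "maximal_triangle (E \<union> F) x y z"
          using good_pair_maximal_triangle[OF EF] by blast
        then show False using no good_pairs_subset[of E] yz by blast
      qed
    qed
    also have "\<dots> = (1 - p) ^ card ?F"
      by (rule rprob_avoid) (use finJ p good_pairs_subset[of E] in \<open>auto simp: bip_def\<close>)
    also have "card ?F = card ?g"
      using inj_on_subset[OF inj_on_bip[OF disj(3)] good_pairs_subset] by (rule card_image)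
    also have "(1 - p) ^ card ?g \<le> exp (- p) ^ card ?g"
      using p exp_ge_add_one_self[of "- p"] by (intro power_mono) auto
    also have "\<dots> = exp (- (p * card ?g))"
      by (simp add: mult_ac flip: exp_of_nat_mult)
    also have "\<dots> \<le> exp (- p * M)"
      using True p by (simp add: mult_left_mono)
    finally show ?thesis .
  next
    case False
    have "?lhs \<le> rprob (bip Y Z) p (\<lambda>F. False)"
      by (rule rprob_mono[OF finJ]) (use False good_pairs_local in auto)
    then show ?thesis by (simp add: rprob_def order_trans)
  qed
qed simp

end

context three_parts
begin

text \<open>
  The sum counts the triples across the parts, each weighted by its number of common neighbours outside.
\<close>
definition light :: "'a set set \<Rightarrow> bool" where
  "light E \<longleftrightarrow> real (\<Sum>w\<in>W. card (A \<inter> nbrs E w) * card (Y \<inter> nbrs E w) * card (Z \<inter> nbrs E w))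
     \<le> real a ^ 3 / 1000"

definition thin :: "real \<Rightarrow> 'a set set \<Rightarrow> bool" where
  "thin p E \<longleftrightarrow> (\<forall>S\<in>{A, Y, Z}. real (card (E \<inter> nsets S 2)) \<le> 16 * p * (real a)\<^sup>2) \<and>
     (\<forall>S\<in>{Y, Z}. \<forall>v\<in>S. p * real (card (S \<inter> nbrs E v)) \<le> 1)"

text \<open>
  If more than a tenth of the \<open>x\<close> were untypical, each would be in at least \<open>a\<^sup>2 / 100\<close> triples that have a
  common neighbour outside, too many in total.
\<close>
lemma card_untypical_le:
  assumes "light E"
  shows "real (card (A - {x\<in>A. 9/10 * real a \<le> card {y\<in>Y. 9/10 * real a \<le> card (open_pairs E x y)}})) \<le> a / 10"
proof (cases "a = 0")
  case True
  then show ?thesis using fin(1) card(1) by simp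
next
  case False
  define B where "B = A - {x\<in>A. 9/10 * real a \<le> card {y\<in>Y. 9/10 * real a \<le> card (open_pairs E x y)}}"
  define D where "D = (\<lambda>x. SIGMA y:Y. Z - open_pairs E x y)"
  have sub: "open_pairs E x y \<subseteq> Z" for x y by (auto simp: open_pairs_def)
  have finD: "finite (D x)" for x using fin by (simp add: D_def)
  have D: "a / 10 * (a / 10) \<le> card (D x)" if "x \<in> B" for x
  proof -
    let ?G = "{y\<in>Y. 9/10 * real a \<le> card (open_pairs E x y)}"
    have "card ?G < 9/10 * real a" using that by (auto simp: B_def)
    moreover have "card (Y - ?G) = card Y - card ?G" "card ?G \<le> card Y"
      using fin by (auto intro!: card_Diff_subset card_mono)
    ultimately have YG: "a / 10 \<le> card (Y - ?G)" using card(2) by simp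
    have "a / 10 \<le> card (Z - open_pairs E x y)" if "y \<in> Y - ?G" for y
    proof -
      have "card (Z - open_pairs E x y) = card Z - card (open_pairs E x y)" "card (open_pairs E x y) \<le> card Z"
        using fin sub by (auto intro!: card_Diff_subset card_mono intro: finite_subset)
      then show ?thesis using that card(3) by auto
    qed
    then have "card (Y - ?G) * (a / 10) \<le> (\<Sum>y\<in>Y. card (Z - open_pairs E x y))"
      by (intro card_ge_le_sum) (use fin in auto)
    also have "(\<Sum>y\<in>Y. card (Z - open_pairs E x y)) = card (D x)"
      unfolding D_def using fin by (intro card_SigmaI[symmetric]) auto
    finally show ?thesis
      using mult_right_mono[OF YG, of "a / 10"] by simp
  qed
  have finW: "finite W" using finV by simp
  have "card B * (a / 10 * (a / 10)) \<le> (\<Sum>x\<in>A. card (D x))"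
    by (rule card_ge_le_sum) (use fin D in \<open>auto simp: B_def\<close>)
  also have "(\<Sum>x\<in>A. card (D x)) = card (Sigma A D)"
    using fin finD by (intro card_SigmaI[symmetric]) auto
  also have "card (Sigma A D) \<le> card (\<Union>w\<in>W. (A \<inter> nbrs E w) \<times> (Y \<inter> nbrs E w) \<times> (Z \<inter> nbrs E w))"
    using fin finW by (intro card_mono) (fastforce simp: D_def open_pairs_def sym_nbrs)+
  also have "\<dots> \<le> (\<Sum>w\<in>W. card ((A \<inter> nbrs E w) \<times> (Y \<inter> nbrs E w) \<times> (Z \<inter> nbrs E w)))"
    by (rule card_UN_le[OF finW])
  also have "\<dots> = (\<Sum>w\<in>W. card (A \<inter> nbrs E w) * card (Y \<inter> nbrs E w) * card (Z \<inter> nbrs E w))"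
    by (simp add: card_cartesian_product mult.assoc)
  also have "real \<dots> \<le> real a ^ 3 / 1000" using assms by (simp add: light_def)
  finally have "card B * (a / 10 * (a / 10)) \<le> (a / 10) * (a / 10 * (a / 10))"
    by (simp add: power3_eq_cube)
  then show ?thesis
    using False unfolding B_def[symmetric] by (subst (asm) mult_le_cancel_right_pos) auto
qed

text \<open>
  What was known before the exposure of the pairs between \<open>A\<close> and \<open>Y \<union> Z\<close> is not affected by it, and
  the neighbours of \<open>x\<close> in \<open>Y\<close> and \<open>Z\<close> come from it alone.
\<close>
lemma bip_A_local:
  assumes E: "E \<inter> bip A (Y \<union> Z) = {}" and F: "F \<subseteq> bip A (Y \<union> Z)"
  shows "W \<inter> nbrs (E \<union> F) v = W \<inter> nbrs E v"
    and "w \<in> W \<Longrightarrow> nbrs (E \<union> F) w = nbrs E w"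
    and "S \<in> {A, Y, Z} \<Longrightarrow> (E \<union> F) \<inter> nsets S 2 = E \<inter> nsets S 2"
    and "S \<in> {Y, Z} \<Longrightarrow> v \<in> S \<Longrightarrow> S \<inter> nbrs (E \<union> F) v = S \<inter> nbrs E v"
    and "x \<in> A \<Longrightarrow> S \<in> {Y, Z} \<Longrightarrow> S \<inter> nbrs (E \<union> F) x = S \<inter> nbrs F x"
proof -
  have ob: "\<exists>x y. e = {x, y} \<and> x \<in> A \<and> y \<in> Y \<union> Z" if "e \<in> F" for e
    using subsetD[OF F that] by (auto simp: bip_def)
  have cases: "u \<in> A \<and> v \<in> Y \<union> Z \<or> v \<in> A \<and> u \<in> Y \<union> Z" if "{u, v} \<in> F" for u v
    using ob[OF that] by (auto simp: doubleton_eq_iff)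
  show "W \<inter> nbrs (E \<union> F) v = W \<inter> nbrs E v"
    using cases by (auto simp: nbrs_def)
  show "w \<in> W \<Longrightarrow> nbrs (E \<union> F) w = nbrs E w"
    using cases by (auto simp: nbrs_def)
  show "(E \<union> F) \<inter> nsets S 2 = E \<inter> nsets S 2" if S: "S \<in> {A, Y, Z}"
  proof -
    have "e \<notin> nsets S 2" if eF: "e \<in> F" for e
    proof -
      obtain x y where e: "e = {x, y}" "x \<in> A" "y \<in> Y \<union> Z" using ob[OF eF] by blast
      show ?thesis using e S disj by (simp; blast)
    qed
    then show ?thesis by blast
  qed
  show "S \<inter> nbrs (E \<union> F) v = S \<inter> nbrs E v" if "S \<in> {Y, Z}" "v \<in> S"
  proof -
    have "{v, u} \<notin> F" if "u \<in> S" for u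
      using cases[of v u] that \<open>v \<in> S\<close> \<open>S \<in> {Y, Z}\<close> disj by blast
    then show ?thesis by (auto simp: nbrs_def)
  qed
  show "S \<inter> nbrs (E \<union> F) x = S \<inter> nbrs F x" if "x \<in> A" "S \<in> {Y, Z}"
  proof -
    have "{x, u} \<notin> E" if "u \<in> S" for u
      using E \<open>x \<in> A\<close> \<open>S \<in> {Y, Z}\<close> that by (auto simp: bip_def)
    then show ?thesis by (auto simp: nbrs_def)
  qed
qed

text \<open>
  Given everything else, the rows of different \<open>x\<close> depend on disjoint stars.  If there are too few good rows, at least
  \<open>a / 10\<close> rows of typical vertices fail.
\<close>
lemma rprob_few_good_rows:
  fixes p d :: real and m c :: nat
  assumes p: "0 \<le> p" "p \<le> 1"
    and m: "144 * (p * a)\<^sup>2 * p \<le> real m" and c: "8 \<le> c"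
    and b: "real (2 * m * (1 + c)) \<le> p * a / 20"
    and d: "2 * exp (- real m) + 2 * real a * exp (- real c) + (real a + 1) * exp (- p * a / 25) \<le> d" "d \<le> 1"
  shows "rprob (nsets V 2) p (\<lambda>E. light E \<and> thin p E \<and>
      real (card {x\<in>A. 4/25 * (p * a)\<^sup>2 \<le> card (row E x)}) < 4/5 * real a) \<le> 2 ^ a * d powr (a / 10)"
proof (rule rprob_cond)
  let ?J = "bip A (Y \<union> Z)"
  show fV: "finite (nsets V 2)" using finV by (rule finite_imp_finite_nsets)
  show J: "?J \<subseteq> nsets V 2" using sub disj by (intro bip_subset_nsets) auto
  have finJ: "finite ?J" using J fV finite_subset by blast
  have d0: "0 < d"
  proof -
    have "0 < 2 * exp (- real m) + 2 * real a * exp (- real c) + (real a + 1) * exp (- p * a / 25)"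
      by (intro add_pos_nonneg mult_nonneg_nonneg) auto
    then show ?thesis using d(1) by linarith
  qed
  show "0 \<le> 2 ^ a * d powr (a / 10)" by simp
  fix E assume E': "E \<subseteq> nsets V 2 - ?J"
  then have E: "E \<inter> ?J = {}" "E \<subseteq> nsets V 2" by auto
  note loc = bip_A_local[OF E(1)]
  let ?bad = "\<lambda>F. light (E \<union> F) \<and> thin p (E \<union> F) \<and>
      real (card {x\<in>A. 4/25 * (p * a)\<^sup>2 \<le> card (row (E \<union> F) x)}) < 4/5 * real a"
  show "rprob ?J p ?bad \<le> 2 ^ a * d powr (a / 10)"
  proof (cases "light E \<and> thin p E")
    case False
    have "light (E \<union> F) = light E" "thin p (E \<union> F) = thin p E" if "F \<subseteq> ?J" for F
      using loc(2)[OF that] loc(3)[OF that] loc(4)[OF that]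
      by (simp_all add: light_def thin_def)
    then have "rprob ?J p ?bad \<le> rprob ?J p (\<lambda>F. False)"
      by (intro rprob_mono[OF finJ]) (use False in auto)
    then show ?thesis using d0 by (simp add: rprob_def order_trans)
  next
    case True
    then have light: "light E" and thin: "thin p E" by auto
    define A1 where "A1 = {x\<in>A. 9/10 * real a \<le> card {y\<in>Y. 9/10 * real a \<le> card (open_pairs E x y)}}"
    define R where "R = (\<lambda>x F. row_pairs F x Y Z (E \<inter> nsets Y 2) (E \<inter> nsets Z 2) (open_pairs E x))"
    let ?few = "\<lambda>x F. real (card (R x F)) < 4/25 * (p * a)\<^sup>2"
    have A1A: "A1 \<subseteq> A" by (auto simp: A1_def)
    have finA1: "finite A1" "card A1 \<le> a" using A1A fin card(1) card_mono finite_subset by auto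
    have untyp: "real (card (A - A1)) \<le> a / 10"
      unfolding A1_def by (rule card_untypical_le[OF light])
    have row: "row (E \<union> F) x = R x F" if F: "F \<subseteq> ?J" and x: "x \<in> A" for F x
    proof -
      have "open_pairs (E \<union> F) x y = open_pairs E x y" for y
      proof -
        have "W \<inter> nbrs (E \<union> F) x \<inter> nbrs (E \<union> F) y \<inter> nbrs (E \<union> F) z = W \<inter> nbrs E x \<inter> nbrs E y \<inter> nbrs E z" for z
          using loc(1)[OF F, of x] loc(1)[OF F, of y] loc(1)[OF F, of z] by blast
        then show ?thesis by (simp add: open_pairs_def)
      qed
      then show ?thesis
        unfolding row_def R_def row_pairs_def using loc(3)[OF F] loc(5)[OF F x]
        by simp
    qed
    have "rprob ?J p ?bad \<le> rprob ?J p (\<lambda>F. a / 10 \<le> card {x\<in>A1. ?few x F})"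
    proof (rule rprob_mono[OF finJ])
      fix F assume F: "F \<subseteq> ?J" and bad: "?bad F"
      let ?G = "{x\<in>A. 4/25 * (p * a)\<^sup>2 \<le> card (row (E \<union> F) x)}"
      have "A \<subseteq> ?G \<union> ((A - A1) \<union> {x\<in>A1. ?few x F})"
        using row[OF F] by (auto simp: not_le)
      then have "card A \<le> card (?G \<union> ((A - A1) \<union> {x\<in>A1. ?few x F}))"
        using fin finA1 by (intro card_mono) auto
      also have "\<dots> \<le> card ?G + (card (A - A1) + card {x\<in>A1. ?few x F})"
        using card_Un_le[of ?G "(A - A1) \<union> {x\<in>A1. ?few x F}"] card_Un_le[of "A - A1" "{x\<in>A1. ?few x F}"] by linarith
      finally have "real a \<le> card ?G + (card (A - A1) + card {x\<in>A1. ?few x F})"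
        using card(1) by linarith
      then show "a / 10 \<le> card {x\<in>A1. ?few x F}"
        using bad untyp by linarith
    qed
    also have "\<dots> \<le> 2 ^ card A1 * d powr (a / 10)"
    proof (rule rprob_many_le[OF finJ finA1(1), where J = "\<lambda>x. star x (Y \<union> Z)"])
      show "star x (Y \<union> Z) \<subseteq> ?J" if "x \<in> A1" for x
        using that A1A by (intro star_subset_bip) auto
      show "disjoint_family_on (\<lambda>x. star x (Y \<union> Z)) A1"
        using A1A disj by (auto simp: disjoint_family_on_def star_def doubleton_eq_iff)
      show "?few x F = ?few x (F \<inter> star x (Y \<union> Z))" for x F
        by (simp add: R_def row_pairs_local)
      fix x assume x: "x \<in> A1"
      have cE: "9 * real (card (E \<inter> nsets S 2)) * p\<^sup>2 \<le> real m" if "S \<in> {Y, Z}" for S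
      proof -
        have "real (card (E \<inter> nsets S 2)) \<le> 16 * p * (real a)\<^sup>2"
          using thin that by (auto simp: thin_def)
        then have "9 * real (card (E \<inter> nsets S 2)) * p\<^sup>2 \<le> 9 * (16 * p * (real a)\<^sup>2) * p\<^sup>2"
          by (intro mult_right_mono mult_left_mono) auto
        also have "\<dots> \<le> real m" using m by (simp add: power2_eq_square mult_ac)
        finally show ?thesis .
      qed
      have deg: "8 * p * card (S \<inter> nbrs (E \<inter> nsets S 2) v) \<le> real c" if "S \<in> {Y, Z}" "v \<in> S" for S v
      proof -
        have "card (S \<inter> nbrs (E \<inter> nsets S 2) v) \<le> card (S \<inter> nbrs E v)"
          using that fin by (intro card_mono) (auto simp: nbrs_def)
        then have "8 * (p * card (S \<inter> nbrs (E \<inter> nsets S 2) v)) \<le> 8 * (p * card (S \<inter> nbrs E v))"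
          using p by (intro mult_left_mono) auto
        also have "\<dots> \<le> 8 * 1"
          using thin that by (intro mult_left_mono) (auto simp: thin_def)
        finally show ?thesis using c by simp
      qed
      have "rprob ?J p (?few x) \<le>
        2 * exp (- real m) + 2 * real a * exp (- real c) + (real a + 1) * exp (- p * a / 25)"
        unfolding R_def
      proof (rule rprob_few_row_pairs)
        show "star x (Y \<union> Z) \<subseteq> ?J" using x A1A by (intro star_subset_bip) auto
        show "9/10 * real a \<le> card {y\<in>Y. 9/10 * real a \<le> card (open_pairs E x y)}"
          using x by (simp add: A1_def)
        show "open_pairs E x y \<subseteq> Z" for y by (auto simp: open_pairs_def)
      qed (use finJ p fin card b cE deg in auto)
      then show "rprob ?J p (?few x) \<le> d" using d(1) by linarith
    qed (use d0 d(2) in auto)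
    also have "\<dots> \<le> 2 ^ a * d powr (a / 10)"
      using finA1(2) by (intro mult_right_mono power_increasing) auto
    finally show ?thesis .
  qed
qed

lemma rprob_no_maximal_triangle:
  fixes p d :: real and m c :: nat
  assumes p: "0 < p" "p \<le> 1"
    and m: "144 * (p * a)\<^sup>2 * p \<le> real m" and c: "8 \<le> c"
      "320 * p * a * (real c)\<^sup>2 \<le> 3/50 * (p * a)\<^sup>2"
    and b: "real (2 * m * (1 + c)) \<le> p * a / 20"
    and d: "2 * exp (- real m) + 2 * real a * exp (- real c) + (real a + 1) * exp (- p * a / 25) \<le> d" "d \<le> 1"
  shows "rprob (nsets V 2) p (\<lambda>E. light E \<and> thin p E \<and> codegrees_le c E \<and>
      (\<forall>x\<in>A. \<forall>y\<in>Y. \<forall>z\<in>Z. \<not> maximal_triangle E x y z))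
    \<le> exp (- p * (a * (p * a)\<^sup>2 / (20 * c))) + 2 ^ a * d powr (a / 10)"
proof -
  let ?M = "a * (p * a)\<^sup>2 / (20 * c)"
  let ?no = "\<lambda>E. \<forall>x\<in>A. \<forall>y\<in>Y. \<forall>z\<in>Z. \<not> maximal_triangle E x y z"
  let ?few = "\<lambda>E. real (card {x\<in>A. 4/25 * (p * a)\<^sup>2 \<le> card (row E x)}) < 4/5 * real a"
  have "rprob (nsets V 2) p (\<lambda>E. light E \<and> thin p E \<and> codegrees_le c E \<and> ?no E)
     \<le> rprob (nsets V 2) p (\<lambda>E. (?M \<le> card (good_pairs E) \<and> ?no E) \<or> (light E \<and> thin p E \<and> ?few E))"
  proof (rule rprob_mono)
    fix E assume E': "E \<subseteq> nsets V 2" "light E \<and> thin p E \<and> codegrees_le c E \<and> ?no E"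
    then have E: "E \<subseteq> nsets V 2" "light E" "thin p E" "codegrees_le c E" "?no E" by auto
    show "(?M \<le> card (good_pairs E) \<and> ?no E) \<or> (light E \<and> thin p E \<and> ?few E)"
      using many_good_pairs[OF E(1) p(1) E(4) _ c(2)] c(1) E by (force simp: thin_def not_less)
  qed (use finV finite_imp_finite_nsets in auto)
  also have "\<dots> \<le> rprob (nsets V 2) p (\<lambda>E. ?M \<le> card (good_pairs E) \<and> ?no E) +
      rprob (nsets V 2) p (\<lambda>E. light E \<and> thin p E \<and> ?few E)"
    by (rule rprob_disj)
  also have "\<dots> \<le> exp (- p * ?M) + 2 ^ a * d powr (a / 10)"
    using rprob_good_pairs_no_triangle[of p ?M] rprob_few_good_rows[OF _ p(2) m c(1) b d] p
    by (intro add_mono) auto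
  finally show ?thesis .
qed

end

section \<open>Density properties of the random graph\<close>

lemma card_subsets_le:
  assumes "finite V" "real (card V) \<le> exp L"
  shows "real (card {S. S \<subseteq> V \<and> card S = k}) \<le> exp (real k * L)"
proof -
  have "card {S. S \<subseteq> V \<and> card S = k} = card V choose k"
    using assms(1) by (rule n_subsets)
  also have "\<dots> \<le> card V ^ k"
    by (cases "k \<le> card V") (simp_all add: binomial_le_pow binomial_eq_0)
  finally have "card {S. S \<subseteq> V \<and> card S = k} \<le> card V ^ k" .
  then have "real (card {S. S \<subseteq> V \<and> card S = k}) \<le> real (card V) ^ k"
    by (simp flip: of_nat_power)
  also have "\<dots> \<le> exp L ^ k" using assms(2) by (intro power_mono) auto
  finally show ?thesis by (simp flip: exp_of_nat_mult)
qed

lemma card_Int_bip: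
  assumes "finite B" "finite W" "B \<inter> W = {}"
  shows "card (E \<inter> bip B W) = (\<Sum>w\<in>W. card (B \<inter> nbrs E w))"
proof -
  have "E \<inter> bip B W = (\<lambda>(w, u). {w, u}) ` (SIGMA w:W. B \<inter> nbrs E w)"
  proof (intro set_eqI iffI)
    fix e assume "e \<in> E \<inter> bip B W"
    then obtain u w where "e = {w, u}" "u \<in> B" "w \<in> W" "{w, u} \<in> E"
      by (auto simp: bip_def insert_commute)
    then show "e \<in> (\<lambda>(w, u). {w, u}) ` (SIGMA w:W. B \<inter> nbrs E w)"
      by (intro image_eqI[of _ _ "(w, u)"]) (auto simp: nbrs_def)
  next
    fix e assume "e \<in> (\<lambda>(w, u). {w, u}) ` (SIGMA w:W. B \<inter> nbrs E w)"
    then obtain u w where uw: "e = {w, u}" "u \<in> B" "w \<in> W" "e \<in> E"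
      by (auto simp: nbrs_def)
    then have "e = (\<lambda>(x, y). {x, y}) (u, w)" by auto
    then show "e \<in> E \<inter> bip B W"
      unfolding bip_def using uw by blast
  qed
  moreover have "inj_on (\<lambda>(w, u). {w, u}) (SIGMA w:W. B \<inter> nbrs E w)"
    by (rule inj_on_subset[OF inj_on_bip[of W B]]) (use assms(3) in auto)
  ultimately show ?thesis using assms by (simp add: card_image)
qed

text \<open>
  The upper half of a jumbledness condition.  For small \<open>W\<close> a tail bound at the scale of the expected number of edges does
  not beat the number of choices of \<open>B\<close> and \<open>W\<close>, hence the second term.
\<close>
definition cross_bounded :: "'a set \<Rightarrow> real \<Rightarrow> real \<Rightarrow> nat \<Rightarrow> 'a set set \<Rightarrow> bool" where
  "cross_bounded V p L b E \<longleftrightarrow> (\<forall>B W. B \<subseteq> V \<and> W \<subseteq> V \<and> B \<inter> W = {} \<and> card B = b \<and> card W \<le> b \<longrightarrow>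
     real (card (E \<inter> bip B W)) < max (8 * p * real b * real (card W)) (3 * real b * L))"

text \<open>
  There are at most \<open>exp (2 b L)\<close> choices for \<open>B\<close> and \<open>W\<close> of given sizes, against a tail of
  \<open>exp (- 3 b L)\<close>.
\<close>
lemma rprob_not_cross_bounded:
  fixes p :: real
  assumes V: "finite V" "real (card V) \<le> exp L" and p: "0 \<le> p" "p \<le> 1" and L: "0 \<le> L"
  shows "rprob (nsets V 2) p (\<lambda>E. \<not> cross_bounded V p L b E) \<le> (real b + 1) * exp (- real b * L)"
proof -
  have finE: "finite (nsets V 2)" using V(1) by (rule finite_imp_finite_nsets)
  let ?S = "\<lambda>k. {S. S \<subseteq> V \<and> card S = k}"
  let ?t = "\<lambda>j. max (8 * p * real b * real j) (3 * real b * L)"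
  let ?bad = "\<lambda>j E. \<exists>BW\<in>?S b \<times> ?S j. fst BW \<inter> snd BW = {} \<and> ?t j \<le> card (E \<inter> bip (fst BW) (snd BW))"
  have "rprob (nsets V 2) p (\<lambda>E. \<not> cross_bounded V p L b E) \<le> rprob (nsets V 2) p (\<lambda>E. \<exists>j\<in>{..b}. ?bad j E)"
  proof (rule rprob_mono[OF finE])
    fix E assume "\<not> cross_bounded V p L b E"
    then obtain B W where BW: "B \<subseteq> V" "W \<subseteq> V" "B \<inter> W = {}" "card B = b" "card W \<le> b"
        "\<not> real (card (E \<inter> bip B W)) < ?t (card W)"
      unfolding cross_bounded_def by blast
    then have "?bad (card W) E"
      by (intro bexI[of _ "(B, W)"]) (simp_all add: not_less)
    then show "\<exists>j\<in>{..b}. ?bad j E"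
      using BW(5) by blast
  qed
  also have "\<dots> \<le> (real b + 1) * exp (- real b * L)"
  proof (rule rprob_bex_le)
    fix j assume j: "j \<in> {..b}"
    have "rprob (nsets V 2) p (?bad j) \<le> exp (2 * real b * L) * exp (- 3 * real b * L)"
    proof (rule rprob_bex_le)
      show "finite (?S b \<times> ?S j)" using V(1) by simp
      have "real (card (?S b \<times> ?S j)) \<le> exp (real b * L) * exp (real j * L)"
        unfolding card_cartesian_product of_nat_mult
        by (intro mult_mono card_subsets_le V) auto
      also have "\<dots> \<le> exp (real b * L) * exp (real b * L)"
        using j L by (intro mult_left_mono) (auto intro: mult_right_mono)
      finally show "real (card (?S b \<times> ?S j)) \<le> exp (2 * real b * L)"
        by (simp add: mult_ac flip: exp_add)
      fix BW assume BW: "BW \<in> ?S b \<times> ?S j"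
      obtain B W where [simp]: "BW = (B, W)" by (cases BW)
      show "rprob (nsets V 2) p (\<lambda>E. fst BW \<inter> snd BW = {} \<and> ?t j \<le> card (E \<inter> bip (fst BW) (snd BW)))
          \<le> exp (- 3 * real b * L)"
      proof (cases "B \<inter> W = {}")
        case True
        have "rprob (nsets V 2) p (\<lambda>E. ?t j \<le> card (E \<inter> bip B W)) \<le> exp (- ?t j)"
        proof (rule rprob_upper_tail)
          show "bip B W \<subseteq> nsets V 2" using BW True by (intro bip_subset_nsets) auto
          show "8 * p * card (bip B W) \<le> ?t j" using BW by (auto simp: card_bip[OF True])
        qed (use finE p in auto)
        also have "\<dots> \<le> exp (- 3 * real b * L)" by simp
        finally show ?thesis using True by simp
      qed (simp add: rprob_def)
    qed simp
    also have "\<dots> = exp (- real b * L)" by (simp flip: exp_add)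
    finally show "rprob (nsets V 2) p (?bad j) \<le> exp (- real b * L)" .
  qed auto
  finally show ?thesis .
qed

lemma rprob_dense_subset:
  fixes p :: real
  assumes V: "finite V" "real (card V) \<le> exp L" and p: "0 \<le> p" "p \<le> 1"
  shows "rprob (nsets V 2) p (\<lambda>E. \<exists>S. S \<subseteq> V \<and> card S = b \<and> 4 * p * (real b)\<^sup>2 \<le> card (E \<inter> nsets S 2))
    \<le> exp (real b * L) * exp (- 4 * p * (real b)\<^sup>2)"
proof -
  have finE: "finite (nsets V 2)" using V(1) by (rule finite_imp_finite_nsets)
  have "rprob (nsets V 2) p (\<lambda>E. \<exists>S\<in>{S. S \<subseteq> V \<and> card S = b}. 4 * p * (real b)\<^sup>2 \<le> card (E \<inter> nsets S 2))
    \<le> exp (real b * L) * exp (- 4 * p * (real b)\<^sup>2)"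
  proof (rule rprob_bex_le)
    fix S assume S: "S \<in> {S. S \<subseteq> V \<and> card S = b}"
    then have "finite S" using V(1) finite_subset by auto
    then have "nsets S 2 = {N. N \<subseteq> S \<and> card N = 2}" by (auto simp: nsets_def intro: finite_subset)
    then have "card (nsets S 2) = b choose 2" using S \<open>finite S\<close> by (simp add: n_subsets)
    moreover have "2 * real (b choose 2) \<le> (real b)\<^sup>2"
    proof -
      have "2 * (b choose 2) \<le> b * (b - 1)"
        unfolding choose_two by (rule times_div_less_eq_dividend)
      also have "\<dots> \<le> b * b" by simp
      finally have "real (2 * (b choose 2)) \<le> real (b * b)" by (rule of_nat_mono)
      then show ?thesis by (simp add: power2_eq_square)
    qed
    ultimately have le: "8 * p * card (nsets S 2) \<le> 4 * p * (real b)\<^sup>2"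
      using mult_left_mono[of "2 * real (b choose 2)" "(real b)\<^sup>2" "4 * p"] p by simp
    have "rprob (nsets V 2) p (\<lambda>E. 4 * p * (real b)\<^sup>2 \<le> card (E \<inter> nsets S 2)) \<le> exp (- (4 * p * (real b)\<^sup>2))"
      by (rule rprob_upper_tail[OF finE _ p le]) (use S in \<open>auto intro: nsets_mono[THEN subsetD]\<close>)
    then show "rprob (nsets V 2) p (\<lambda>E. 4 * p * (real b)\<^sup>2 \<le> card (E \<inter> nsets S 2)) \<le> exp (- 4 * p * (real b)\<^sup>2)"
      by simp
  qed (use V card_subsets_le in auto)
  then show ?thesis by (simp only: Bex_def mem_Collect_eq conj_assoc)
qed

lemma rprob_high_degree:
  fixes p :: real
  assumes V: "finite V" and p: "0 \<le> p" "p \<le> 1"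
  shows "rprob (nsets V 2) p (\<lambda>E. \<exists>v\<in>V. 8 * p * card V \<le> card (nbrs E v)) \<le> card V * exp (- 8 * p * card V)"
proof (rule rprob_bex_le)
  have finE: "finite (nsets V 2)" using V by (rule finite_imp_finite_nsets)
  fix v assume v: "v \<in> V"
  have "rprob (nsets V 2) p (\<lambda>E. 8 * p * card V \<le> card (nbrs E v))
      \<le> rprob (nsets V 2) p (\<lambda>E. 8 * p * card V \<le> card (E \<inter> star v (V - {v})))"
  proof (rule rprob_mono[OF finE])
    fix E assume E: "E \<subseteq> nsets V 2" and deg: "8 * p * card V \<le> card (nbrs E v)"
    have "nbrs E v = (V - {v}) \<inter> nbrs E v"
      using nbrs_subset[OF E, of v] nbrs_irrefl[OF E, of v] by auto
    then show "8 * p * card V \<le> card (E \<inter> star v (V - {v}))"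
      using deg by (simp add: card_Int_star)
  qed
  also have "\<dots> \<le> exp (- (8 * p * card V))"
  proof (rule rprob_upper_tail[OF finE _ p])
    show "star v (V - {v}) \<subseteq> nsets V 2" using v by (auto simp: star_def)
    show "8 * p * card (star v (V - {v})) \<le> 8 * p * card V"
      using p card_mono[of V "V - {v}"] V by (intro mult_left_mono) auto
  qed
  finally show "rprob (nsets V 2) p (\<lambda>E. 8 * p * card V \<le> card (nbrs E v)) \<le> exp (- 8 * p * card V)" by simp
qed (use V in auto)

text \<open>
  First moment over the sets of \<open>c\<close> common neighbours; each needs \<open>2 * c\<close> edges.
\<close>
lemma rprob_common_nbrs_ge:
  fixes p :: real
  assumes I: "finite I" "bip {u, v} S \<subseteq> I" and p: "0 \<le> p" "p \<le> 1"
    and uv: "u \<noteq> v" "u \<notin> S" "v \<notin> S" and S: "finite S"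
    and c: "9 * real (card S) * p\<^sup>2 \<le> real c"
  shows "rprob I p (\<lambda>E. c \<le> card (S \<inter> nbrs E u \<inter> nbrs E v)) \<le> exp (- real c)"
proof -
  let ?T = "{T. T \<subseteq> S \<and> card T = c}"
  have "rprob I p (\<lambda>E. c \<le> card (S \<inter> nbrs E u \<inter> nbrs E v)) \<le> rprob I p (\<lambda>E. \<exists>T\<in>?T. bip {u, v} T \<subseteq> E)"
  proof (rule rprob_mono[OF I(1)])
    fix E assume "c \<le> card (S \<inter> nbrs E u \<inter> nbrs E v)"
    then obtain T where T: "T \<subseteq> S \<inter> nbrs E u \<inter> nbrs E v" "card T = c"
      using obtain_subset_with_card_n by metis
    then show "\<exists>T\<in>?T. bip {u, v} T \<subseteq> E"
      by (intro bexI[of _ T]) (auto simp: bip_def nbrs_def)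
  qed
  also have "\<dots> \<le> real (card S choose c) * (p\<^sup>2) ^ c"
  proof (rule rprob_bex_le)
    fix T assume T: "T \<in> ?T"
    have "bip {u, v} T \<subseteq> I" using T I(2) by (auto simp: bip_def)
    then have "rprob I p (\<lambda>E. bip {u, v} T \<subseteq> E) = p ^ card (bip {u, v} T)"
      by (intro rprob_subset I p)
    also have "card (bip {u, v} T) = 2 * c"
      using T uv by (subst card_bip) auto
    finally show "rprob I p (\<lambda>E. bip {u, v} T \<subseteq> E) \<le> (p\<^sup>2) ^ c" by (simp add: power_mult)
  qed (use S p in \<open>auto simp: n_subsets\<close>)
  also have "\<dots> \<le> exp (- real c)"
    by (rule choose_times_power_le) (use c in auto)
  finally show ?thesis .
qed

lemma rprob_high_codegree:
  fixes p :: real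
  assumes V: "finite V" and p: "0 \<le> p" "p \<le> 1"
    and c: "9 * real (card V) * p\<^sup>2 \<le> real c"
  shows "rprob (nsets V 2) p (\<lambda>E. \<exists>u\<in>V. \<exists>v\<in>V. u \<noteq> v \<and> c \<le> card (nbrs E u \<inter> nbrs E v))
    \<le> (real (card V))\<^sup>2 * exp (- real c)"
proof -
  have finE: "finite (nsets V 2)" using V by (rule finite_imp_finite_nsets)
  have "rprob (nsets V 2) p (\<lambda>E. \<exists>u\<in>V. \<exists>v\<in>V. u \<noteq> v \<and> c \<le> card (nbrs E u \<inter> nbrs E v)) \<le>
      rprob (nsets V 2) p (\<lambda>E. \<exists>uv\<in>V \<times> V. fst uv \<noteq> snd uv \<and>
        c \<le> card ((V - {fst uv, snd uv}) \<inter> nbrs E (fst uv) \<inter> nbrs E (snd uv)))"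
  proof (rule rprob_mono[OF finE])
    fix E assume E: "E \<subseteq> nsets V 2" and "\<exists>u\<in>V. \<exists>v\<in>V. u \<noteq> v \<and> c \<le> card (nbrs E u \<inter> nbrs E v)"
    then obtain u v where uv: "u \<in> V" "v \<in> V" "u \<noteq> v" "c \<le> card (nbrs E u \<inter> nbrs E v)" by blast
    have "nbrs E u \<inter> nbrs E v = (V - {u, v}) \<inter> nbrs E u \<inter> nbrs E v"
      using nbrs_subset[OF E] nbrs_irrefl[OF E] by auto
    then show "\<exists>uv\<in>V \<times> V. fst uv \<noteq> snd uv \<and>
        c \<le> card ((V - {fst uv, snd uv}) \<inter> nbrs E (fst uv) \<inter> nbrs E (snd uv))"
      using uv by (intro bexI[of _ "(u, v)"]) auto
  qed
  also have "\<dots> \<le> (real (card V))\<^sup>2 * exp (- real c)"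
  proof (rule rprob_bex_le)
    fix uv assume uv: "uv \<in> V \<times> V"
    obtain u v where [simp]: "uv = (u, v)" by (cases uv)
    show "rprob (nsets V 2) p (\<lambda>E. fst uv \<noteq> snd uv \<and>
        c \<le> card ((V - {fst uv, snd uv}) \<inter> nbrs E (fst uv) \<inter> nbrs E (snd uv))) \<le> exp (- real c)"
    proof (cases "u = v")
      case False
      have "9 * real (card (V - {u, v})) * p\<^sup>2 \<le> 9 * real (card V) * p\<^sup>2"
        using V by (intro mult_right_mono mult_left_mono of_nat_mono card_mono) auto
      then have "rprob (nsets V 2) p (\<lambda>E. c \<le> card ((V - {u, v}) \<inter> nbrs E u \<inter> nbrs E v)) \<le> exp (- real c)"
        using c False uv V by (intro rprob_common_nbrs_ge[OF finE _ p]) (auto simp: bip_def)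
      then show ?thesis using False by simp
    qed (simp add: rprob_def)
  qed (use V in \<open>auto simp: power2_eq_square card_cartesian_product\<close>)
  finally show ?thesis .
qed

text \<open>
  Large codegrees into \<open>S\<close> cannot be excluded for single pairs of vertices, because \<open>S\<close> is arbitrary;
  only many disjoint such pairs are unlikely.
\<close>
definition rich_matching :: "'a set \<Rightarrow> nat \<Rightarrow> nat \<Rightarrow> 'a set set \<Rightarrow> 'a set \<Rightarrow> 'a set set \<Rightarrow> bool" where
  "rich_matching V f c E S M \<longleftrightarrow> M \<subseteq> nsets (V - S) 2 \<and> disjoint M \<and> card M = f \<and>
     (\<forall>e\<in>M. c \<le> card {z\<in>S. \<forall>u\<in>e. z \<in> nbrs E u})"

text \<open>
  Disjoint pairs outside \<open>S\<close> use disjoint sets of edges to \<open>S\<close>, so their codegrees are independent.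
\<close>
lemma rprob_rich_matching:
  fixes p :: real
  assumes V: "finite V" "real (card V) \<le> exp L" and p: "0 \<le> p" "p \<le> 1"
    and c: "9 * real b * p\<^sup>2 \<le> real c"
  shows "rprob (nsets V 2) p (\<lambda>E. \<exists>S M. S \<subseteq> V \<and> card S = b \<and> rich_matching V f c E S M)
    \<le> exp (real b * L + 2 * real f * L) * exp (- real c * real f)"
proof -
  have finE: "finite (nsets V 2)" using V(1) by (rule finite_imp_finite_nsets)
  let ?S = "{S. S \<subseteq> V \<and> card S = b}" and ?M = "{M. M \<subseteq> nsets V 2 \<and> card M = f}"
  let ?rich = "\<lambda>S M E. M \<subseteq> nsets (V - S) 2 \<and> disjoint M \<and> (\<forall>e\<in>M. c \<le> card {z\<in>S. \<forall>u\<in>e. z \<in> nbrs E u})"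
  have "rprob (nsets V 2) p (\<lambda>E. \<exists>S M. S \<subseteq> V \<and> card S = b \<and> rich_matching V f c E S M) \<le>
      rprob (nsets V 2) p (\<lambda>E. \<exists>SM\<in>?S \<times> ?M. ?rich (fst SM) (snd SM) E)"
  proof (rule rprob_mono[OF finE])
    fix E assume "\<exists>S M. S \<subseteq> V \<and> card S = b \<and> rich_matching V f c E S M"
    then obtain S M where SM: "S \<subseteq> V" "card S = b" "rich_matching V f c E S M" by blast
    moreover have "nsets (V - S) 2 \<subseteq> nsets V 2" by (rule nsets_mono) auto
    ultimately show "\<exists>SM\<in>?S \<times> ?M. ?rich (fst SM) (snd SM) E"
      by (intro bexI[of _ "(S, M)"]) (auto simp: rich_matching_def)
  qed
  also have "\<dots> \<le> exp (real b * L + 2 * real f * L) * exp (- real c * real f)"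
  proof (rule rprob_bex_le)
    show "finite (?S \<times> ?M)" using V(1) finE by auto
    have "real (card (nsets V 2)) \<le> exp (2 * L)"
    proof -
      have "nsets V 2 \<subseteq> (\<lambda>(x, y). {x, y}) ` (V \<times> V)" by (auto simp: nsets_2_eq)
      then have "card (nsets V 2) \<le> card (V \<times> V)"
        using V(1) by (intro surj_card_le) auto
      then have "real (card (nsets V 2)) \<le> real (card V) * real (card V)"
        by (simp add: card_cartesian_product flip: of_nat_mult)
      also have "\<dots> \<le> exp L * exp L" using V by (intro mult_mono) auto
      finally show ?thesis by (simp flip: exp_add)
    qed
    then have "real (card ?M) \<le> exp (real f * (2 * L))"
      by (rule card_subsets_le[OF finE])
    then show "real (card (?S \<times> ?M)) \<le> exp (real b * L + 2 * real f * L)"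
      using mult_mono[OF card_subsets_le[OF V, of b], of "real (card ?M)" "exp (real f * (2 * L))"]
      by (simp add: card_cartesian_product exp_add mult_ac)
    fix SM assume SM: "SM \<in> ?S \<times> ?M"
    obtain S M where [simp]: "SM = (S, M)" by (cases SM)
    have S: "S \<subseteq> V" "card S = b" and M: "M \<subseteq> nsets V 2" "card M = f" using SM by auto
    have finS: "finite S" and finM: "finite M" using S M V(1) finE finite_subset by blast+
    show "rprob (nsets V 2) p (\<lambda>E. ?rich (fst SM) (snd SM) E) \<le> exp (- real c * real f)"
    proof (cases "M \<subseteq> nsets (V - S) 2 \<and> disjoint M")
      case True
      have "rprob (nsets V 2) p (\<lambda>E. \<forall>e\<in>M. c \<le> card {z\<in>S. \<forall>u\<in>e. z \<in> nbrs E u}) \<le> exp (- real c) ^ card M"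
      proof (rule rprob_indep_le[OF finE finM, where J = "\<lambda>e. bip e S"])
        show "disjoint_family_on (\<lambda>e. bip e S) M"
        proof -
          have "False" if "e \<in> M" "e' \<in> M" "e \<noteq> e'" "d \<in> bip e S" "d \<in> bip e' S" for e e' d
          proof -
            have "e \<inter> e' = {}" using True that(1-3) by (auto simp: disjoint_def)
            moreover have "e \<inter> S = {}" "e' \<inter> S = {}" using True that(1,2) by (auto simp: nsets_def)
            ultimately show False using that(4,5) by (auto simp: bip_def doubleton_eq_iff)
          qed
          then show ?thesis unfolding disjoint_family_on_def by blast
        qed
        fix e assume e: "e \<in> M"
        have eV: "e \<subseteq> V - S" using e True by (auto simp: nsets_def)
        show J: "bip e S \<subseteq> nsets V 2" using eV S by (intro bip_subset_nsets) auto
        show "(c \<le> card {z\<in>S. \<forall>u\<in>e. z \<in> nbrs E u}) = (c \<le> card {z\<in>S. \<forall>u\<in>e. z \<in> nbrs (E \<inter> bip e S) u})" for E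
        proof -
          have "{z\<in>S. \<forall>u\<in>e. z \<in> nbrs E u} = {z\<in>S. \<forall>u\<in>e. z \<in> nbrs (E \<inter> bip e S) u}"
            by (auto simp: nbrs_def bip_def)
          then show ?thesis by simp
        qed
        obtain u v where uv: "e = {u, v}" "u \<noteq> v"
          using e True by (auto simp: nsets_def card_2_iff)
        have eq: "{z\<in>S. \<forall>u\<in>e. z \<in> nbrs E u} = S \<inter> nbrs E u \<inter> nbrs E v" for E
          by (auto simp: uv)
        show "rprob (nsets V 2) p (\<lambda>E. c \<le> card {z\<in>S. \<forall>u\<in>e. z \<in> nbrs E u}) \<le> exp (- real c)"
          unfolding eq using J eV c S uv
          by (intro rprob_common_nbrs_ge[OF finE _ p _ _ _ finS]) auto
      qed auto
      also have "\<dots> = exp (- real c * real f)"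
        by (simp add: M(2) mult_ac flip: exp_of_nat_mult)
      finally show ?thesis using True by simp
    next
      case False
      then have "rprob (nsets V 2) p (\<lambda>E. ?rich (fst SM) (snd SM) E) = rprob (nsets V 2) p (\<lambda>E. False)"
        by (intro rprob_cong finE) auto
      then show ?thesis by (simp add: rprob_def)
    qed
  qed auto
  finally show ?thesis .
qed

section \<open>Spread triples of sets contain maximal triangles\<close>

lemma bip_commute: "bip X Y = bip Y X"
proof -
  have "bip X Y \<subseteq> bip Y X" for X Y :: "'a set"
  proof
    fix e assume "e \<in> bip X Y"
    then obtain x y where "e = {x, y}" "x \<in> X" "y \<in> Y" by (auto simp: bip_def)
    then have "e = (\<lambda>(x, y). {x, y}) (y, x)" "(y, x) \<in> Y \<times> X" by auto
    then show "e \<in> bip Y X" unfolding bip_def by blast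
  qed
  then show ?thesis by blast
qed

context three_parts
begin

text \<open>
  Vertices of degree at most \<open>16 p a\<close> into \<open>Y \<union> Z\<close> contribute a small multiple of \<open>n p ^ 3 * a ^ 3\<close>,
  since they send few edges to \<open>A\<close> altogether.  The others send only \<open>6 a L\<close> edges to \<open>Y \<union> Z\<close>, and by the
  spread condition each contributes at most \<open>r * a\<close> times its number of such edges.
\<close>
lemma light_if_spread:
  fixes p L :: real
  assumes E: "E \<subseteq> nsets V 2" and p: "0 \<le> p" and L: "0 < L" and a: "1 \<le> a"
    and cross: "cross_bounded V p L (2 * a) E"
    and deg: "\<And>v. v \<in> V \<Longrightarrow> real (card (nbrs E v)) \<le> 8 * p * card V"
    and spread: "\<And>w. w \<in> V \<Longrightarrow> card (A \<inter> nbrs E w) \<le> r \<or> Y \<inter> nbrs E w = {}"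
    and num: "3 * L \<le> 16 * p * a" "12000 * real r * L \<le> real a" "4096000 * real (card V) * p ^ 3 \<le> 1"
  shows "light E"
proof -
  define B where "B = Y \<union> Z"
  define b where "b = (\<lambda>w. card (B \<inter> nbrs E w))"
  define H where "H = {w\<in>W. 16 * p * a < b w}"
  have cB: "card B = 2 * a" and BV: "B \<subseteq> V" and finB: "finite B" and finW: "finite W"
    unfolding B_def using card disj sub fin finV by (auto simp: card_Un_disjoint)
  have finH: "finite H" unfolding H_def using finW by (rule finite_subset[rotated]) auto
  \<comment> \<open>Vertices of \<open>H\<close> send more edges to \<open>B\<close> than the first term of \<open>cross_bounded\<close> allows, so the second one applies.\<close>
  have small: "real (\<Sum>w\<in>S. b w) < 6 * a * L" if S: "S \<subseteq> H" "card S \<le> 2 * a" for S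
  proof -
    have BS: "B \<inter> S = {}" using S by (auto simp: H_def B_def)
    have finS: "finite S" using S finH finite_subset by blast
    have "S \<subseteq> V" using S by (auto simp: H_def)
    then have "real (card (E \<inter> bip B S)) < max (8 * p * real (2 * a) * card S) (3 * real (2 * a) * L)"
      using cross BV BS cB S(2) unfolding cross_bounded_def by blast
    moreover have "card (E \<inter> bip B S) = (\<Sum>w\<in>S. b w)"
      unfolding b_def by (rule card_Int_bip[OF finB finS BS])
    moreover have "card S * (16 * p * a) \<le> (\<Sum>w\<in>S. b w)"
      by (rule card_ge_le_sum[OF finS]) (use S in \<open>auto simp: H_def\<close>)
    ultimately show ?thesis by (auto simp: max_def mult_ac split: if_splits)
  qed
  have "card H \<le> 2 * a"
  proof (rule ccontr)
    assume "\<not> card H \<le> 2 * a"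
    then have "2 * a \<le> card H" by simp
    then obtain S where S: "S \<subseteq> H" "card S = 2 * a"
      using obtain_subset_with_card_n by metis
    then have "finite S" using finH finite_subset by blast
    then have "card S * (16 * p * a) \<le> (\<Sum>w\<in>S. b w)"
      by (rule card_ge_le_sum) (use S in \<open>auto simp: H_def\<close>)
    moreover have "6 * a * L \<le> card S * (16 * p * a)"
      using mult_left_mono[OF num(1), of "2 * real a"] S(2) by (simp add: mult_ac)
    moreover have "real (\<Sum>w\<in>S. b w) < 6 * a * L" using small[OF S(1)] S(2) by simp
    ultimately show False by linarith
  qed
  then have sumH: "real (\<Sum>w\<in>H. b w) \<le> 6 * a * L" using small[of H] by simp
  have sumA: "real (\<Sum>w\<in>W. card (A \<inter> nbrs E w)) \<le> a * (8 * p * card V)"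
  proof -
    have AW: "A \<inter> W = {}" by auto
    have "(\<Sum>w\<in>W. card (A \<inter> nbrs E w)) = card (E \<inter> bip W A)"
      unfolding bip_commute[of W A] using card_Int_bip[OF fin(1) finW AW] by simp
    also have "\<dots> = (\<Sum>x\<in>A. card (W \<inter> nbrs E x))"
      by (rule card_Int_bip[OF finW fin(1)]) auto
    also have "real \<dots> \<le> (\<Sum>x\<in>A. 8 * p * card V)"
      unfolding of_nat_sum
    proof (rule sum_mono)
      fix x assume "x \<in> A"
      moreover have "card (W \<inter> nbrs E x) \<le> card (nbrs E x)"
        using nbrs_subset[OF E] finV by (intro card_mono) (auto intro: finite_subset)
      ultimately show "real (card (W \<inter> nbrs E x)) \<le> 8 * p * card V"
        using deg[of x] sub by (auto intro: order_trans[of _ "real (card (nbrs E x))"])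
    qed
    finally show ?thesis using card(1) by simp
  qed
  let ?f = "\<lambda>w. real (card (A \<inter> nbrs E w) * card (Y \<inter> nbrs E w) * card (Z \<inter> nbrs E w))"
  have le_b: "card (Y \<inter> nbrs E w) \<le> b w" "card (Z \<inter> nbrs E w) \<le> b w" for w
    unfolding b_def using finB by (auto intro!: card_mono simp: B_def)
  have 1: "?f w \<le> card (A \<inter> nbrs E w) * (16 * p * a)\<^sup>2" if "w \<in> W - H" for w
  proof -
    have bw: "real (b w) \<le> 16 * p * a" using that by (auto simp: H_def)
    have "?f w \<le> card (A \<inter> nbrs E w) * (real (b w) * real (b w))"
      using le_b[of w] by (simp add: mult.assoc mult_left_mono mult_mono)
    also have "\<dots> \<le> card (A \<inter> nbrs E w) * ((16 * p * a) * (16 * p * a))"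
      using bw p by (intro mult_left_mono mult_mono) auto
    finally show ?thesis by (simp add: power2_eq_square)
  qed
  have 2: "?f w \<le> real r * real a * b w" if "w \<in> H" for w
  proof -
    have "w \<in> V" using that by (auto simp: H_def)
    then consider "card (A \<inter> nbrs E w) \<le> r" | "Y \<inter> nbrs E w = {}" using spread by blast
    then show ?thesis
    proof cases
      case 1
      have "card (Z \<inter> nbrs E w) \<le> a" using card_mono[OF fin(3), of "Z \<inter> nbrs E w"] card(3) by simp
      then have "card (A \<inter> nbrs E w) * card (Y \<inter> nbrs E w) * card (Z \<inter> nbrs E w) \<le> r * b w * a"
        using 1 le_b(1)[of w] by (intro mult_le_mono) auto
      then have "?f w \<le> real (r * b w * a)" by (rule of_nat_mono)
      then show ?thesis by (simp add: mult_ac)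
    qed simp
  qed
  have "(\<Sum>w\<in>W. ?f w) = (\<Sum>w\<in>W - H. ?f w) + (\<Sum>w\<in>H. ?f w)"
    using finW by (intro sum.subset_diff) (auto simp: H_def)
  also have "\<dots> \<le> (\<Sum>w\<in>W - H. card (A \<inter> nbrs E w) * (16 * p * a)\<^sup>2) + (\<Sum>w\<in>H. real r * real a * b w)"
    by (intro add_mono sum_mono 1 2)
  also have "(\<Sum>w\<in>W - H. card (A \<inter> nbrs E w) * (16 * p * a)\<^sup>2) \<le> (\<Sum>w\<in>W. card (A \<inter> nbrs E w) * (16 * p * a)\<^sup>2)"
    using finW by (intro sum_mono2) auto
  also have "\<dots> = real (\<Sum>w\<in>W. card (A \<inter> nbrs E w)) * (16 * p * a)\<^sup>2"
    by (simp add: sum_distrib_right)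
  also have "\<dots> \<le> a * (8 * p * card V) * (16 * p * a)\<^sup>2"
    by (intro mult_right_mono sumA) auto
  also have "\<dots> = 2048 * (card V * p ^ 3) * real a ^ 3"
    by (simp add: power2_eq_square power3_eq_cube)
  also have "\<dots> \<le> 1/2000 * real a ^ 3"
    using num(3) by (intro mult_right_mono) auto
  also have "(\<Sum>w\<in>H. real r * real a * b w) = real r * real a * real (\<Sum>w\<in>H. b w)"
    by (simp add: sum_distrib_left)
  also have "\<dots> \<le> real r * real a * (6 * a * L)"
    by (intro mult_left_mono sumH) auto
  also have "\<dots> = (12000 * real r * L) * (real a * real a) / 2000" by simp
  also have "\<dots> \<le> real a * (real a * real a) / 2000"
    by (intro divide_right_mono mult_right_mono num(2)) auto
  finally show ?thesis
    by (simp add: light_def power3_eq_cube)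
qed

end

text \<open>
  Apply the vertex cover lemma to the graph of pairs with large codegree into \<open>S\<close>.
\<close>
lemma obtain_codegree_cover:
  assumes V: "finite V" and S: "S \<subseteq> V" "X \<subseteq> V - S"
    and no: "\<And>M. \<not> rich_matching V f c E S M"
  obtains K where "K \<subseteq> X" "card K \<le> 2 * f"
    "\<And>u v. u \<in> X - K \<Longrightarrow> v \<in> X - K \<Longrightarrow> u \<noteq> v \<Longrightarrow> card (S \<inter> nbrs E u \<inter> nbrs E v) \<le> c"
proof -
  let ?H = "{e\<in>nsets X 2. c \<le> card {z\<in>S. \<forall>u\<in>e. z \<in> nbrs E u}}"
  have finX: "finite X" using V S finite_subset by blast
  have finH: "finite ?H" using finite_imp_finite_nsets[OF finX] by simp
  have HX: "?H \<subseteq> nsets X 2" by auto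
  have mat: "card M \<le> f" if M: "M \<subseteq> ?H" "disjoint M" for M
  proof (rule ccontr)
    assume "\<not> card M \<le> f"
    then have "f \<le> card M" by simp
    then obtain N where N: "N \<subseteq> M" "card N = f"
      using obtain_subset_with_card_n by metis
    have "nsets X 2 \<subseteq> nsets (V - S) 2" using S(2) by (rule nsets_mono)
    then have "rich_matching V f c E S N"
      using N M(1) pairwise_subset[OF M(2) N(1)] unfolding rich_matching_def by blast
    then show False using no by blast
  qed
  obtain K where K: "K \<subseteq> X" "finite K" "card K \<le> 2 * f" "\<And>e. e \<in> ?H \<Longrightarrow> e \<inter> K \<noteq> {}"
    using obtain_vertex_cover[OF finH HX mat] by blast
  have "card (S \<inter> nbrs E u \<inter> nbrs E v) \<le> c" if "u \<in> X - K" "v \<in> X - K" "u \<noteq> v" for u v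
  proof -
    have "{z\<in>S. \<forall>w\<in>{u, v}. z \<in> nbrs E w} = S \<inter> nbrs E u \<inter> nbrs E v" by auto
    moreover have "{u, v} \<notin> ?H" using K(4)[of "{u, v}"] that by auto
    ultimately show ?thesis using that by auto
  qed
  then show thesis using that K by blast
qed

lemma card_high_degree_le:
  fixes p :: real and a :: nat
  assumes "finite S" "E \<subseteq> nsets V 2" "0 < p" "real (card (E \<inter> nsets S 2)) \<le> 16 * p * (real a)\<^sup>2"
    and "64 * p\<^sup>2 * a \<le> 1"
  shows "real (card {v\<in>S. 1 < p * card (S \<inter> nbrs E v)}) \<le> a / 2"
proof -
  let ?K = "{v\<in>S. 1 < p * card (S \<inter> nbrs E v)}"
  have "card ?K * (1 / p) \<le> (\<Sum>v\<in>S. card (S \<inter> nbrs E v))"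
    by (rule card_ge_le_sum) (use assms in \<open>auto simp: field_simps\<close>)
  also have "\<dots> \<le> real (2 * card (E \<inter> nsets S 2))"
    by (rule of_nat_mono[OF sum_degree_le[OF assms(1,2)]])
  also have "\<dots> \<le> 32 * p * (real a)\<^sup>2" using assms(4) by simp
  finally have "card ?K \<le> 32 * p * (real a)\<^sup>2 * p" using assms(3) by (simp add: field_simps)
  also have "\<dots> = (64 * p\<^sup>2 * a) * (a / 2)" by (simp add: power2_eq_square)
  also have "\<dots> \<le> 1 * (a / 2)" by (intro mult_right_mono assms(5)) auto
  finally show ?thesis by simp
qed

lemma obtain_subset_avoiding:
  assumes "card S = 2 * a" "finite K" "card K \<le> a"
  obtains T where "T \<subseteq> S - K" "card T = a"
proof -
  have "a \<le> card (S - K)"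
    using diff_card_le_card_Diff[OF assms(2), of S] assms(1,3) by simp
  then show thesis
    using obtain_subset_with_card_n[of a "S - K"] that by metis
qed

text \<open>
  Start with parts of size \<open>2 * a\<close> and delete vertex covers of the pairs with large codegree as
  well as the vertices of large degree inside \<open>Y\<close> and \<open>Z\<close>; at least half of each part survives.
\<close>
lemma obtain_pruned_parts:
  fixes p :: real and a :: nat
  assumes V: "finite V" and E: "E \<subseteq> nsets V 2" and p: "0 < p"
    and sub0: "A0 \<subseteq> V" "Y0 \<subseteq> V" "Z0 \<subseteq> V"
    and disj0: "A0 \<inter> Y0 = {}" "A0 \<inter> Z0 = {}" "Y0 \<inter> Z0 = {}"
    and card0: "card A0 = 2 * a" "card Y0 = 2 * a" "card Z0 = 2 * a"
    and dense: "\<And>S. S \<subseteq> V \<Longrightarrow> card S = 2 * a \<Longrightarrow> real (card (E \<inter> nsets S 2)) \<le> 16 * p * (real a)\<^sup>2"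
    and rich: "\<And>S M. S \<subseteq> V \<Longrightarrow> card S = 2 * a \<Longrightarrow> \<not> rich_matching V f c E S M"
    and num: "4 * f \<le> a" "64 * p\<^sup>2 * a \<le> 1"
  obtains A Y Z where "three_parts V A Y Z a" "A \<subseteq> A0" "Y \<subseteq> Y0" "Z \<subseteq> Z0"
    "three_parts.thin A Y Z a p E" "three_parts.codegrees_le A Y Z c E"
proof -
  have fin0: "finite A0" "finite Y0" "finite Z0" using sub0 by (auto intro: finite_subset[OF _ V])
  have X: "A0 \<subseteq> V - Y0" "A0 \<subseteq> V - Z0" "Y0 \<union> Z0 \<subseteq> V - A0" using sub0 disj0 by blast+
  obtain K1 where K1: "K1 \<subseteq> A0" "card K1 \<le> 2 * f"
    "\<And>u v. u \<in> A0 - K1 \<Longrightarrow> v \<in> A0 - K1 \<Longrightarrow> u \<noteq> v \<Longrightarrow> card (Y0 \<inter> nbrs E u \<inter> nbrs E v) \<le> c"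
    using obtain_codegree_cover[OF V sub0(2) X(1) rich[OF sub0(2) card0(2)]] by blast
  obtain K2 where K2: "K2 \<subseteq> A0" "card K2 \<le> 2 * f"
    "\<And>u v. u \<in> A0 - K2 \<Longrightarrow> v \<in> A0 - K2 \<Longrightarrow> u \<noteq> v \<Longrightarrow> card (Z0 \<inter> nbrs E u \<inter> nbrs E v) \<le> c"
    using obtain_codegree_cover[OF V sub0(3) X(2) rich[OF sub0(3) card0(3)]] by blast
  obtain K3 where K3: "K3 \<subseteq> Y0 \<union> Z0" "card K3 \<le> 2 * f"
    "\<And>u v. u \<in> Y0 \<union> Z0 - K3 \<Longrightarrow> v \<in> Y0 \<union> Z0 - K3 \<Longrightarrow> u \<noteq> v \<Longrightarrow> card (A0 \<inter> nbrs E u \<inter> nbrs E v) \<le> c"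
    using obtain_codegree_cover[OF V sub0(1) X(3) rich[OF sub0(1) card0(1)]] by blast
  define K where "K = (\<lambda>S. {v\<in>S. 1 < p * card (S \<inter> nbrs E v)})"
  have KS: "card (K3 \<union> K S) \<le> a" if "S \<in> {Y0, Z0}" for S
  proof -
    have "real (card (K S)) \<le> a / 2" unfolding K_def
      by (rule card_high_degree_le[OF _ E p dense num(2)]) (use that fin0 sub0 card0 in auto)
    then show ?thesis using card_Un_le[of K3 "K S"] K3(2) num(1) by linarith
  qed
  have KA: "card (K1 \<union> K2) \<le> a" using card_Un_le[of K1 K2] K1(2) K2(2) num(1) by linarith
  have finK: "finite (K1 \<union> K2)" "finite (K3 \<union> K Y0)" "finite (K3 \<union> K Z0)"
    using K1(1) K2(1) K3(1) fin0 by (auto simp: K_def intro: finite_subset)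
  obtain A where A: "A \<subseteq> A0 - (K1 \<union> K2)" "card A = a"
    using obtain_subset_avoiding[OF card0(1) _ KA] finK by blast
  obtain Y where Y: "Y \<subseteq> Y0 - (K3 \<union> K Y0)" "card Y = a"
    using obtain_subset_avoiding[OF card0(2) _ KS[of Y0]] finK by blast
  obtain Z where Z: "Z \<subseteq> Z0 - (K3 \<union> K Z0)" "card Z = a"
    using obtain_subset_avoiding[OF card0(3) _ KS[of Z0]] finK by blast
  have subs: "A \<subseteq> A0" "Y \<subseteq> Y0" "Z \<subseteq> Z0" using A Y Z by auto
  have tp: "three_parts V A Y Z a"
  proof
    show "A \<subseteq> V" "Y \<subseteq> V" "Z \<subseteq> V" using subs sub0 by blast+
    show "A \<inter> Y = {}" "A \<inter> Z = {}" "Y \<inter> Z = {}" using subs disj0 by blast+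
  qed (fact V A Y Z)+
  interpret three_parts V A Y Z a by (rule tp)
  have finN: "finite (E \<inter> nsets S 2)" if "finite S" for S
    using finite_imp_finite_nsets[OF that] by blast
  have inner: "card (E \<inter> nsets S 2) \<le> 16 * p * (real a)\<^sup>2"
    if "S \<subseteq> S0" "S0 \<subseteq> V" "card S0 = 2 * a" for S S0
  proof -
    have "card (E \<inter> nsets S 2) \<le> card (E \<inter> nsets S0 2)"
      using finN[of S0] that V nsets_mono[OF that(1), of 2] by (intro card_mono) (auto intro: finite_subset)
    then show ?thesis using dense[OF that(2,3)] by linarith
  qed
  have low: "p * card (S \<inter> nbrs E v) \<le> 1" if "v \<in> S" "S \<subseteq> S0 - K S0" "finite S0" for S S0 v
  proof -
    have "p * card (S \<inter> nbrs E v) \<le> p * card (S0 \<inter> nbrs E v)"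
      using that p by (intro mult_left_mono of_nat_mono card_mono) auto
    also have "\<dots> \<le> 1" using that by (auto simp: K_def not_less)
    finally show ?thesis .
  qed
  have "thin p E"
    unfolding thin_def
  proof (intro conjI ballI)
    fix S assume "S \<in> {A, Y, Z}"
    then show "card (E \<inter> nsets S 2) \<le> 16 * p * (real a)\<^sup>2"
      using inner[OF subs(1) sub0(1) card0(1)] inner[OF subs(2) sub0(2) card0(2)]
        inner[OF subs(3) sub0(3) card0(3)] by blast
  next
    fix S v assume S: "S \<in> {Y, Z}" "v \<in> S"
    have "Y \<subseteq> Y0 - K Y0" "Z \<subseteq> Z0 - K Z0" using Y Z by blast+
    then show "p * card (S \<inter> nbrs E v) \<le> 1"
      using low[OF S(2) _ fin0(2)] low[OF S(2) _ fin0(3)] S(1) by blast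
  qed
  moreover have "codegrees_le c E"
  proof -
    have le: "card (S \<inter> nbrs E u \<inter> nbrs E v) \<le> c"
      if "S \<subseteq> S0" "finite S0" "card (S0 \<inter> nbrs E u \<inter> nbrs E v) \<le> c" for S S0 u v
    proof -
      have "card (S \<inter> nbrs E u \<inter> nbrs E v) \<le> card (S0 \<inter> nbrs E u \<inter> nbrs E v)"
        using that by (intro card_mono) auto
      then show ?thesis using that(3) by simp
    qed
    show ?thesis unfolding codegrees_le_def
    proof (intro conjI ballI impI)
      fix x w assume "x \<in> A" "w \<in> A" "x \<noteq> w"
      then show "card (Y \<inter> nbrs E x \<inter> nbrs E w) \<le> c" "card (Z \<inter> nbrs E x \<inter> nbrs E w) \<le> c"
        using A by (auto intro!: le[OF subs(2) fin0(2)] le[OF subs(3) fin0(3)] K1(3) K2(3))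
    next
      fix y z assume "y \<in> Y" "z \<in> Z"
      then show "card (A \<inter> nbrs E y \<inter> nbrs E z) \<le> c"
        using Y Z disj0 by (intro le[OF subs(1) fin0(1)] K3(3)) auto
    qed
  qed
  ultimately show thesis using that tp subs by blast
qed

text \<open>
  All size conditions for one application.  Up to constants, \<open>a\<close> lies between powers of \<open>L\<close> times
  \<open>p^(-3/2)\<close>, the parameters \<open>m\<close> and \<open>c\<close> are powers of \<open>L\<close>, and \<open>p a\<close> dominates the products of
  these that occur.
\<close>
definition regime :: "nat \<Rightarrow> real \<Rightarrow> real \<Rightarrow> nat \<Rightarrow> nat \<Rightarrow> nat \<Rightarrow> bool" where
  "regime n p L m c a \<longleftrightarrow>
     0 < p \<and> p \<le> 1 \<and> 2 \<le> L \<and> real n \<le> exp L \<and> 2 * L \<le> 8 * p * n \<and> 4096000 * real n * p ^ 3 \<le> 1 \<and>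
     103 * L \<le> m \<and> 103 * L \<le> c \<and> a \<le> n \<and>
     144 * (p * a)\<^sup>2 * p \<le> m \<and> 100 * c * L \<le> (p * a)\<^sup>2 * p \<and>
     6000 * (real c)\<^sup>2 \<le> p * a \<and> 40 * real m * (1 + real c) \<le> p * a \<and> 64 * p\<^sup>2 * a \<le> 1"

text \<open>
  The last condition says that no vertex dominates a relevant part of \<open>A \<times> Y \<times> Z\<close>; for small \<open>r\<close> it
  excludes that the three sets are contained in a single neighbourhood.
\<close>
definition spread_triple :: "'a set \<Rightarrow> nat \<Rightarrow> nat \<Rightarrow> 'a set set \<Rightarrow> 'a set \<Rightarrow> 'a set \<Rightarrow> 'a set \<Rightarrow> bool" where
  "spread_triple V a r E A Y Z \<longleftrightarrow> A \<subseteq> V \<and> Y \<subseteq> V \<and> Z \<subseteq> V \<and> A \<inter> Y = {} \<and> A \<inter> Z = {} \<and> Y \<inter> Z = {} \<and>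
     card A = 2 * a \<and> card Y = 2 * a \<and> card Z = 2 * a \<and>
     (\<forall>w\<in>V. card (A \<inter> nbrs E w) \<le> r \<or> Y \<inter> nbrs E w = {})"

text \<open>
  Each term is at most \<open>2 * exp L * exp (- 103 * L)\<close>.
\<close>
lemma regime_row_failure:
  assumes "regime n p L m c a"
  shows "2 * exp (- real m) + 2 * real a * exp (- real c) + (real a + 1) * exp (- p * a / 25) \<le> exp (- 100 * L)"
proof -
  have r: "2 \<le> L" "real n \<le> exp L" "103 * L \<le> m" "103 * L \<le> c" "a \<le> n" "6000 * (real c)\<^sup>2 \<le> p * a"
    using assms by (auto simp: regime_def)
  have a: "real a \<le> exp L" using r(2,5) by linarith
  have L1: "1 \<le> exp L" using r(1) by simp
  have "1 * real c \<le> real c * real c" using r(1,4) by (intro mult_right_mono) auto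
  then have "real c \<le> (real c)\<^sup>2" by (simp only: power2_eq_square mult_1)
  then have pa: "103 * L \<le> p * a / 25" using r(1,4,6) by linarith
  have "2 * exp (- real m) \<le> 2 * exp L * exp (- 103 * L)"
    using r(3) L1 by (intro mult_mono) auto
  moreover have "2 * real a * exp (- real c) \<le> 2 * exp L * exp (- 103 * L)"
    using r(4) a by (intro mult_mono) auto
  moreover have "real a + 1 \<le> 2 * exp L" using a L1 by linarith
  then have "(real a + 1) * exp (- p * a / 25) \<le> (2 * exp L) * exp (- 103 * L)"
    using pa by (intro mult_mono) auto
  moreover have "6 * (exp L * exp (- 103 * L)) \<le> exp (2 * L) * (exp L * exp (- 103 * L))"
  proof (rule mult_right_mono)
    have "3 \<le> exp (2 :: real)" using exp_ge_add_one_self[of 2] by simp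
    then have "3 * 3 \<le> exp 2 * exp (2 :: real)" by (intro mult_mono) auto
    then have "9 \<le> exp (4 :: real)" by (simp flip: exp_add)
    also have "\<dots> \<le> exp (2 * L)" using r(1) by simp
    finally show "6 \<le> exp (2 * L)" by simp
  qed auto
  moreover have "exp (2 * L) * (exp L * exp (- 103 * L)) = exp (- 100 * L)"
    by (simp flip: exp_add)
  ultimately show ?thesis by linarith
qed

text \<open>
  Outside four unlikely events, a spread triple can be pruned to one of at most \<open>exp (3 a L)\<close> triples
  for which the absence of a maximal triangle has probability at most \<open>2 * exp (- 5 a L)\<close>.
\<close>
lemma rprob_spread_triple_no_triangle:
  assumes V: "finite V" "card V = n" and reg: "regime n p L m c a" and r: "12000 * real r * L \<le> real a"
  shows "rprob (nsets V 2) p (\<lambda>E. \<exists>A Y Z. spread_triple V a r E A Y Z \<and>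
      (\<forall>x\<in>A. \<forall>y\<in>Y. \<forall>z\<in>Z. \<not> maximal_triangle E x y z)) \<le> 6 * exp (- L)"
proof -
  have p: "0 < p" "p \<le> 1" and L: "2 \<le> L" and n: "real n \<le> exp L" "2 * L \<le> 8 * p * n" "4096000 * real n * p ^ 3 \<le> 1"
    and mc: "103 * L \<le> m" "103 * L \<le> c" and an: "a \<le> n"
    and num: "144 * (p * a)\<^sup>2 * p \<le> m" "100 * c * L \<le> (p * a)\<^sup>2 * p" "6000 * (real c)\<^sup>2 \<le> p * a"
      "40 * real m * (1 + real c) \<le> p * a" "64 * p\<^sup>2 * a \<le> 1"
    using reg by (auto simp: regime_def)
  have c1: "206 \<le> real c" using mc L by linarith
  have "1 * real c \<le> real c * real c" using c1 by (intro mult_right_mono) auto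
  then have "real c \<le> (real c)\<^sup>2" by (simp only: power2_eq_square mult_1)
  then have pa: "6000 * (103 * L) \<le> p * a" using num(3) mc(2) by linarith
  have "p * a \<le> 1 * real a" using p by (intro mult_right_mono) auto
  then have a8: "8 \<le> real a" using pa L by linarith
  have a1: "1 \<le> a" using a8 by simp
  have finE: "finite (nsets V 2)" using V(1) by (rule finite_imp_finite_nsets)
  have VL: "real (card V) \<le> exp L" using V n by simp
  \<comment> \<open>Pruning deletes two covers of size \<open>2 * f\<close> from \<open>A\<close>, hence at most \<open>a\<close> vertices.\<close>
  define f where "f = a div 4"
  have f: "4 * f \<le> a" "real a / 8 \<le> f"
    using a8 by (auto simp: f_def)
  define \<beta> where "\<beta> = exp (- p * (a * (p * a)\<^sup>2 / (20 * c))) + 2 ^ a * exp (- 100 * L) powr (a / 10)"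
  let ?no = "\<lambda>E A Y Z. \<forall>x\<in>A. \<forall>y\<in>Y. \<forall>z\<in>Z. \<not> maximal_triangle E x y z"
  let ?T = "{S. S \<subseteq> V \<and> card S = a} \<times> {S. S \<subseteq> V \<and> card S = a} \<times> {S. S \<subseteq> V \<and> card S = a}"
  let ?bad = "\<lambda>E A Y Z. three_parts V A Y Z a \<and> three_parts.light V A Y Z a E \<and>
      three_parts.thin A Y Z a p E \<and> three_parts.codegrees_le A Y Z c E \<and> ?no E A Y Z"
  let ?c1 = "\<lambda>E. \<not> cross_bounded V p L (2 * a) E"
  let ?c2 = "\<lambda>E. \<exists>S. S \<subseteq> V \<and> card S = 2 * a \<and> 4 * p * (real (2 * a))\<^sup>2 \<le> card (E \<inter> nsets S 2)"
  let ?c3 = "\<lambda>E. \<exists>v\<in>V. 8 * p * card V \<le> card (nbrs E v)"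
  let ?c4 = "\<lambda>E. \<exists>S M. S \<subseteq> V \<and> card S = 2 * a \<and> rich_matching V f c E S M"
  let ?c5 = "\<lambda>E. \<exists>T\<in>?T. ?bad E (fst T) (fst (snd T)) (snd (snd T))"
  let ?P = "rprob (nsets V 2) p"
  have "?P (\<lambda>E. \<exists>A Y Z. spread_triple V a r E A Y Z \<and> ?no E A Y Z) \<le>
      ?P (\<lambda>E. (?c1 E \<or> ?c2 E) \<or> (?c3 E \<or> (?c4 E \<or> ?c5 E)))"
  proof (rule rprob_mono[OF finE], rule ccontr)
    fix E assume E: "E \<subseteq> nsets V 2" and "\<exists>A Y Z. spread_triple V a r E A Y Z \<and> ?no E A Y Z"
    then obtain A0 Y0 Z0 where T: "spread_triple V a r E A0 Y0 Z0" and no: "?no E A0 Y0 Z0" by blast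
    assume "\<not> ((?c1 E \<or> ?c2 E) \<or> (?c3 E \<or> (?c4 E \<or> ?c5 E)))"
    then have nc: "cross_bounded V p L (2 * a) E"
        "\<And>S. S \<subseteq> V \<Longrightarrow> card S = 2 * a \<Longrightarrow> real (card (E \<inter> nsets S 2)) \<le> 16 * p * (real a)\<^sup>2"
        "\<And>v. v \<in> V \<Longrightarrow> real (card (nbrs E v)) \<le> 8 * p * card V"
        "\<And>S M. S \<subseteq> V \<Longrightarrow> card S = 2 * a \<Longrightarrow> \<not> rich_matching V f c E S M"
      and n5: "\<not> ?c5 E"
      by (auto simp: not_le power2_eq_square less_imp_le)
    obtain A Y Z where P: "three_parts V A Y Z a" "A \<subseteq> A0" "Y \<subseteq> Y0" "Z \<subseteq> Z0"
        "three_parts.thin A Y Z a p E" "three_parts.codegrees_le A Y Z c E"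
      using obtain_pruned_parts[OF V(1) E p(1), of A0 Y0 Z0 a f c] T nc(2,4) f(1) num(5)
      unfolding spread_triple_def by blast
    interpret three_parts V A Y Z a by (rule P(1))
    have "light E"
    proof (rule light_if_spread[OF E _ _ a1 nc(1,3)])
      fix w assume "w \<in> V"
      then have "card (A0 \<inter> nbrs E w) \<le> r \<or> Y0 \<inter> nbrs E w = {}"
        using T by (auto simp: spread_triple_def)
      moreover have "finite A0" using T V(1) by (auto simp: spread_triple_def intro: finite_subset)
      then have "card (A \<inter> nbrs E w) \<le> card (A0 \<inter> nbrs E w)"
        using P(2) by (intro card_mono) auto
      ultimately show "card (A \<inter> nbrs E w) \<le> r \<or> Y \<inter> nbrs E w = {}"
        using P(3) by auto
    qed (use p L pa r n(3) V in auto)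
    moreover have "?no E A Y Z" using no P(2-4) by blast
    moreover have "(A, Y, Z) \<in> ?T" using sub card by simp
    ultimately have "?c5 E" using P by (intro bexI[of _ "(A, Y, Z)"]) auto
    then show False using n5 by blast
  qed
  also have "\<dots> \<le> (?P ?c1 + ?P ?c2) + (?P ?c3 + (?P ?c4 + ?P ?c5))"
    by (intro order.trans[OF rprob_disj] add_mono order.refl)
  also have "?P ?c1 \<le> exp (- L)"
  proof -
    have "?P ?c1 \<le> (real (2 * a) + 1) * exp (- real (2 * a) * L)"
      using rprob_not_cross_bounded[OF V(1) VL, of p "2 * a"] p L by simp
    also have "\<dots> \<le> exp (2 * real a) * exp (- real (2 * a) * L)"
      using exp_ge_add_one_self[of "2 * real a"] by (intro mult_right_mono) (auto simp: add.commute)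
    also have "\<dots> = exp (real a * (2 - 2 * L))" by (simp add: algebra_simps flip: exp_add)
    also have "\<dots> \<le> exp (real a * (- L))" using L by (intro iffD2[OF exp_le_cancel_iff] mult_left_mono) auto
    also have "\<dots> \<le> exp (1 * (- L))" using L a1 by simp
    finally show ?thesis by simp
  qed
  also have "?P ?c2 \<le> exp (- L)"
  proof -
    have "?P ?c2 \<le> exp (real (2 * a) * L) * exp (- 4 * p * (real (2 * a))\<^sup>2)"
      by (rule rprob_dense_subset[OF V(1) VL]) (use p in auto)
    also have "\<dots> = exp (real a * (2 * L - 16 * (p * a)))"
      by (simp add: algebra_simps power2_eq_square flip: exp_add)
    also have "\<dots> \<le> exp (real a * (- L))"
      using pa L by (intro iffD2[OF exp_le_cancel_iff] mult_left_mono) auto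
    also have "\<dots> \<le> exp (1 * (- L))" using L a1 by simp
    finally show ?thesis by simp
  qed
  also have "?P ?c3 \<le> exp (- L)"
  proof -
    have "?P ?c3 \<le> card V * exp (- 8 * p * card V)"
      by (rule rprob_high_degree[OF V(1)]) (use p in auto)
    also have "\<dots> \<le> exp L * exp (- (2 * L))"
      using n V by (intro mult_mono) auto
    finally show ?thesis by (simp flip: exp_add)
  qed
  also have "?P ?c4 \<le> exp (- L)"
  proof -
    have "9 * real (2 * a) * p\<^sup>2 \<le> 64 * p\<^sup>2 * a" by (simp add: mult_ac)
    also have "\<dots> \<le> real c" using num(5) c1 by linarith
    finally have "?P ?c4 \<le> exp (real (2 * a) * L + 2 * real f * L) * exp (- real c * real f)"
      by (intro rprob_rich_matching[OF V(1) VL]) (use p in auto)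
    also have "\<dots> = exp (2 * real a * L + 2 * real f * L - real c * real f)"
      by (simp flip: exp_add)
    also have "\<dots> \<le> exp (- L)"
    proof -
      have "(32 * L) * (a / 8) \<le> real c * real f"
        using f(2) mc(2) L by (intro mult_mono) auto
      then have "4 * (real a * L) \<le> real c * real f" by (simp add: mult_ac)
      moreover have "(2 * real f) * L \<le> real a * L" using f(1) L by (intro mult_right_mono) auto
      moreover have "L \<le> real a * L" using a1 L by simp
      ultimately show ?thesis by (simp add: mult.assoc)
    qed
    finally show ?thesis .
  qed
  also have "?P ?c5 \<le> 2 * exp (- L)"
  proof -
    have b1: "\<beta> \<le> 2 * exp (- 5 * a * L)"
    proof -
      have "5 * a * L \<le> p * (a * (p * a)\<^sup>2 / (20 * c))"
      proof -
        have "5 * a * L = (100 * c * L) * (a / (20 * c))" using c1 by simp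
        also have "\<dots> \<le> ((p * a)\<^sup>2 * p) * (a / (20 * c))"
          by (intro mult_right_mono num(2)) auto
        finally show ?thesis by (simp add: mult_ac)
      qed
      then have "exp (- p * (a * (p * a)\<^sup>2 / (20 * c))) \<le> exp (- 5 * a * L)" by simp
      moreover have "2 ^ a * exp (- 100 * L) powr (a / 10) \<le> exp (- 5 * a * L)"
      proof -
        have "(2 :: real) ^ a \<le> exp 1 ^ a" using exp_ge_add_one_self[of 1] by (intro power_mono) auto
        then have "2 ^ a * exp (- 100 * L) powr (a / 10) \<le> exp (real a) * exp (- 10 * L * a)"
          by (intro mult_mono) (auto simp: powr_def simp flip: exp_of_nat_mult)
        also have "\<dots> = exp (real a * (1 - 10 * L))" by (simp add: algebra_simps flip: exp_add)
        also have "\<dots> \<le> exp (real a * (- 5 * L))"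
          using L by (intro iffD2[OF exp_le_cancel_iff] mult_left_mono) auto
        finally show ?thesis by (simp add: mult_ac)
      qed
      ultimately show ?thesis unfolding \<beta>_def by linarith
    qed
    have "?P ?c5 \<le> exp (3 * real a * L) * (2 * exp (- 5 * a * L))"
    proof (rule rprob_bex_le)
      show "finite ?T" using V(1) by simp
      have c: "real (card {S. S \<subseteq> V \<and> card S = a}) \<le> exp (real a * L)"
        by (rule card_subsets_le[OF V(1) VL])
      have "real (card ?T) \<le> exp (real a * L) * (exp (real a * L) * exp (real a * L))"
        unfolding card_cartesian_product of_nat_mult by (intro mult_mono c) auto
      then show "real (card ?T) \<le> exp (3 * real a * L)" by (simp add: mult_ac flip: exp_add)
      fix T assume "T \<in> ?T"
      obtain A Y Z where [simp]: "T = (A, Y, Z)" by (cases T)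
      show "?P (\<lambda>E. ?bad E (fst T) (fst (snd T)) (snd (snd T))) \<le> 2 * exp (- 5 * a * L)"
      proof (cases "three_parts V A Y Z a")
        case True
        interpret three_parts V A Y Z a by (rule True)
        have "?P (\<lambda>E. light E \<and> thin p E \<and> codegrees_le c E \<and> ?no E A Y Z) \<le> \<beta>"
          unfolding \<beta>_def
        proof (rule rprob_no_maximal_triangle[OF p num(1) _ _ _ regime_row_failure[OF reg]])
          have pa0: "0 \<le> p * a" using p by simp
          then have "(real c)\<^sup>2 \<le> 3 / 16000 * (p * a)" using num(3) by linarith
          then have "(320 * (p * a)) * (real c)\<^sup>2 \<le> (320 * (p * a)) * (3 / 16000 * (p * a))"
            using pa0 by (intro mult_left_mono) auto
          then show "320 * p * a * (real c)\<^sup>2 \<le> 3/50 * (p * a)\<^sup>2" by (simp add: power2_eq_square mult_ac)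
          show "real (2 * m * (1 + c)) \<le> p * a / 20" using num(4) by (simp add: algebra_simps)
        qed (use c1 L in auto)
        then show ?thesis using True b1 by simp
      next
        case False
        then show ?thesis by (simp add: rprob_def)
      qed
    qed auto
    also have "\<dots> = 2 * exp (real a * (- 2 * L))" by (simp add: algebra_simps flip: exp_add)
    also have "\<dots> \<le> 2 * exp (1 * (- L))"
    proof -
      have "1 * L \<le> real a * (2 * L)" using a1 L by (intro mult_mono) auto
      then show ?thesis by simp
    qed
    finally show ?thesis by simp
  qed
  finally show ?thesis by simp
qed

text \<open>
  If some neighbourhood contains a large part of \<open>C\<close>, choose \<open>A\<close> inside it and \<open>Y\<close>, \<open>Z\<close> outside:
  every other vertex has few neighbours in \<open>A\<close>, because codegrees are at most \<open>t\<close>.  If there is no such neighbourhood,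
  arbitrary parts of the larger size \<open>a2\<close> form a spread triple.
\<close>
lemma rprob_exists_set_far_from_nbrs:
  assumes V: "finite V" "card V = n" "V \<noteq> {}"
    and reg: "regime n p L m c a1" "regime n p L m c a2"
    and t: "9 * real n * p\<^sup>2 \<le> real t" "3 * L \<le> real t" "12000 * real t * L \<le> real a1"
    and a: "24000 * real a1 * L \<le> real a2" "6 * a2 \<le> s"
  shows "rprob (nsets V 2) p (\<lambda>E. \<exists>C. C \<subseteq> V \<and> (\<forall>x\<in>C. \<forall>y\<in>C. \<forall>z\<in>C. \<not> maximal_triangle E x y z) \<and>
      (\<forall>v\<in>V. s \<le> card (C - nbrs E v))) \<le> 13 * exp (- L)"
proof -
  let ?P = "rprob (nsets V 2) p"
  let ?no = "\<lambda>E A Y Z. \<forall>x\<in>A. \<forall>y\<in>Y. \<forall>z\<in>Z. \<not> maximal_triangle E x y z"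
  let ?c = "\<lambda>a r E. \<exists>A Y Z. spread_triple V a r E A Y Z \<and> ?no E A Y Z"
  let ?d = "\<lambda>E. \<exists>u\<in>V. \<exists>v\<in>V. u \<noteq> v \<and> t \<le> card (nbrs E u \<inter> nbrs E v)"
  have p: "0 < p" "p \<le> 1" and L: "2 \<le> L" and n: "real n \<le> exp L"
    using reg(1) by (auto simp: regime_def)
  have finE: "finite (nsets V 2)" using V(1) by (rule finite_imp_finite_nsets)
  have a12: "a1 \<le> a2"
  proof -
    have "real a1 * 1 \<le> real a1 * (24000 * L)" using L by (intro mult_left_mono) auto
    then show ?thesis using a(1) by (simp add: mult_ac)
  qed
  have "?P (\<lambda>E. \<exists>C. C \<subseteq> V \<and> ?no E C C C \<and> (\<forall>v\<in>V. s \<le> card (C - nbrs E v)))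
      \<le> ?P (\<lambda>E. ?d E \<or> (?c a1 t E \<or> ?c a2 (2 * a1) E))"
  proof (rule rprob_mono[OF finE], rule ccontr)
    fix E assume E: "E \<subseteq> nsets V 2"
      and ex: "\<exists>C. C \<subseteq> V \<and> ?no E C C C \<and> (\<forall>v\<in>V. s \<le> card (C - nbrs E v))"
    obtain C where CC: "C \<subseteq> V \<and> ?no E C C C \<and> (\<forall>v\<in>V. s \<le> card (C - nbrs E v))"
      using ex by (rule exE)
    have C: "C \<subseteq> V" "\<And>x y z. x \<in> C \<Longrightarrow> y \<in> C \<Longrightarrow> z \<in> C \<Longrightarrow> \<not> maximal_triangle E x y z"
        "\<And>v. v \<in> V \<Longrightarrow> s \<le> card (C - nbrs E v)"
      using CC by simp_all
    assume nc: "\<not> (?d E \<or> (?c a1 t E \<or> ?c a2 (2 * a1) E))"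
    note nc' = nc[unfolded de_Morgan_disj]
    note nd = nc'[THEN conjunct1] and nc1 = nc'[THEN conjunct2, THEN conjunct1]
      and nc2 = nc'[THEN conjunct2, THEN conjunct2]
    have cod: "\<not> t \<le> card (nbrs E u \<inter> nbrs E v)" if "u \<in> V" "v \<in> V" "u \<noteq> v" for u v
      using nd that by blast
    have n1: "\<not> ?no E A Y Z" if st: "spread_triple V a1 t E A Y Z" for A Y Z
    proof
      assume "?no E A Y Z"
      with st have "\<exists>A Y Z. spread_triple V a1 t E A Y Z \<and> ?no E A Y Z" by (intro exI conjI)
      with nc1 show False by (rule notE)
    qed
    have n2: "\<not> ?no E A Y Z" if st: "spread_triple V a2 (2 * a1) E A Y Z" for A Y Z
    proof
      assume "?no E A Y Z"
      with st have "\<exists>A Y Z. spread_triple V a2 (2 * a1) E A Y Z \<and> ?no E A Y Z" by (intro exI conjI)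
      with nc2 show False by (rule notE)
    qed
    have finC: "finite C" using C(1) V(1) by (rule finite_subset)
    show False
    proof (cases "\<exists>v\<in>V. 2 * a1 \<le> card (C \<inter> nbrs E v)")
      case True
      then obtain v where v: "v \<in> V" "2 * a1 \<le> card (C \<inter> nbrs E v)" by blast
      obtain A where A: "A \<subseteq> C \<inter> nbrs E v" "card A = 2 * a1"
        using obtain_subset_with_card_n[OF v(2)] by metis
      have "2 * a1 + 2 * a1 \<le> card (C - nbrs E v)" using C(3)[OF v(1)] a(2) a12 by linarith
      then obtain B where B: "B \<subseteq> C - nbrs E v" "card B = 2 * a1 + 2 * a1"
        using obtain_subset_with_card_n by metis
      have "2 * a1 \<le> card B" using B(2) by simp
      then obtain Y where Y: "Y \<subseteq> B" "card Y = 2 * a1"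
        using obtain_subset_with_card_n by metis
      have finY: "finite Y" by (rule finite_subset[OF _ finC]) (use Y B in blast)
      have cZ: "card (B - Y) = 2 * a1" using card_Diff_subset[OF finY Y(1)] B(2) Y(2) by simp
      have "A \<subseteq> V" "Y \<subseteq> V" "B - Y \<subseteq> V" "A \<inter> Y = {}" "A \<inter> (B - Y) = {}" "Y \<inter> (B - Y) = {}"
        using A(1) B(1) Y(1) C(1) by blast+
      note parts = this A(2) Y(2) cZ
      have "spread_triple V a1 t E A Y (B - Y)"
        unfolding spread_triple_def
      proof (intro conjI ballI)
        fix w assume w: "w \<in> V"
        show "card (A \<inter> nbrs E w) \<le> t \<or> Y \<inter> nbrs E w = {}"
        proof (cases "w = v")
          case True
          then show ?thesis using Y B by blast
        next
          case False
          then have "\<not> t \<le> card (nbrs E v \<inter> nbrs E w)" using cod[OF v(1) w] by blast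
          moreover have "card (A \<inter> nbrs E w) \<le> card (nbrs E v \<inter> nbrs E w)"
            using A(1) finite_subset[OF nbrs_subset[OF E] V(1)] by (intro card_mono) auto
          ultimately show ?thesis by simp
        qed
      qed (simp_all only: parts)
      then have n: "\<not> ?no E A Y (B - Y)" by (rule n1)
      have "A \<subseteq> C" "Y \<subseteq> C" "B - Y \<subseteq> C" using A(1) B(1) Y(1) by blast+
      then have "?no E A Y (B - Y)" by (intro ballI C(2)) (erule (1) subsetD)+
      with n show False by (rule notE)
    next
      case False
      obtain v where v: "v \<in> V" using V(3) by blast
      have "card (C - nbrs E v) \<le> card C" using finC by (intro card_mono) auto
      then have cC: "2 * a2 + (2 * a2 + 2 * a2) \<le> card C" using C(3)[OF v] a(2) by linarith
      then obtain D where D: "D \<subseteq> C" "card D = 2 * a2 + (2 * a2 + 2 * a2)"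
        using obtain_subset_with_card_n by metis
      have "2 * a2 \<le> card D" using D(2) by simp
      then obtain A where A: "A \<subseteq> D" "card A = 2 * a2"
        using obtain_subset_with_card_n by metis
      have finD: "finite D" using D finC finite_subset by blast
      have cDA: "card (D - A) = 2 * a2 + 2 * a2"
        using card_Diff_subset[OF finite_subset[OF A(1) finD] A(1)] A(2) D(2) by simp
      have "2 * a2 \<le> card (D - A)" using cDA by simp
      then obtain Y where Y: "Y \<subseteq> D - A" "card Y = 2 * a2"
        using obtain_subset_with_card_n by metis
      have cZ: "card (D - A - Y) = 2 * a2"
        using card_Diff_subset[OF finite_subset[OF Y(1)] Y(1)] Y(2) cDA finD by simp
      have "A \<subseteq> V" "Y \<subseteq> V" "D - A - Y \<subseteq> V" "A \<inter> Y = {}" "A \<inter> (D - A - Y) = {}" "Y \<inter> (D - A - Y) = {}"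
        using A(1) D(1) Y(1) C(1) by blast+
      note parts = this A(2) Y(2) cZ
      have "spread_triple V a2 (2 * a1) E A Y (D - A - Y)"
        unfolding spread_triple_def
      proof (intro conjI ballI)
        fix w assume w: "w \<in> V"
        have "card (A \<inter> nbrs E w) \<le> card (C \<inter> nbrs E w)"
          using A(1) D(1) finC by (intro card_mono) auto
        moreover have "\<not> 2 * a1 \<le> card (C \<inter> nbrs E w)" using False w by blast
        ultimately show "card (A \<inter> nbrs E w) \<le> 2 * a1 \<or> Y \<inter> nbrs E w = {}"
          by linarith
      qed (simp_all only: parts)
      then have n: "\<not> ?no E A Y (D - A - Y)" by (rule n2)
      have "A \<subseteq> C" "Y \<subseteq> C" "D - A - Y \<subseteq> C" using A(1) D(1) Y(1) by blast+
      then have "?no E A Y (D - A - Y)" by (intro ballI C(2)) (erule (1) subsetD)+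
      with n show False by (rule notE)
    qed
  qed
  also have "\<dots> \<le> ?P ?d + (?P (?c a1 t) + ?P (?c a2 (2 * a1)))"
    by (intro order.trans[OF rprob_disj] add_mono order.refl)
  also have "?P ?d \<le> exp (- L)"
  proof -
    have "?P ?d \<le> (real (card V))\<^sup>2 * exp (- real t)"
      by (rule rprob_high_codegree[OF V(1)]) (use p t(1) V in auto)
    also have "\<dots> \<le> (exp L)\<^sup>2 * exp (- 3 * L)"
      using n V t(2) by (intro mult_mono power_mono) auto
    also have "\<dots> = exp (- L)" by (simp add: power2_eq_square flip: exp_add)
    finally show ?thesis .
  qed
  also have "?P (?c a1 t) \<le> 6 * exp (- L)"
    by (rule rprob_spread_triple_no_triangle[OF V(1,2) reg(1) t(3)])
  also have "?P (?c a2 (2 * a1)) \<le> 6 * exp (- L)"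
    by (rule rprob_spread_triple_no_triangle[OF V(1,2) reg(2)]) (use a(1) in simp)
  finally show ?thesis by simp
qed

section \<open>Few colors do not suffice\<close>

definition uncovered :: "'a set \<Rightarrow> 'a set set \<Rightarrow> 'a set \<Rightarrow> 'a set" where
  "uncovered V E Q = {u\<in>V - Q. Q \<inter> nbrs E u = {}}"

lemma rprob_star_avoid:
  assumes "finite I" "star u Q \<subseteq> I" "0 \<le> p" "p \<le> 1"
  shows "rprob I p (\<lambda>E. Q \<inter> nbrs E u = {}) = (1 - p) ^ card Q"
proof -
  have "Q \<inter> nbrs E u = {} \<longleftrightarrow> star u Q \<inter> E = {}" for E
    by (auto simp: star_def nbrs_def)
  then show ?thesis using rprob_avoid[OF assms] by simp
qed

text \<open>
  First moment over \<open>Q\<close> and a set \<open>Y\<close> of \<open>h\<close> vertices that contains the uncovered ones: every other vertex must have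
  a neighbour in \<open>Q\<close>, and these events are independent.
\<close>
lemma rprob_few_uncovered:
  fixes p L :: real
  assumes V: "finite V" "real (card V) \<le> exp L" and p: "0 \<le> p" "p \<le> 1" and kh: "k + h \<le> card V"
  shows "rprob (nsets V 2) p (\<lambda>E. \<exists>Q. Q \<subseteq> V \<and> card Q = k \<and> card (uncovered V E Q) \<le> h)
    \<le> exp ((real k + real h) * L - (1 - p) ^ k * (real (card V) - real k - real h))"
proof -
  have finE: "finite (nsets V 2)" using V(1) by (rule finite_imp_finite_nsets)
  let ?S = "\<lambda>k. {S. S \<subseteq> V \<and> card S = k}"
  let ?q = "(1 - p) ^ k"
  let ?P = "rprob (nsets V 2) p"
  \<comment> \<open>\<open>Y\<close> has exactly \<open>h\<close> elements, so that no sum over sizes is needed.\<close>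
  let ?cov = "\<lambda>E Q Y. Y \<subseteq> V - Q \<and> (\<forall>u\<in>V - Q - Y. Q \<inter> nbrs E u \<noteq> {})"
  have "?P (\<lambda>E. \<exists>Q. Q \<subseteq> V \<and> card Q = k \<and> card (uncovered V E Q) \<le> h) \<le>
      ?P (\<lambda>E. \<exists>QY\<in>?S k \<times> ?S h. ?cov E (fst QY) (snd QY))"
  proof (rule rprob_mono[OF finE])
    fix E assume "\<exists>Q. Q \<subseteq> V \<and> card Q = k \<and> card (uncovered V E Q) \<le> h"
    then obtain Q where Q: "Q \<subseteq> V" "card Q = k" "card (uncovered V E Q) \<le> h" by blast
    have "finite Q" using Q(1) V(1) by (rule finite_subset)
    then have c: "h \<le> card (V - Q)" using Q kh by (simp add: card_Diff_subset)
    have "uncovered V E Q \<subseteq> V - Q" by (auto simp: uncovered_def)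
    then obtain Y where Y: "uncovered V E Q \<subseteq> Y" "Y \<subseteq> V - Q" "card Y = h"
      using exists_subset_between[OF Q(3) c] V(1) by blast
    have "?cov E Q Y" using Y(1,2) by (auto simp: uncovered_def)
    moreover have "(Q, Y) \<in> ?S k \<times> ?S h" using Q Y by auto
    ultimately show "\<exists>QY\<in>?S k \<times> ?S h. ?cov E (fst QY) (snd QY)"
      by (intro bexI[of _ "(Q, Y)"]) simp_all
  qed
  also have "\<dots> \<le> exp ((real k + real h) * L) * exp (- ?q * (real (card V) - real k - real h))"
  proof (rule rprob_bex_le)
    show "finite (?S k \<times> ?S h)" using V(1) by simp
    have "real (card (?S k \<times> ?S h)) \<le> exp (real k * L) * exp (real h * L)"
      unfolding card_cartesian_product of_nat_mult by (intro mult_mono card_subsets_le V) auto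
    then show "real (card (?S k \<times> ?S h)) \<le> exp ((real k + real h) * L)"
      by (simp add: algebra_simps flip: exp_add)
    fix QY assume QY: "QY \<in> ?S k \<times> ?S h"
    obtain Q Y where [simp]: "QY = (Q, Y)" by (cases QY)
    have Q: "Q \<subseteq> V" "card Q = k" "card Y = h" "finite Q" "finite Y"
      using QY by (auto intro: finite_subset[OF _ V(1)])
    show "?P (\<lambda>E. ?cov E (fst QY) (snd QY)) \<le> exp (- ?q * (real (card V) - real k - real h))"
    proof (cases "Y \<subseteq> V - Q")
      case True
      have "?P (\<lambda>E. \<forall>u\<in>V - Q - Y. Q \<inter> nbrs E u \<noteq> {}) \<le> (1 - ?q) ^ card (V - Q - Y)"
      proof (rule rprob_indep_le[OF finE, where J = "\<lambda>u. star u Q"])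
        show "finite (V - Q - Y)" using V(1) by simp
        show "disjoint_family_on (\<lambda>u. star u Q) (V - Q - Y)"
          by (auto simp: disjoint_family_on_def star_def doubleton_eq_iff)
        show "(Q \<inter> nbrs E u \<noteq> {}) = (Q \<inter> nbrs (E \<inter> star u Q) u \<noteq> {})" for u E
          by (simp add: nbrs_Int_star)
        fix u assume u: "u \<in> V - Q - Y"
        show J: "star u Q \<subseteq> nsets V 2" using u Q(1) by (auto simp: star_def)
        show "?P (\<lambda>E. Q \<inter> nbrs E u \<noteq> {}) \<le> 1 - ?q"
          using rprob_star_avoid[OF finE J p] Q(2) by (simp add: rprob_not)
      qed (use p in \<open>auto simp: power_le_one\<close>)
      also have "\<dots> \<le> exp (- ?q) ^ card (V - Q - Y)"
        using exp_ge_add_one_self[of "- ?q"] p by (intro power_mono) (auto simp: power_le_one)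
      also have "card (V - Q - Y) = card V - k - h"
        using True Q by (simp add: card_Diff_subset)
      also have "exp (- ?q) ^ (card V - k - h) = exp (- ?q * (real (card V) - real k - real h))"
        using kh by (simp add: of_nat_diff mult_ac flip: exp_of_nat_mult)
      finally show ?thesis using True by simp
    qed (simp add: rprob_def)
  qed auto
  finally show ?thesis by (simp add: algebra_simps flip: exp_add)
qed

lemma maximal_triangle_clique:
  assumes E: "E \<subseteq> nsets V 2" and t: "maximal_triangle E x y z"
  shows "maximal_clique V E {x, y, z}" "card {x, y, z} = 3"
proof -
  have e: "{x, y} \<in> E" "{x, z} \<in> E" "{y, z} \<in> E" and no: "nbrs E x \<inter> nbrs E y \<inter> nbrs E z = {}"
    using t by (auto simp: maximal_triangle_def)
  have d: "x \<noteq> y" "x \<noteq> z" "y \<noteq> z" and xV: "{x, y, z} \<subseteq> V"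
    using e[THEN subsetD[OF E]] by auto
  show "card {x, y, z} = 3" using d by simp
  have "clique {x, y, z} E" using e by (auto simp: clique_def insert_commute)
  moreover have "L = {x, y, z}" if L: "{x, y, z} \<subseteq> L" "L \<subseteq> V" "clique L E" for L
  proof (rule ccontr)
    assume "L \<noteq> {x, y, z}"
    then obtain w where w: "w \<in> L" "w \<noteq> x" "w \<noteq> y" "w \<noteq> z" using L(1) by blast
    have "{x, w} \<in> E" "{y, w} \<in> E" "{z, w} \<in> E"
      using L(1,3) w unfolding clique_def by auto
    then show False using no by (auto simp: nbrs_def)
  qed
  ultimately show "maximal_clique V E {x, y, z}"
    using xV unfolding maximal_clique_def by blast
qed

lemma clique_coloring_chromatic:
  assumes "finite V"
  obtains c where "clique_coloring V E (clique_chromatic_number V E) c"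
proof -
  have "\<exists>c. clique_coloring V E (clique_chromatic_number V E) c"
    unfolding clique_chromatic_number_def using clique_coloring_exists[OF assms] by (rule LeastI)
  then show thesis using that by blast
qed

text \<open>
  Each color class is close to a neighbourhood; take \<open>Q\<close> to contain the centres.
\<close>
lemma uncovered_if_few_colors:
  assumes V: "finite V" and E: "E \<subseteq> nsets V 2"
    and k: "clique_chromatic_number V E \<le> k" "k \<le> card V"
    and near: "\<And>C. C \<subseteq> V \<Longrightarrow> (\<And>x y z. x \<in> C \<Longrightarrow> y \<in> C \<Longrightarrow> z \<in> C \<Longrightarrow> \<not> maximal_triangle E x y z) \<Longrightarrow>
      \<exists>v\<in>V. card (C - nbrs E v) \<le> s"
  obtains Q where "Q \<subseteq> V" "card Q = k" "card (uncovered V E Q) \<le> k * s"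
proof -
  let ?k = "clique_chromatic_number V E"
  obtain c where c: "clique_coloring V E ?k c" using clique_coloring_chromatic[OF V] by blast
  define C where "C = (\<lambda>i. {v\<in>V. c v = i})"
  have "\<not> maximal_triangle E x y z" if "x \<in> C i" "y \<in> C i" "z \<in> C i" for i x y z
  proof
    assume "maximal_triangle E x y z"
    then have "maximal_clique V E {x, y, z}" "card {x, y, z} = 3"
      by (rule maximal_triangle_clique[OF E])+
    then have "\<not> monochromatic c {x, y, z}" using c by (simp add: clique_coloring_def)
    moreover have "monochromatic c {x, y, z}" using that by (auto simp: monochromatic_def C_def)
    ultimately show False by blast
  qed
  then have "\<exists>v\<in>V. card (C i - nbrs E v) \<le> s" for i
    by (intro near) (auto simp: C_def)
  then obtain v where v: "\<And>i. v i \<in> V" "\<And>i. card (C i - nbrs E (v i)) \<le> s" by metis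
  have "v ` {..<?k} \<subseteq> V" using v(1) by auto
  moreover have "card (v ` {..<?k}) \<le> k" using card_image_le[of "{..<?k}" v] k(1) by simp
  ultimately obtain Q where Q: "v ` {..<?k} \<subseteq> Q" "Q \<subseteq> V" "card Q = k"
    using exists_subset_between[of "v ` {..<?k}" k V] k(2) V by blast
  have finC: "finite (C i)" for i using V by (simp add: C_def)
  have "uncovered V E Q \<subseteq> (\<Union>i<?k. C i - nbrs E (v i))"
  proof
    fix u assume u: "u \<in> uncovered V E Q"
    then have uV: "u \<in> V" by (simp add: uncovered_def)
    then have cu: "c u < ?k" using c by (auto simp: clique_coloring_def)
    then have "v (c u) \<in> Q" using Q(1) by auto
    then have "v (c u) \<notin> nbrs E u" using u by (auto simp: uncovered_def)
    then have "u \<notin> nbrs E (v (c u))" using sym_nbrs by metis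
    then show "u \<in> (\<Union>i<?k. C i - nbrs E (v i))" using cu uV by (auto simp: C_def)
  qed
  then have "card (uncovered V E Q) \<le> card (\<Union>i<?k. C i - nbrs E (v i))"
    using finC by (intro card_mono) auto
  also have "\<dots> \<le> (\<Sum>i<?k. card (C i - nbrs E (v i)))"
    by (rule card_UN_le) simp
  also have "\<dots> \<le> (\<Sum>i<?k. s)" by (intro sum_mono v(2))
  also have "\<dots> \<le> k * s" using k(1) by simp
  finally show thesis using that Q by blast
qed

lemma rprob_few_colors:
  fixes p L :: real
  assumes V: "finite V" "card V = n" "V \<noteq> {}"
    and reg: "regime n p L m c a1" "regime n p L m c a2"
    and t: "9 * real n * p\<^sup>2 \<le> real t" "3 * L \<le> real t" "12000 * real t * L \<le> real a1"
    and a: "24000 * real a1 * L \<le> real a2" "6 * a2 \<le> s"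
    and ks: "k + k * s \<le> n"
  shows "rprob (nsets V 2) p (\<lambda>E. clique_chromatic_number V E \<le> k) \<le> 13 * exp (- L) +
    exp ((real k + real (k * s)) * L - (1 - p) ^ k * (real n - real k - real (k * s)))"
proof -
  have finE: "finite (nsets V 2)" using V(1) by (rule finite_imp_finite_nsets)
  let ?P = "rprob (nsets V 2) p"
  let ?far = "\<lambda>E. \<exists>C. C \<subseteq> V \<and> (\<forall>x\<in>C. \<forall>y\<in>C. \<forall>z\<in>C. \<not> maximal_triangle E x y z) \<and>
      (\<forall>v\<in>V. s \<le> card (C - nbrs E v))"
  let ?unc = "\<lambda>E. \<exists>Q. Q \<subseteq> V \<and> card Q = k \<and> card (uncovered V E Q) \<le> k * s"
  have p: "0 \<le> p" "p \<le> 1" "real (card V) \<le> exp L" using reg(1) V(2) by (auto simp: regime_def)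
  have "?P (\<lambda>E. clique_chromatic_number V E \<le> k) \<le> ?P (\<lambda>E. ?far E \<or> ?unc E)"
  proof (rule rprob_mono[OF finE])
    fix E assume E: "E \<subseteq> nsets V 2" and k: "clique_chromatic_number V E \<le> k"
    show "?far E \<or> ?unc E"
    proof (cases "?far E")
      case False
      have near: "\<exists>v\<in>V. card (C - nbrs E v) \<le> s"
        if C: "C \<subseteq> V" "\<And>x y z. x \<in> C \<Longrightarrow> y \<in> C \<Longrightarrow> z \<in> C \<Longrightarrow> \<not> maximal_triangle E x y z" for C
      proof (rule ccontr)
        assume "\<not> (\<exists>v\<in>V. card (C - nbrs E v) \<le> s)"
        then have "\<forall>v\<in>V. s \<le> card (C - nbrs E v)" by (simp add: not_le less_imp_le)
        moreover have "\<forall>x\<in>C. \<forall>y\<in>C. \<forall>z\<in>C. \<not> maximal_triangle E x y z" using C(2) by simp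
        ultimately have "?far E" using C(1) by (intro exI[of _ C] conjI)
        with False show False by (rule notE)
      qed
      have "k \<le> card V" using ks V(2) by simp
      then obtain Q where "Q \<subseteq> V" "card Q = k" "card (uncovered V E Q) \<le> k * s"
        using uncovered_if_few_colors[OF V(1) E k _ near] by blast
      then show ?thesis by (intro disjI2 exI[of _ Q] conjI)
    qed (rule disjI1)
  qed
  also have "\<dots> \<le> ?P ?far + ?P ?unc" by (rule rprob_disj)
  also have "\<dots> \<le> 13 * exp (- L) +
    exp ((real k + real (k * s)) * L - (1 - p) ^ k * (real (card V) - real k - real (k * s)))"
    by (intro add_mono rprob_exists_set_far_from_nbrs[OF V reg t a]
        rprob_few_uncovered[OF V(1) p(3,1,2)]) (use ks V(2) in simp)
  finally show ?thesis using V(2) by simp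
qed

section \<open>An explicit coloring\<close>

text \<open>
  The obstacle to greedy coloring with \<open>T\<close> colors: a vertex \<open>v\<close> of \<open>S\<close> with \<open>T\<close> disjoint edges among its
  neighbours in \<open>S\<close>.
\<close>
definition book :: "'a set set \<Rightarrow> 'a set \<Rightarrow> nat \<Rightarrow> bool" where
  "book E S T \<longleftrightarrow> (\<exists>v\<in>S. \<exists>M. M \<subseteq> E \<inter> nsets (S \<inter> nbrs E v) 2 \<and> disjoint M \<and> card M = T)"

definition triangle_free_coloring :: "'a set set \<Rightarrow> 'a set \<Rightarrow> nat \<Rightarrow> ('a \<Rightarrow> nat) \<Rightarrow> bool" where
  "triangle_free_coloring E S T c \<longleftrightarrow> c \<in> S \<rightarrow> {..<T} \<and>
     (\<forall>x\<in>S. \<forall>y\<in>S. \<forall>z\<in>S. {x, y} \<in> E \<and> {x, z} \<in> E \<and> {y, z} \<in> E \<longrightarrow> \<not> (c x = c y \<and> c x = c z))"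

text \<open>
  Color the vertices one by one.  If no color is available for \<open>v\<close>, each color class contains an edge
  in the neighbourhood of \<open>v\<close>; edges from different classes are disjoint, which gives a book.
\<close>
lemma triangle_free_coloring_if_no_book:
  assumes E: "E \<subseteq> nsets V 2" and S: "finite S" and no: "\<not> book E S T"
  shows "\<exists>c. triangle_free_coloring E S T c"
  using S no
proof (induction S rule: finite_induct)
  case empty
  then show ?case by (simp add: triangle_free_coloring_def)
next
  case (insert v S)
  have "\<not> book E S T"
  proof
    assume "book E S T"
    then obtain u M where u: "u \<in> S" and M: "M \<subseteq> E \<inter> nsets (S \<inter> nbrs E u) 2" "disjoint M" "card M = T"
      by (auto simp: book_def)
    have "M \<subseteq> E \<inter> nsets (insert v S \<inter> nbrs E u) 2"
      using M(1) nsets_mono[of "S \<inter> nbrs E u" "insert v S \<inter> nbrs E u" 2] by blast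
    then have "book E (insert v S) T" unfolding book_def using u M(2,3) by blast
    then show False using insert.prems by blast
  qed
  then obtain c where c: "triangle_free_coloring E S T c" using insert.IH by blast
  let ?A = "\<lambda>i. E \<inter> nsets ({u\<in>S. c u = i} \<inter> nbrs E v) 2"
  have "\<exists>i<T. ?A i = {}"
  proof (rule ccontr)
    assume "\<not> (\<exists>i<T. ?A i = {})"
    then have "\<forall>i\<in>{..<T}. \<exists>e. e \<in> ?A i" by auto
    then obtain e where e: "\<And>i. i < T \<Longrightarrow> e i \<in> ?A i" by (metis lessThan_iff)
    have sub: "e i \<subseteq> {u\<in>S. c u = i} \<inter> nbrs E v" "e i \<noteq> {}" if "i < T" for i
      using e[OF that] by (auto simp: nsets_def)
    have disj: "e i \<inter> e j = {}" if "i < T" "j < T" "i \<noteq> j" for i j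
      using sub(1)[OF that(1)] sub(1)[OF that(2)] that(3) by blast
    have inj: "inj_on e {..<T}"
    proof (rule inj_onI)
      fix i j assume ij: "i \<in> {..<T}" "j \<in> {..<T}" "e i = e j"
      then show "i = j" using disj[of i j] sub(2)[of i] by auto
    qed
    have "e ` {..<T} \<subseteq> E \<inter> nsets (insert v S \<inter> nbrs E v) 2"
    proof
      fix d assume "d \<in> e ` {..<T}"
      then obtain i where i: "i < T" "d = e i" by auto
      have "nsets ({u\<in>S. c u = i} \<inter> nbrs E v) 2 \<subseteq> nsets (insert v S \<inter> nbrs E v) 2"
        by (rule nsets_mono) auto
      then show "d \<in> E \<inter> nsets (insert v S \<inter> nbrs E v) 2" using e[OF i(1)] i(2) by blast
    qed
    moreover have "disjoint (e ` {..<T})"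
      unfolding disjoint_def
    proof (intro ballI impI)
      fix d d' assume "d \<in> e ` {..<T}" "d' \<in> e ` {..<T}" "d \<noteq> d'"
      then obtain i j where "i < T" "j < T" "d = e i" "d' = e j" "i \<noteq> j" by auto
      then show "d \<inter> d' = {}" using disj by simp
    qed
    moreover have "card (e ` {..<T}) = T" using card_image[OF inj] by simp
    ultimately have "book E (insert v S) T" unfolding book_def by blast
    then show False using insert.prems by blast
  qed
  then obtain i where i: "i < T" "?A i = {}" by blast
  have ok: "\<not> (y \<in> S \<and> z \<in> S \<and> {v, y} \<in> E \<and> {v, z} \<in> E \<and> {y, z} \<in> E \<and> c y = i \<and> c z = i)" for y z
  proof
    assume yz: "y \<in> S \<and> z \<in> S \<and> {v, y} \<in> E \<and> {v, z} \<in> E \<and> {y, z} \<in> E \<and> c y = i \<and> c z = i"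
    then have "y \<noteq> z" using subsetD[OF E, of "{y, z}"] by auto
    then have "{y, z} \<in> ?A i" using yz by (simp add: nbrs_def)
    then show False using i(2) by blast
  qed
  have loop: "{u} \<notin> E" for u using E by (auto simp: nsets_def)
  have "triangle_free_coloring E (insert v S) T (c(v := i))"
    unfolding triangle_free_coloring_def
  proof (intro conjI ballI impI)
    show "c(v := i) \<in> insert v S \<rightarrow> {..<T}"
      using c i(1) by (auto simp: triangle_free_coloring_def)
    fix x y z assume xyz: "x \<in> insert v S" "y \<in> insert v S" "z \<in> insert v S"
      and t: "{x, y} \<in> E \<and> {x, z} \<in> E \<and> {y, z} \<in> E"
    have ne: "x \<noteq> y" "x \<noteq> z" "y \<noteq> z" using t loop by (metis insert_absorb2)+
    consider "x = v" | "y = v" | "z = v" | "x \<noteq> v" "y \<noteq> v" "z \<noteq> v" by blast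
    then show "\<not> ((c(v := i)) x = (c(v := i)) y \<and> (c(v := i)) x = (c(v := i)) z)"
    proof cases
      case 1
      then show ?thesis using ok[of y z] xyz t ne by auto
    next
      case 2
      then show ?thesis using ok[of x z] xyz t ne by (auto simp: insert_commute)
    next
      case 3
      then show ?thesis using ok[of x y] xyz t ne by (auto simp: insert_commute)
    next
      case 4
      then show ?thesis using c xyz t by (simp add: triangle_free_coloring_def)
    qed
  qed
  then show ?case by blast
qed

text \<open>
  A book with given \<open>v\<close> and given disjoint edges requires \<open>3 * T\<close> edges, so its first moment
  is that of \<open>T\<close> successes of probability \<open>p ^ 3\<close> each.
\<close>
lemma rprob_book:
  fixes p :: real
  assumes I: "finite I" "nsets S 2 \<subseteq> I" "I \<subseteq> nsets V 2" and S: "finite S" "card S \<le> s" and p: "0 \<le> p" "p \<le> 1"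
    and T: "9 * (real s)\<^sup>2 * p ^ 3 \<le> 2 * real T"
  shows "rprob I p (\<lambda>E. book E S T) \<le> real s * exp (- real T)"
proof -
  let ?M = "{M. M \<subseteq> nsets S 2 \<and> card M = T}"
  have fS: "finite (nsets S 2)" using S(1) by (rule finite_imp_finite_nsets)
  have "rprob I p (\<lambda>E. book E S T) \<le> rprob I p (\<lambda>E. \<exists>v\<in>S. \<exists>M\<in>?M. disjoint M \<and> v \<notin> \<Union>M \<and> M \<union> star v (\<Union>M) \<subseteq> E)"
  proof (rule rprob_mono[OF I(1)])
    fix E assume E: "E \<subseteq> I" and "book E S T"
    then obtain v M where v: "v \<in> S" and M: "M \<subseteq> E \<inter> nsets (S \<inter> nbrs E v) 2" "disjoint M" "card M = T"
      unfolding book_def by blast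
    have "nsets (S \<inter> nbrs E v) 2 \<subseteq> nsets S 2" by (rule nsets_mono) auto
    then have MS: "M \<in> ?M" using M(1,3) by blast
    have U: "\<Union>M \<subseteq> nbrs E v" using M(1) by (auto simp: nsets_def)
    have "v \<notin> nbrs E v" using E I(3) by (intro nbrs_irrefl[of E V]) blast
    then have "v \<notin> \<Union>M" using U by blast
    moreover have "M \<union> star v (\<Union>M) \<subseteq> E" using M(1) U by (simp add: star_subset_iff)
    ultimately show "\<exists>v\<in>S. \<exists>M\<in>?M. disjoint M \<and> v \<notin> \<Union>M \<and> M \<union> star v (\<Union>M) \<subseteq> E"
      using v MS M(2) by (intro bexI conjI)
  qed
  also have "\<dots> \<le> real s * exp (- real T)"
  proof (rule rprob_bex_le)
    fix v assume v: "v \<in> S"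
    have "rprob I p (\<lambda>E. \<exists>M\<in>?M. disjoint M \<and> v \<notin> \<Union>M \<and> M \<union> star v (\<Union>M) \<subseteq> E) \<le>
        real (card (nsets S 2) choose T) * (p ^ 3) ^ T"
    proof (rule rprob_bex_le)
      show "finite ?M" using fS by simp
      show "real (card ?M) \<le> real (card (nsets S 2) choose T)" by (simp add: n_subsets[OF fS])
      fix M assume M: "M \<in> ?M"
      show "rprob I p (\<lambda>E. disjoint M \<and> v \<notin> \<Union>M \<and> M \<union> star v (\<Union>M) \<subseteq> E) \<le> (p ^ 3) ^ T"
      proof (cases "disjoint M \<and> v \<notin> \<Union>M")
        case True
        have MS: "M \<subseteq> nsets S 2" "card M = T" and finM: "finite M" using M finite_subset[OF _ fS] by auto
        have US: "\<Union>M \<subseteq> S" using MS(1) by (auto simp: nsets_def)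
        have "star v (\<Union>M) \<subseteq> nsets S 2"
        proof
          fix e assume "e \<in> star v (\<Union>M)"
          then obtain u where u: "u \<in> \<Union>M" "e = {v, u}" unfolding star_def by (rule imageE)
          have "u \<in> S" using u(1) US by (rule subsetD[rotated])
          moreover have "u \<noteq> v" using u(1) True by blast
          ultimately show "e \<in> nsets S 2" using v u(2) by simp
        qed
        then have sub: "M \<union> star v (\<Union>M) \<subseteq> I" using MS(1) I(2) by blast
        have "M \<inter> star v (\<Union>M) = {}" using True by (auto simp: star_def)
        then have "card (M \<union> star v (\<Union>M)) = 3 * T"
          using finM US finite_subset[OF US S(1)] card_Union_nsets2[OF MS(1) _ finM] True MS(2)
          by (subst card_Un_disjoint) (auto simp: star_def[of v "\<Union>M"] card_star[unfolded star_def])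
        moreover have "rprob I p (\<lambda>E. M \<union> star v (\<Union>M) \<subseteq> E) = p ^ card (M \<union> star v (\<Union>M))"
          by (rule rprob_subset[OF I(1) sub p])
        ultimately show ?thesis using True by (simp add: power_mult)
      next
        case False
        then have "rprob I p (\<lambda>E. disjoint M \<and> v \<notin> \<Union>M \<and> M \<union> star v (\<Union>M) \<subseteq> E) = rprob I p (\<lambda>E. False)"
          by (intro rprob_cong I(1)) blast
        then show ?thesis using p by (simp add: rprob_def)
      qed
    qed (use p in auto)
    also have "\<dots> \<le> exp (- real T)"
    proof (rule choose_times_power_le)
      have "2 * card (nsets S 2) \<le> s * s"
      proof -
        have "nsets S 2 = {N. N \<subseteq> S \<and> card N = 2}" by (auto simp: nsets_def intro: finite_subset[OF _ S(1)])
        then have "card (nsets S 2) = card S choose 2" using S(1) by (simp add: n_subsets)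
        then have "2 * card (nsets S 2) \<le> card S * (card S - 1)"
          unfolding choose_two by (metis times_div_less_eq_dividend)
        also have "\<dots> \<le> s * s" using S(2) by (intro mult_le_mono) auto
        finally show ?thesis .
      qed
      then have "real (2 * card (nsets S 2)) \<le> real (s * s)" by (rule of_nat_mono)
      then have "2 * real (card (nsets S 2)) \<le> (real s)\<^sup>2" by (simp add: power2_eq_square)
      then have "9 * (2 * real (card (nsets S 2))) * p ^ 3 \<le> 9 * (real s)\<^sup>2 * p ^ 3"
        using p by (intro mult_right_mono mult_left_mono) auto
      then show "9 * real (card (nsets S 2)) * p ^ 3 \<le> real T" using T by linarith
    qed (use p in auto)
    finally show "rprob I p (\<lambda>E. \<exists>M\<in>?M. disjoint M \<and> v \<notin> \<Union>M \<and> M \<union> star v (\<Union>M) \<subseteq> E) \<le> exp (- real T)" .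
  qed (use S in auto)
  finally show ?thesis .
qed

text \<open>
  A clique inside a neighbourhood is extended by the centre.  In a class without triangles, a clique with at least two
  vertices is an edge and is extended by a common neighbour of its ends.
\<close>
lemma clique_coloringI:
  assumes V: "finite V" and E: "E \<subseteq> nsets V 2"
    and common: "\<And>u v. {u, v} \<in> E \<Longrightarrow> nbrs E u \<inter> nbrs E v \<noteq> {}"
    and c: "c \<in> V \<rightarrow> {..<k}"
    and classes: "\<And>i. (\<exists>q\<in>V. {v\<in>V. c v = i} \<subseteq> nbrs E q) \<or>
      (\<forall>x\<in>V. \<forall>y\<in>V. \<forall>z\<in>V. {x, y} \<in> E \<and> {x, z} \<in> E \<and> {y, z} \<in> E \<longrightarrow> \<not> (c x = i \<and> c y = i \<and> c z = i))"
  shows "clique_coloring V E k c"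
  unfolding clique_coloring_def
proof (intro conjI allI impI c)
  fix K assume K: "maximal_clique V E K \<and> 2 \<le> card K"
  note mc = K[THEN conjunct1, unfolded maximal_clique_def]
  have KV: "K \<subseteq> V" and cl: "clique K E"
    using mc by simp_all
  have max: "L = K" if "K \<subseteq> L" "L \<subseteq> V" "clique L E" for L
    using mc[THEN conjunct2, THEN conjunct2, rule_format, of L] that by simp
  have clE: "{x, y} \<in> E" if "x \<in> K" "y \<in> K" "x \<noteq> y" for x y
    using cl that unfolding clique_def by simp
  have ext: "w \<in> K" if w: "w \<in> V" "\<And>u. u \<in> K \<Longrightarrow> u \<noteq> w \<Longrightarrow> {u, w} \<in> E" for w
  proof -
    have "clique (insert w K) E"
      unfolding clique_def
    proof (intro ballI impI)
      fix x y assume xy: "x \<in> insert w K" "y \<in> insert w K" "x \<noteq> y"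
      show "{x, y} \<in> E"
      proof (cases "x = w")
        case True
        then have "{y, w} \<in> E" using w(2)[of y] xy by auto
        then show ?thesis using True by (simp add: insert_commute)
      next
        case False
        show ?thesis
        proof (cases "y = w")
          case True
          then show ?thesis using w(2)[of x] xy by auto
        next
          case False
          then have "x \<in> K" "y \<in> K" using xy \<open>x \<noteq> w\<close> by simp_all
          then show ?thesis using clE xy(3) by simp
        qed
      qed
    qed
    then have "insert w K = K" using KV w(1) by (intro max) auto
    then show ?thesis by blast
  qed
  show "\<not> monochromatic c K"
  proof
    assume "monochromatic c K"
    then obtain i where i': "\<forall>v\<in>K. c v = i" unfolding monochromatic_def by (rule exE)
    then have i: "c v = i" if "v \<in> K" for v using that by simp
    from classes[of i] show False
    proof (elim disjE bexE)
      fix q assume q: "q \<in> V" "{v\<in>V. c v = i} \<subseteq> nbrs E q"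
      have Kq: "K \<subseteq> nbrs E q"
      proof
        fix v assume "v \<in> K"
        then have "v \<in> {v\<in>V. c v = i}" using KV i by blast
        then show "v \<in> nbrs E q" using q(2) by blast
      qed
      have "q \<in> K"
      proof (rule ext[OF q(1)])
        fix u assume "u \<in> K"
        then have "u \<in> nbrs E q" using Kq by blast
        then show "{u, q} \<in> E" by (simp add: nbrs_def insert_commute)
      qed
      then show False using Kq nbrs_irrefl[OF E] by blast
    next
      assume tri: "\<forall>x\<in>V. \<forall>y\<in>V. \<forall>z\<in>V. {x, y} \<in> E \<and> {x, z} \<in> E \<and> {y, z} \<in> E \<longrightarrow> \<not> (c x = i \<and> c y = i \<and> c z = i)"
      obtain T where T: "T \<subseteq> K" "card T = 2"
        using obtain_subset_with_card_n[OF K[THEN conjunct2]] by metis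
      obtain x y where xy: "T = {x, y}" "x \<noteq> y" using T(2) unfolding card_2_iff by blast
      have xK: "x \<in> K" "y \<in> K" using T xy by auto
      have e: "{x, y} \<in> E" using clE xK xy(2) by simp
      obtain w where w: "w \<in> nbrs E x" "w \<in> nbrs E y" using common[OF e] by blast
      have wV: "w \<in> V" using w(1) nbrs_subset[OF E] by blast
      have K2: "u = x \<or> u = y" if u: "u \<in> K" for u
      proof (rule ccontr)
        assume "\<not> (u = x \<or> u = y)"
        then have "x \<noteq> u" "y \<noteq> u" by auto
        then have "{x, u} \<in> E" "{y, u} \<in> E" using clE u xK by simp_all
        moreover have "x \<in> V" "y \<in> V" "u \<in> V" using KV u xK by auto
        ultimately show False using tri[rule_format, of x y u] e i[OF u] i[OF xK(1)] i[OF xK(2)] by simp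
      qed
      have "w \<in> K"
      proof (rule ext[OF wV])
        fix u assume "u \<in> K" "u \<noteq> w"
        then have "u = x \<or> u = y" using K2 by simp
        then show "{u, w} \<in> E" using w by (auto simp: nbrs_def)
      qed
      then have "w = x \<or> w = y" by (rule K2)
      then show False using w nbrs_irrefl[OF E] by auto
    qed
  qed
qed

lemma clique_chromatic_number_le:
  assumes "clique_coloring V E k c"
  shows "clique_chromatic_number V E \<le> k"
  unfolding clique_chromatic_number_def using assms by (intro Least_le) blast

text \<open>
  The first \<open>k\<close> colors are used for neighbourhoods of vertices of \<open>Q\<close>; then come \<open>T\<close> colors for each of the
  \<open>B\<close> blocks and \<open>T\<close> more for \<open>Q\<close> itself.
\<close>
lemma clique_chromatic_number_le_if_blocks:
  assumes V: "finite V" and E: "E \<subseteq> nsets V 2"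
    and common: "\<And>u v. {u, v} \<in> E \<Longrightarrow> nbrs E u \<inter> nbrs E v \<noteq> {}"
    and Q: "Q \<subseteq> V" "card Q = k"
    and g: "g \<in> uncovered V E Q \<rightarrow> {..<B}"
    and blocks: "\<And>j. j < B \<Longrightarrow> \<not> book E {u\<in>uncovered V E Q. g u = j} T" and QT: "\<not> book E Q T"
  shows "clique_chromatic_number V E \<le> k + (B + 1) * T"
proof -
  define U where "U = uncovered V E Q"
  \<comment> \<open>Treat \<open>Q\<close> as the additional block number \<open>B\<close>.\<close>
  define blk where "blk = (\<lambda>v. if v \<in> Q then B else g v)"
  define S where "S = (\<lambda>j. {v\<in>Q \<union> U. blk v = j})"
  have UV: "U \<subseteq> V - Q" by (auto simp: U_def uncovered_def)
  have finQ: "finite Q" using Q(1) V by (rule finite_subset)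
  have finS: "finite (S j)" for j
    by (rule finite_subset[OF _ V]) (use UV Q(1) in \<open>auto simp: S_def\<close>)
  have gU: "g u < B" if "u \<in> U" for u using g that by (auto simp: U_def)
  have blkB: "blk v \<le> B" if "v \<in> Q \<union> U" for v
    using that gU[of v] by (auto simp: blk_def)
  have "\<exists>c. triangle_free_coloring E (S j) T c" if "j \<le> B" for j
  proof (rule triangle_free_coloring_if_no_book[OF E finS])
    show "\<not> book E (S j) T"
    proof (cases "j = B")
      case True
      have "S j = Q" using True gU UV by (fastforce simp: S_def blk_def)
      then show ?thesis using QT by simp
    next
      case False
      have "S j = {u\<in>U. g u = j}" using False UV by (auto simp: S_def blk_def)
      then show ?thesis using blocks[of j] that False by (simp add: U_def)
    qed
  qed
  then obtain cc where cc: "\<And>j. j \<le> B \<Longrightarrow> triangle_free_coloring E (S j) T (cc j)" by metis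
  obtain q where q: "bij_betw q {..<k} Q" using ex_bij_betw_nat_finite[OF finQ] Q(2) by (auto simp: atLeast0LessThan)
  define c where "c = (\<lambda>v. if v \<in> Q \<union> U then k + (blk v * T + cc (blk v) v) else (SOME i. i < k \<and> q i \<in> nbrs E v))"
  have cs: "cc (blk v) v < T" if "v \<in> Q \<union> U" for v
  proof -
    have "v \<in> S (blk v)" using that by (simp add: S_def)
    then show ?thesis using cc[OF blkB[OF that]] by (auto simp: triangle_free_coloring_def)
  qed
  have cn: "c v < k \<and> q (c v) \<in> nbrs E v" if "v \<in> V" "v \<notin> Q \<union> U" for v
  proof -
    have "\<exists>w. w \<in> Q \<inter> nbrs E v" using that by (auto simp: U_def uncovered_def)
    then have "\<exists>i. i < k \<and> q i \<in> nbrs E v" using q by (auto simp: bij_betw_def)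
    then show ?thesis using that(2) unfolding c_def by (simp add: someI_ex[of "\<lambda>i. i < k \<and> q i \<in> nbrs E v"])
  qed
  have "clique_coloring V E (k + (B + 1) * T) c"
  proof (rule clique_coloringI[OF V E common])
    show "c \<in> V \<rightarrow> {..<k + (B + 1) * T}"
    proof
      fix v assume v: "v \<in> V"
      show "c v \<in> {..<k + (B + 1) * T}"
      proof (cases "v \<in> Q \<union> U")
        case True
        have "blk v * T + cc (blk v) v < (B + 1) * T"
          using mult_le_mono1[OF blkB[OF True], of T] cs[OF True]
          by (simp only: add_mult_distrib mult_1)
        then show ?thesis using True by (simp only: c_def if_True lessThan_iff add_less_cancel_left)
      next
        case False
        then show ?thesis using cn[OF v False] by simp
      qed
    qed
    fix i
    show "(\<exists>q\<in>V. {v\<in>V. c v = i} \<subseteq> nbrs E q) \<or>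
      (\<forall>x\<in>V. \<forall>y\<in>V. \<forall>z\<in>V. {x, y} \<in> E \<and> {x, z} \<in> E \<and> {y, z} \<in> E \<longrightarrow> \<not> (c x = i \<and> c y = i \<and> c z = i))"
    proof (cases "i < k")
      case True
      have "{v\<in>V. c v = i} \<subseteq> nbrs E (q i)"
      proof safe
        fix v assume v: "v \<in> V" "i = c v"
        have "v \<notin> Q \<union> U" using True v by (auto simp: c_def)
        then have "q i \<in> nbrs E v" using cn[OF v(1)] v(2) by simp
        then show "v \<in> nbrs E (q (c v))" using sym_nbrs v(2) by metis
      qed
      moreover have "q i \<in> V" using True q Q(1) by (auto simp: bij_betw_def)
      ultimately show ?thesis by blast
    next
      case False
      define j where "j = (i - k) div T"
      have dec: "v \<in> S j \<and> j \<le> B \<and> cc j v = (i - k) mod T" if v: "v \<in> V" "c v = i" for v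
      proof -
        have vQ: "v \<in> Q \<union> U" using cn[OF v(1)] v(2) False by auto
        then have "i - k = blk v * T + cc (blk v) v" using v(2) by (auto simp: c_def)
        then have "j = blk v" "(i - k) mod T = cc (blk v) v"
          using cs[OF vQ] by (auto simp: j_def)
        then show ?thesis using vQ blkB[OF vQ] by (simp add: S_def)
      qed
      have "\<not> (c x = i \<and> c y = i \<and> c z = i)"
        if V3: "x \<in> V" "y \<in> V" "z \<in> V" and t: "{x, y} \<in> E \<and> {x, z} \<in> E \<and> {y, z} \<in> E" for x y z
      proof
        assume "c x = i \<and> c y = i \<and> c z = i"
        then have S: "x \<in> S j" "y \<in> S j" "z \<in> S j" and j: "j \<le> B" and eq: "cc j x = cc j y" "cc j x = cc j z"
          using dec[OF V3(1)] dec[OF V3(2)] dec[OF V3(3)] by auto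
        show False
          using cc[OF j, unfolded triangle_free_coloring_def, THEN conjunct2, rule_format, OF S t] eq by blast
      qed
      then show ?thesis by blast
    qed
  qed
  then show ?thesis by (rule clique_chromatic_number_le)
qed

lemma rprob_markov_card:
  assumes X: "finite X" and t: "0 < t"
  shows "rprob I p (\<lambda>E. t \<le> real (card {x\<in>X. P x E})) \<le> (\<Sum>x\<in>X. rprob I p (P x)) / t"
proof -
  let ?M = "measure_pmf (random_subset I p)"
  let ?f = "\<lambda>E. \<Sum>x\<in>X. indicat_real {E. P x E} E"
  have f: "real (card {x\<in>X. P x E}) = ?f E" for E
    using X by (simp add: indicator_def sum.If_cases Int_def)
  have int: "integrable ?M ?f"
    by (intro Bochner_Integration.integrable_sum measure_pmf.integrable_const_bound[where B = 1]) auto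
  have "rprob I p (\<lambda>E. t \<le> real (card {x\<in>X. P x E})) \<le> measure_pmf.expectation (random_subset I p) ?f / t"
    unfolding rprob_def f
    using integral_Markov_inequality_measure[OF int, of "{}" t] t by (simp add: sum_nonneg)
  also have "measure_pmf.expectation (random_subset I p) ?f = (\<Sum>x\<in>X. rprob I p (P x))"
    by (subst Bochner_Integration.integral_sum)
      (auto simp: rprob_def intro!: measure_pmf.integrable_const_bound[where B = 1])
  finally show ?thesis .
qed

text \<open>
  The \<open>n - 2\<close> candidates for a common neighbour are independent.
\<close>
lemma rprob_edge_without_common_nbr:
  fixes p :: real
  assumes V: "finite V" "card V = n" and p: "0 \<le> p" "p \<le> 1"
  shows "rprob (nsets V 2) p (\<lambda>E. \<exists>u v. {u, v} \<in> E \<and> nbrs E u \<inter> nbrs E v = {})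
    \<le> (real n)\<^sup>2 * exp (- p\<^sup>2 * (real n - 2))"
proof -
  have finE: "finite (nsets V 2)" using V(1) by (rule finite_imp_finite_nsets)
  let ?P = "rprob (nsets V 2) p"
  have "?P (\<lambda>E. \<exists>u v. {u, v} \<in> E \<and> nbrs E u \<inter> nbrs E v = {}) \<le>
      ?P (\<lambda>E. \<exists>uv\<in>V \<times> V. fst uv \<noteq> snd uv \<and> nbrs E (fst uv) \<inter> nbrs E (snd uv) = {})"
  proof (rule rprob_mono[OF finE])
    fix E assume E: "E \<subseteq> nsets V 2" and "\<exists>u v. {u, v} \<in> E \<and> nbrs E u \<inter> nbrs E v = {}"
    then obtain u v where uv: "{u, v} \<in> E" "nbrs E u \<inter> nbrs E v = {}" by blast
    have "u \<in> V \<and> v \<in> V \<and> u \<noteq> v" using subsetD[OF E uv(1)] by simp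
    then show "\<exists>uv\<in>V \<times> V. fst uv \<noteq> snd uv \<and> nbrs E (fst uv) \<inter> nbrs E (snd uv) = {}"
      using uv(2) by (intro bexI[of _ "(u, v)"]) auto
  qed
  also have "\<dots> \<le> (real n)\<^sup>2 * exp (- p\<^sup>2 * (real n - 2))"
  proof (rule rprob_bex_le)
    fix uv assume uv: "uv \<in> V \<times> V"
    obtain u v where [simp]: "uv = (u, v)" by (cases uv)
    show "?P (\<lambda>E. fst uv \<noteq> snd uv \<and> nbrs E (fst uv) \<inter> nbrs E (snd uv) = {}) \<le> exp (- p\<^sup>2 * (real n - 2))"
    proof (cases "u = v")
      case False
      let ?W = "V - {u, v}"
      have cW: "card ?W = n - 2" "2 \<le> n"
      proof -
        have sub: "{u, v} \<subseteq> V" using uv by simp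
        have "card {u, v} = 2" using False by simp
        then show "card ?W = n - 2" "2 \<le> n"
          using card_Diff_subset[OF _ sub] card_mono[OF V(1) sub] V(2) by auto
      qed
      have "?P (\<lambda>E. fst uv \<noteq> snd uv \<and> nbrs E (fst uv) \<inter> nbrs E (snd uv) = {}) \<le>
          ?P (\<lambda>E. \<forall>w\<in>?W. \<not> bip {u, v} {w} \<subseteq> E)"
      proof (rule rprob_mono[OF finE])
        fix E assume "fst uv \<noteq> snd uv \<and> nbrs E (fst uv) \<inter> nbrs E (snd uv) = {}"
        then show "\<forall>w\<in>?W. \<not> bip {u, v} {w} \<subseteq> E" by (auto simp: bip_def nbrs_def)
      qed
      also have "\<dots> \<le> (1 - p\<^sup>2) ^ card ?W"
      proof (rule rprob_indep_le[OF finE, where J = "\<lambda>w. bip {u, v} {w}"])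
        show "finite ?W" using V(1) by simp
        show "disjoint_family_on (\<lambda>w. bip {u, v} {w}) ?W"
          by (auto simp: disjoint_family_on_def bip_def doubleton_eq_iff)
        show "(\<not> bip {u, v} {w} \<subseteq> E) = (\<not> bip {u, v} {w} \<subseteq> E \<inter> bip {u, v} {w})" for w E by auto
        fix w assume w: "w \<in> ?W"
        show J: "bip {u, v} {w} \<subseteq> nsets V 2" using w uv by (intro bip_subset_nsets) auto
        have "card (bip {u, v} {w}) = 2" using w False by (subst card_bip) auto
        then show "?P (\<lambda>E. \<not> bip {u, v} {w} \<subseteq> E) \<le> 1 - p\<^sup>2"
          using rprob_subset[OF finE J p] by (simp add: rprob_not)
      qed (use p in \<open>auto simp: power_le_one\<close>)
      also have "\<dots> \<le> exp (- p\<^sup>2) ^ card ?W"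
        using exp_ge_add_one_self[of "- p\<^sup>2"] p by (intro power_mono) (auto simp: power_le_one)
      also have "\<dots> = exp (- p\<^sup>2 * (real n - 2))"
        using cW by (simp add: of_nat_diff mult_ac flip: exp_of_nat_mult)
      finally show ?thesis .
    qed (simp add: rprob_def)
  qed (use V in \<open>auto simp: power2_eq_square card_cartesian_product\<close>)
  finally show ?thesis .
qed

lemma exists_block_map:
  assumes "finite U" "card U \<le> B * s"
  shows "\<exists>g. g \<in> U \<rightarrow> {..<B} \<and> (\<forall>j. card {u\<in>U. g u = j} \<le> s)"
proof (cases "s = 0")
  case True
  then have "U = {}" using assms by simp
  then show ?thesis by simp
next
  case False
  obtain h where h: "bij_betw h U {..<card U}"
    using ex_bij_betw_finite_nat[OF assms(1)] by (auto simp: atLeast0LessThan)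
  have inj: "inj_on h U" using h by (rule bij_betw_imp_inj_on)
  have lt: "h u < B * s" if "u \<in> U" for u
    using bij_betwE[OF h] that assms(2) by fastforce
  have "card {u\<in>U. h u div s = j} \<le> s" for j
  proof -
    have "h ` {u\<in>U. h u div s = j} \<subseteq> {j * s..<j * s + s}"
    proof safe
      fix u assume "u \<in> U" "j = h u div s"
      then show "h u \<in> {h u div s * s..<h u div s * s + s}"
        using False div_mult_mod_eq[of "h u" s] mod_less_divisor[of s "h u"]
        by (simp only: atLeastLessThan_iff) linarith
    qed
    then have "card (h ` {u\<in>U. h u div s = j}) \<le> card {j * s..<j * s + s}"
      by (rule card_mono[rotated]) simp
    moreover have "card (h ` {u\<in>U. h u div s = j}) = card {u\<in>U. h u div s = j}"
      by (rule card_image, rule inj_on_subset[OF inj]) auto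
    ultimately show ?thesis by simp
  qed
  moreover have "(\<lambda>u. h u div s) \<in> U \<rightarrow> {..<B}"
    using lt by (auto simp: less_mult_imp_div_less)
  ultimately show ?thesis by blast
qed

lemma book_mono:
  assumes E: "E \<subseteq> nsets V 2" and b: "book E S T" and sub: "E \<inter> nsets S 2 \<subseteq> F"
  shows "book F S T"
proof -
  obtain v M where v: "v \<in> S" and M: "M \<subseteq> E \<inter> nsets (S \<inter> nbrs E v) 2" "disjoint M" "card M = T"
    using b unfolding book_def by blast
  have "S \<inter> nbrs E v \<subseteq> nbrs F v"
  proof
    fix u assume u: "u \<in> S \<inter> nbrs E v"
    then have "u \<noteq> v" using nbrs_irrefl[OF E] by blast
    then show "u \<in> nbrs F v" using subsetD[OF sub, of "{v, u}"] u v by (simp add: nbrs_def)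
  qed
  then have "nsets (S \<inter> nbrs E v) 2 \<subseteq> nsets (S \<inter> nbrs F v) 2" by (intro nsets_mono) blast
  moreover have "nsets (S \<inter> nbrs E v) 2 \<subseteq> nsets S 2" by (rule nsets_mono) blast
  ultimately have "M \<subseteq> F \<inter> nsets (S \<inter> nbrs F v) 2" using M(1) sub by blast
  then show ?thesis unfolding book_def using v M(2,3) by blast
qed

text \<open>
  The first \<open>k\<close> classes are determined by the pairs that meet a fixed set \<open>Q\<close>.  Given these, the blocks are fixed
  subsets of the complement of \<open>Q\<close>, where the graph is still completely random.
\<close>
lemma rprob_many_colors:
  fixes V :: "'a set" and p :: real
  assumes V: "finite V" "card V = n" and p: "0 \<le> p" "p \<le> 1"
    and k: "k \<le> s" "k \<le> n" and s: "1 \<le> s" "1 \<le> B" and T: "9 * (real s)\<^sup>2 * p ^ 3 \<le> 2 * real T"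
  shows "rprob (nsets V 2) p (\<lambda>E. k + (B + 1) * T < clique_chromatic_number V E)
    \<le> (real n)\<^sup>2 * exp (- p\<^sup>2 * (real n - 2)) + real s * exp (- real T)
      + real n * exp (- p * k) / (real B * real s) + real B * (real s * exp (- real T))"
proof -
  have finE: "finite (nsets V 2)" using V(1) by (rule finite_imp_finite_nsets)
  let ?P = "rprob (nsets V 2) p"
  obtain Q where Q: "Q \<subseteq> V" "card Q = k"
    using obtain_subset_with_card_n[of k V] k(2) V(2) by metis
  have finQ: "finite Q" using Q(1) V(1) by (rule finite_subset)
  \<comment> \<open>A fixed way to cut \<open>U\<close> into blocks, so that the blocks depend on the graph only through \<open>U\<close>.\<close>
  define g where "g = (\<lambda>U :: 'a set. SOME g. g \<in> U \<rightarrow> {..<B} \<and> (\<forall>j. card {u\<in>U. g u = j} \<le> s))"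
  let ?U = "\<lambda>E. uncovered V E Q"
  have finU: "finite (?U E)" for E using V(1) by (simp add: uncovered_def)
  have g: "g (?U E) \<in> ?U E \<rightarrow> {..<B} \<and> (\<forall>j. card {u\<in>?U E. g (?U E) u = j} \<le> s)"
    if "card (?U E) \<le> B * s" for E
    unfolding g_def by (rule someI_ex[OF exists_block_map[OF finU that]])
  let ?c1 = "\<lambda>E. \<exists>u v. {u, v} \<in> E \<and> nbrs E u \<inter> nbrs E v = {}"
  let ?c2 = "\<lambda>E. book E Q T"
  let ?c3 = "\<lambda>E. real B * real s \<le> real (card {u\<in>V - Q. Q \<inter> nbrs E u = {}})"
  let ?c4 = "\<lambda>E. card (?U E) \<le> B * s \<and> (\<exists>j\<in>{..<B}. book E {u\<in>?U E. g (?U E) u = j} T)"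
  have "?P (\<lambda>E. k + (B + 1) * T < clique_chromatic_number V E) \<le> ?P (\<lambda>E. (?c1 E \<or> ?c2 E) \<or> (?c3 E \<or> ?c4 E))"
  proof (rule rprob_mono[OF finE], rule ccontr)
    fix E assume E: "E \<subseteq> nsets V 2" and chi: "k + (B + 1) * T < clique_chromatic_number V E"
      and nc: "\<not> ((?c1 E \<or> ?c2 E) \<or> (?c3 E \<or> ?c4 E))"
    note nc' = nc[unfolded de_Morgan_disj]
    note n1 = nc'[THEN conjunct1, THEN conjunct1] and n2 = nc'[THEN conjunct1, THEN conjunct2]
      and n3 = nc'[THEN conjunct2, THEN conjunct1] and n4 = nc'[THEN conjunct2, THEN conjunct2]
    have cU: "card (?U E) \<le> B * s"
      using n3 unfolding uncovered_def by (simp flip: of_nat_mult)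
    have "clique_chromatic_number V E \<le> k + (B + 1) * T"
    proof (rule clique_chromatic_number_le_if_blocks[OF V(1) E _ Q _ _ n2])
      show "nbrs E u \<inter> nbrs E v \<noteq> {}" if "{u, v} \<in> E" for u v
        using n1 that by blast
      show "g (?U E) \<in> ?U E \<rightarrow> {..<B}" using g[OF cU] by (rule conjunct1)
      show "\<not> book E {u\<in>?U E. g (?U E) u = j} T" if "j < B" for j
      proof
        assume "book E {u\<in>?U E. g (?U E) u = j} T"
        then have "\<exists>j\<in>{..<B}. book E {u\<in>?U E. g (?U E) u = j} T"
          using that by (intro bexI) simp_all
        with cU have "?c4 E" by (rule conjI)
        with n4 show False by (rule notE)
      qed
    qed
    then show False using chi by simp
  qed
  also have "\<dots> \<le> (?P ?c1 + ?P ?c2) + (?P ?c3 + ?P ?c4)"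
    by (intro order.trans[OF rprob_disj] add_mono order.refl)
  also have "?P ?c1 \<le> (real n)\<^sup>2 * exp (- p\<^sup>2 * (real n - 2))"
    by (rule rprob_edge_without_common_nbr[OF V p])
  also have "?P ?c2 \<le> real s * exp (- real T)"
    by (rule rprob_book[OF finE nsets_mono[OF Q(1)] subset_refl finQ _ p T]) (use Q(2) k(1) in simp)
  also have "?P ?c3 \<le> real n * exp (- p * k) / (real B * real s)"
  proof -
    have "?P ?c3 \<le> (\<Sum>u\<in>V - Q. ?P (\<lambda>E. Q \<inter> nbrs E u = {})) / (real B * real s)"
      by (rule rprob_markov_card) (use V(1) s in auto)
    also have "\<dots> \<le> (real n * exp (- p * k)) / (real B * real s)"
    proof (rule divide_right_mono)
      have "?P (\<lambda>E. Q \<inter> nbrs E u = {}) \<le> exp (- p * k)" if u: "u \<in> V - Q" for u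
      proof -
        have "star u Q \<subseteq> nsets V 2" using u Q(1) by (auto simp: star_def)
        then have "?P (\<lambda>E. Q \<inter> nbrs E u = {}) = (1 - p) ^ k"
          using rprob_star_avoid[OF finE _ p] Q(2) by simp
        also have "\<dots> \<le> exp (- p) ^ k"
          using exp_ge_add_one_self[of "- p"] p by (intro power_mono) auto
        finally show ?thesis by (simp add: mult_ac flip: exp_of_nat_mult)
      qed
      then have "(\<Sum>u\<in>V - Q. ?P (\<lambda>E. Q \<inter> nbrs E u = {})) \<le> (\<Sum>u\<in>V - Q. exp (- p * k))"
        by (rule sum_mono)
      also have "\<dots> \<le> real n * exp (- p * k)"
        using card_mono[OF V(1), of "V - Q"] V(2) by (simp add: mult_right_mono)
      finally show "(\<Sum>u\<in>V - Q. ?P (\<lambda>E. Q \<inter> nbrs E u = {})) \<le> real n * exp (- p * k)" .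
    qed simp
    finally show ?thesis .
  qed
  also have "?P ?c4 \<le> real B * (real s * exp (- real T))"
  proof (rule rprob_cond[OF finE])
    let ?J = "nsets (V - Q) 2"
    show J: "?J \<subseteq> nsets V 2" by (rule nsets_mono) auto
    have finJ: "finite ?J" using J finE by (rule finite_subset)
    show "0 \<le> real B * (real s * exp (- real T))" by simp
    fix E assume E: "E \<subseteq> nsets V 2 - ?J"
    let ?S = "\<lambda>j. {u\<in>?U E. g (?U E) u = j}"
    have U: "?U (E \<union> F) = ?U E" if F: "F \<subseteq> ?J" for F
    proof -
      have "q \<notin> nbrs F u" if "q \<in> Q" for q u
        using subsetD[OF F, of "{u, q}"] that by (auto simp: nbrs_def)
      then have "Q \<inter> nbrs F u = {}" for u by blast
      then show ?thesis unfolding uncovered_def nbrs_Un by (simp add: Int_Un_distrib)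
    qed
    show "rprob ?J p (\<lambda>F. ?c4 (E \<union> F)) \<le> real B * (real s * exp (- real T))"
    proof (cases "card (?U E) \<le> B * s")
      case True
      have "rprob ?J p (\<lambda>F. ?c4 (E \<union> F)) \<le> rprob ?J p (\<lambda>F. \<exists>j\<in>{..<B}. book F (?S j) T)"
      proof (rule rprob_mono[OF finJ])
        fix F assume F: "F \<subseteq> ?J" and c4: "?c4 (E \<union> F)"
        obtain j where j: "j \<in> {..<B}" "book (E \<union> F) (?S j) T"
          using c4[unfolded U[OF F], THEN conjunct2] by (rule bexE)
        have "?S j \<subseteq> V - Q" by (auto simp: uncovered_def)
        then have SJ: "nsets (?S j) 2 \<subseteq> ?J" by (rule nsets_mono)
        have "book F (?S j) T"
        proof (rule book_mono[OF _ j(2)])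
          show "E \<union> F \<subseteq> nsets V 2" using E F J by blast
          show "(E \<union> F) \<inter> nsets (?S j) 2 \<subseteq> F"
          proof
            fix e assume e: "e \<in> (E \<union> F) \<inter> nsets (?S j) 2"
            have "e \<in> ?J" using SJ e[THEN IntD2] by (rule subsetD)
            then have "e \<notin> E" using E by blast
            then show "e \<in> F" using e by simp
          qed
        qed
        with j(1) show "\<exists>j\<in>{..<B}. book F (?S j) T" by (rule rev_bexI)
      qed
      also have "\<dots> \<le> real B * (real s * exp (- real T))"
      proof (rule rprob_bex_le)
        fix j
        have SV: "?S j \<subseteq> V - Q" by (auto simp: uncovered_def)
        have "card (?S j) \<le> s" by (rule g[OF True, THEN conjunct2, rule_format])
        moreover have "finite (?S j)" using finU[of E] by simp
        ultimately show "rprob ?J p (\<lambda>F. book F (?S j) T) \<le> real s * exp (- real T)"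
          by (intro rprob_book[OF finJ nsets_mono[OF SV] subset_refl _ _ p T])
      qed auto
      finally show ?thesis .
    next
      case False
      have "rprob ?J p (\<lambda>F. ?c4 (E \<union> F)) \<le> rprob ?J p (\<lambda>F. False)"
      proof (rule rprob_mono[OF finJ])
        fix F assume F: "F \<subseteq> ?J" and c4: "?c4 (E \<union> F)"
        show False using c4[THEN conjunct1] False unfolding U[OF F] by (rule notE[rotated])
      qed
      also have "\<dots> = 0" by (simp add: rprob_def)
      finally show ?thesis by (rule order_trans) simp
    qed
  qed
  finally show ?thesis by simp
qed

section \<open>Asymptotics\<close>

text \<open>
  With \<open>r = p^(-1/2)\<close> and \<open>y = (n^(2/5) p)^(5/2)\<close> all quantities become monomials: \<open>p = r^(-2)\<close>,
  \<open>n = r^5 y\<close>, \<open>n p^2 = r y\<close> and \<open>n p^3 = y / r\<close>.  Here \<open>L\<close> is \<open>ln n\<close>.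
\<close>
locale scaling =
  fixes n :: nat and p r y L :: real
  assumes lam: "10 ^ 7 \<le> L" "exp L = real n"
    and r: "L ^ 20 \<le> r" "p = 1 / r\<^sup>2"
    and y: "L ^ 7 \<le> y" "4096000 * y \<le> r" "real n = r ^ 5 * y"
begin

lemma lam_pos: "0 < L" "1 \<le> L"
  using lam(1) by auto

lemma lam_big: "10000000 \<le> L"
  using lam(1) by simp

lemma lam_step: "10 ^ 7 * L ^ j \<le> L ^ Suc j"
  using lam(1) lam_pos by (simp add: mult_right_mono)

lemma lam_mono: "i \<le> j \<Longrightarrow> L ^ i \<le> L ^ j"
  using lam_pos by (intro power_increasing) auto

lemma r_ge: "j \<le> 20 \<Longrightarrow> L ^ j \<le> r"
  using lam_mono[of j 20] r(1) by linarith

lemma r_pos: "0 < r" "1 \<le> r"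
  using r_ge[of 0] by auto

lemma p_bounds: "0 < p" "p \<le> 1"
  using r_pos by (auto simp: r(2))

lemma regime_if_between:
  assumes a: "r ^ 3 * L\<^sup>2 \<le> real a" "real a \<le> 2 * r ^ 3 * L ^ 4"
  shows "regime n p L (nat \<lceil>576 * L ^ 8\<rceil>) (nat \<lceil>103 * L\<rceil>) a"
proof -
  define m where "m = nat \<lceil>576 * L ^ 8\<rceil>"
  define c where "c = nat \<lceil>103 * L\<rceil>"
  have m: "576 * L ^ 8 \<le> m" "real m \<le> 577 * L ^ 8"
  proof -
    have "1 \<le> L ^ 8" using lam_pos by simp
    then show "576 * L ^ 8 \<le> m" "real m \<le> 577 * L ^ 8"
      unfolding m_def by linarith+
  qed
  have c: "103 * L \<le> c" "real c \<le> 104 * L"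
    unfolding c_def using lam_pos by linarith+
  have pa: "r * L\<^sup>2 \<le> p * a" "p * a \<le> 2 * r * L ^ 4"
  proof -
    have "r * L\<^sup>2 = p * (r ^ 3 * L\<^sup>2)" "2 * r * L ^ 4 = p * (2 * r ^ 3 * L ^ 4)"
      using r_pos by (simp_all add: r(2) power2_eq_square power3_eq_cube)
    then show "r * L\<^sup>2 \<le> p * a" "p * a \<le> 2 * r * L ^ 4"
      using a p_bounds by (simp_all only: mult_left_mono less_imp_le)
  qed
  have nn: "0 \<le> r * L\<^sup>2" using r_pos by simp
  have paq: "L ^ 4 \<le> (p * a)\<^sup>2 * p" "(p * a)\<^sup>2 * p \<le> 4 * L ^ 8"
  proof -
    have e: "L ^ 4 = (r * L\<^sup>2)\<^sup>2 * p" "4 * L ^ 8 = (2 * r * L ^ 4)\<^sup>2 * p"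
      using r_pos by (simp_all add: r(2) power_mult_distrib flip: power_mult)
    show "L ^ 4 \<le> (p * a)\<^sup>2 * p" unfolding e(1)
      using pa nn p_bounds by (intro mult_right_mono power_mono) auto
    show "(p * a)\<^sup>2 * p \<le> 4 * L ^ 8" unfolding e(2)
      using pa nn p_bounds by (intro mult_right_mono power_mono) auto
  qed
  have l10: "L ^ 10 \<le> p * a"
  proof -
    have "L ^ 10 \<le> r * 1" using r_ge[of 10] by simp
    also have "\<dots> \<le> r * L\<^sup>2" using lam_pos r_pos by (intro mult_left_mono) auto
    finally show ?thesis using pa by linarith
  qed
  have steps: "10 ^ 7 * L ^ 1 \<le> L ^ 2" "10 ^ 7 * L ^ 2 \<le> L ^ 3" "10 ^ 7 * L ^ 9 \<le> L ^ 10" "10 ^ 7 * L ^ 3 \<le> L ^ 4"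
    using lam_step[of 1] lam_step[of 2] lam_step[of 9] lam_step[of 3] by (simp_all add: eval_nat_numeral)
  have "2 * L \<le> 8 * p * real n"
  proof -
    have "p * real n = r ^ 3 * y" using r_pos by (simp add: r(2) y(3) power2_eq_square power3_eq_cube eval_nat_numeral)
    moreover have "L * 1 \<le> r ^ 3 * y"
      using r_pos r_ge[of 1] lam_mono[of 0 7] y(1) power_increasing[of 1 3 r] by (intro mult_mono) auto
    ultimately show ?thesis using lam_pos by linarith
  qed
  moreover have "4096000 * real n * p ^ 3 \<le> 1"
  proof -
    have "4096000 * real n * p ^ 3 = 4096000 * y / r"
      using r_pos by (simp add: r(2) y(3) power_divide eval_nat_numeral)
    then show ?thesis using y(2) r_pos by simp
  qed
  moreover have "103 * L \<le> m"
  proof -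
    have "L ^ 1 \<le> L ^ 8" by (rule lam_mono) simp
    then show ?thesis using m lam_pos by simp
  qed
  moreover have "a \<le> n"
  proof -
    have "2 * r ^ 3 * L ^ 4 \<le> 2 * r ^ 3 * r" using r_ge[of 4] r_pos by (intro mult_left_mono) auto
    also have "\<dots> = r ^ 4 * 2" by (simp add: eval_nat_numeral)
    also have "\<dots> \<le> r ^ 5 * y"
      using r_pos lam(1) lam_mono[of 1 7] y(1) by (intro mult_mono power_increasing) auto
    finally have "real a \<le> real n" using a(2) y(3) by linarith
    then show ?thesis by simp
  qed
  moreover have "144 * (p * a)\<^sup>2 * p \<le> m" using paq(2) m(1) by simp
  moreover have "100 * c * L \<le> (p * a)\<^sup>2 * p"
  proof -
    have "100 * c * L \<le> 100 * (104 * L) * L" using c lam_pos by (intro mult_right_mono) auto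
    also have "\<dots> = 10400 * L\<^sup>2" by (simp add: power2_eq_square)
    also have "\<dots> \<le> L ^ 4" using steps lam_pos by simp
    finally show ?thesis using paq by linarith
  qed
  moreover have "6000 * (real c)\<^sup>2 \<le> p * a"
  proof -
    have "(real c)\<^sup>2 \<le> (104 * L)\<^sup>2" using c by (intro power_mono) auto
    then have "6000 * (real c)\<^sup>2 \<le> 64896000 * L\<^sup>2" by (simp add: power_mult_distrib)
    also have "\<dots> \<le> 10 ^ 7 * (10 ^ 7 * L\<^sup>2)" by simp
    also have "\<dots> \<le> 10 ^ 7 * L ^ 3" using steps by simp
    also have "\<dots> \<le> L ^ 4" using steps by simp
    also have "\<dots> \<le> L ^ 10" by (rule lam_mono) simp
    finally show ?thesis using l10 by linarith
  qed
  moreover have "40 * real m * (1 + real c) \<le> p * a"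
  proof -
    have "40 * real m * (1 + real c) \<le> 40 * (577 * L ^ 8) * (105 * L)"
      using m c lam_pos by (intro mult_mono) auto
    also have "\<dots> = 2423400 * L ^ 9" by (simp add: eval_nat_numeral)
    also have "\<dots> \<le> 10 ^ 7 * L ^ 9" using lam_pos by simp
    finally show ?thesis using steps l10 by linarith
  qed
  moreover have "64 * p\<^sup>2 * a \<le> 1"
  proof -
    have "64 * p\<^sup>2 * a = 64 * p * (p * a)" by (simp add: power2_eq_square)
    also have "\<dots> \<le> 64 * p * (2 * r * L ^ 4)" using pa p_bounds by (intro mult_left_mono) auto
    also have "\<dots> = 128 * L ^ 4 / r" using r_pos by (simp add: r(2) power2_eq_square)
    also have "128 * L ^ 4 \<le> L ^ 5" using lam_step[of 4] zero_le_power[of L 4] lam_pos by (simp add: eval_nat_numeral)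
    also have "\<dots> \<le> r" by (rule r_ge) simp
    finally show ?thesis using r_pos by (simp add: divide_right_mono)
  qed
  ultimately show ?thesis
    using p_bounds c lam unfolding regime_def m_def[symmetric] c_def[symmetric] by simp
qed

text \<open>
  From \<open>ln (1 - p) \<ge> - p - 2 p\<^sup>2\<close>, where \<open>2 p\<^sup>2 k \<le> 1\<close>; moreover \<open>exp 1 \<le> 3\<close>.
\<close>
lemma power_one_minus_ge:
  assumes "p * real k \<le> \<kappa>" "\<kappa> \<le> 3 * L"
  shows "exp (- \<kappa>) / 3 \<le> (1 - p) ^ k"
proof -
  have p: "p * (6 * L) \<le> 1"
  proof -
    have "6 * L \<le> L\<^sup>2" using lam by (simp add: power2_eq_square)
    also have "\<dots> \<le> r" by (rule r_ge) simp
    also have "\<dots> \<le> r\<^sup>2" using r_pos by (simp add: power2_eq_square)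
    finally show ?thesis using r_pos by (simp add: r(2))
  qed
  have "p * 2 \<le> p * (6 * L)" using lam p_bounds by (intro mult_left_mono) auto
  then have p2: "p \<le> 1/2" using p by linarith
  have "- \<kappa> - 1 \<le> real k * (- p - 2 * p\<^sup>2)"
  proof -
    have "2 * p * (p * real k) \<le> 2 * p * (3 * L)" using assms p_bounds by (intro mult_left_mono) auto
    then show ?thesis using p assms(1) by (simp add: algebra_simps power2_eq_square)
  qed
  also have "\<dots> \<le> real k * ln (1 - p)"
    using ln_one_minus_pos_lower_bound[of p] p2 p_bounds by (intro mult_left_mono) auto
  finally have "exp (- \<kappa> - 1) \<le> exp (real k * ln (1 - p))" by simp
  also have "\<dots> = (1 - p) ^ k" using p2 by (simp add: exp_of_nat_mult)
  finally have "exp (- \<kappa>) / exp 1 \<le> (1 - p) ^ k" by (simp add: exp_diff)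
  moreover have "exp (- \<kappa>) / 3 \<le> exp (- \<kappa>) / exp 1"
    by (intro divide_left_mono exp_le) auto
  ultimately show ?thesis by linarith
qed

text \<open>
  Instance \<open>a1 = r^3 L^2\<close>, \<open>a2 = r^3 L^4\<close> of the lower bound.  The assumption on \<open>\<kappa>\<close> says that \<open>k\<close>
  neighbourhoods miss at least \<open>r^5 L^7\<close> vertices up to a constant, whereas \<open>k * s\<close> is only of order \<open>r^5 L^5\<close>.
\<close>
lemma rprob_chromatic_le:
  assumes k: "p * real k \<le> \<kappa>" "\<kappa> \<le> 3 * L" and \<kappa>: "L ^ 7 \<le> exp (- \<kappa>) * y"
  shows "rprob (nsets {1..n} 2) p (\<lambda>E. clique_chromatic_number {1..n} E \<le> k) \<le> 14 * exp (- L)"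
proof -
  define m where "m = nat \<lceil>576 * L ^ 8\<rceil>"
  define c where "c = nat \<lceil>103 * L\<rceil>"
  define a1 where "a1 = nat \<lceil>r ^ 3 * L\<^sup>2\<rceil>"
  define a2 where "a2 = nat \<lceil>r ^ 3 * L ^ 4\<rceil>"
  define t where "t = nat \<lceil>9 * (r * y) + 3 * L\<rceil>"
  have ge1: "1 \<le> r ^ 3 * L\<^sup>2" "1 \<le> r ^ 3 * L ^ 4"
    using mult_mono[of 1 "r ^ 3" 1 "L\<^sup>2"] mult_mono[of 1 "r ^ 3" 1 "L ^ 4"] r_pos lam_pos by auto
  have a1: "r ^ 3 * L\<^sup>2 \<le> a1" "a1 \<le> 2 * r ^ 3 * L\<^sup>2"
    using ge1 unfolding a1_def by linarith+
  have a2: "r ^ 3 * L ^ 4 \<le> a2" "a2 \<le> 2 * r ^ 3 * L ^ 4"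
    using ge1 unfolding a2_def by linarith+
  have r3: "r ^ 3 * L\<^sup>2 \<le> r ^ 3 * L ^ 4" using r_pos lam_mono[of 2 4] by (intro mult_left_mono) auto
  have reg1: "regime n p L m c a1" and reg2: "regime n p L m c a2"
    unfolding m_def c_def by (rule regime_if_between; use a1 a2 r3 in linarith)+
  have y1: "1 \<le> y" using y(1) lam_mono[of 0 7] by simp
  have ry: "0 \<le> r * y" using r_pos y1 by simp
  have t: "9 * (r * y) + 3 * L \<le> t" "t \<le> 9 * (r * y) + 3 * L + 1"
    using ry lam_pos unfolding t_def by linarith+
  have np2: "real n * p\<^sup>2 = r * y"
    using r_pos by (simp add: r(2) y(3) power_divide eval_nat_numeral)
  have t1: "9 * real n * p\<^sup>2 \<le> t" "3 * L \<le> t" using t ry np2 lam_pos by (auto simp: mult.assoc)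
  have t3: "12000 * real t * L \<le> a1"
  proof -
    have "r * y \<le> r * r" using y y1 r_pos by (intro mult_left_mono) auto
    moreover have "L \<le> r" using r_ge[of 1] by simp
    moreover have "1 * r \<le> r * r" using r_pos by (intro mult_right_mono) auto
    ultimately have "t \<le> 13 * (r * r)" using t(2) r_pos lam_pos by linarith
    then have "12000 * real t * L \<le> 12000 * (13 * (r * r)) * L"
      using lam_pos by (intro mult_right_mono mult_left_mono) auto
    also have "\<dots> = (r * r * L) * 156000" by simp
    also have "\<dots> \<le> (r * r * L) * (r * L)"
    proof (rule mult_left_mono)
      have "1 * L \<le> r * L" using r_pos lam_pos by (intro mult_right_mono) auto
      then show "156000 \<le> r * L" using lam_big by linarith
    qed (use r_pos lam_pos in simp)
    also have "\<dots> = r ^ 3 * L\<^sup>2" by (simp add: power2_eq_square power3_eq_cube)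
    finally show ?thesis using a1 by linarith
  qed
  have aa: "24000 * real a1 * L \<le> a2"
  proof -
    have "24000 * real a1 * L \<le> 24000 * (2 * r ^ 3 * L\<^sup>2) * L"
      using a1 lam_pos by (intro mult_right_mono mult_left_mono) auto
    also have "\<dots> = r ^ 3 * (48000 * L ^ 3)" by (simp add: eval_nat_numeral)
    also have "\<dots> \<le> r ^ 3 * L ^ 4"
      using lam_step[of 3] zero_le_power[of L 3] lam_pos r_pos by (intro mult_left_mono) (auto simp: eval_nat_numeral)
    finally show ?thesis using a2 by linarith
  qed
  have kr: "real k \<le> 3 * L * r\<^sup>2"
  proof -
    have "p * real k \<le> 3 * L" using k by linarith
    then show ?thesis using r_pos by (simp add: r(2) field_simps)
  qed
  have "6 * real a2 + 1 \<le> 13 * (r ^ 3 * L ^ 4)" using a2(2) ge1(2) by simp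
  then have "real k * (6 * real a2 + 1) \<le> (3 * L * r\<^sup>2) * (13 * (r ^ 3 * L ^ 4))"
    using kr by (intro mult_mono) auto
  also have "\<dots> = r ^ 5 * (39 * L ^ 5)" by (simp add: eval_nat_numeral)
  finally have ks: "real k + real (k * (6 * a2)) \<le> r ^ 5 * (39 * L ^ 5)" by (simp add: algebra_simps)
  have st: "10 ^ 7 * L ^ 5 \<le> L ^ 6" "10 ^ 7 * L ^ 6 \<le> L ^ 7" "L ^ 5 \<ge> 1" "L ^ 6 \<ge> 1"
    using lam_step[of 5] lam_step[of 6] lam_mono[of 0 5] lam_mono[of 0 6] by simp_all
  have half: "real k + real (k * (6 * a2)) \<le> real n / 2"
  proof -
    have "r ^ 5 * (39 * L ^ 5) \<le> r ^ 5 * (y / 2)"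
      using st y(1) r_pos by (intro mult_left_mono) auto
    then show ?thesis using ks y(3) by simp
  qed
  have kn: "k + k * (6 * a2) \<le> n"
  proof -
    have "real (k + k * (6 * a2)) \<le> real n" using half by simp
    then show ?thesis by (simp only: of_nat_le_iff)
  qed
  have n0: "{1..n} \<noteq> {}"
  proof -
    have "0 < real n" using r_pos y1 by (simp add: y(3))
    then show ?thesis by simp
  qed
  have "rprob (nsets {1..n} 2) p (\<lambda>E. clique_chromatic_number {1..n} E \<le> k) \<le> 13 * exp (- L) +
      exp ((real k + real (k * (6 * a2))) * L - (1 - p) ^ k * (real n - real k - real (k * (6 * a2))))"
    by (rule rprob_few_colors[OF _ _ n0 reg1 reg2 t1 t3 aa order_refl kn]) auto
  also have "(real k + real (k * (6 * a2))) * L - (1 - p) ^ k * (real n - real k - real (k * (6 * a2))) \<le> - L"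
  proof -
    have "(real k + real (k * (6 * a2))) * L \<le> r ^ 5 * (39 * L ^ 5) * L"
      using ks lam_pos by (intro mult_right_mono) auto
    moreover have "(exp (- \<kappa>) / 3) * (real n / 2) \<le> (1 - p) ^ k * (real n - real k - real (k * (6 * a2)))"
      using half power_one_minus_ge[OF k] p_bounds by (intro mult_mono) auto
    moreover have "r ^ 5 * (L ^ 7 / 6) \<le> (exp (- \<kappa>) / 3) * (real n / 2)"
    proof -
      have "r ^ 5 * L ^ 7 \<le> r ^ 5 * (exp (- \<kappa>) * y)" using \<kappa> r_pos by (intro mult_left_mono) auto
      then show ?thesis by (simp add: y(3) mult_ac)
    qed
    moreover have "L \<le> r ^ 5 * (L ^ 7 / 6 - 39 * L ^ 6)"
    proof -
      have "L ^ 1 \<le> L ^ 6" by (rule lam_mono) simp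
      then have "1 * L \<le> r ^ 5 * (L ^ 7 / 6 - 39 * L ^ 6)"
        using st r_pos lam_pos by (intro mult_mono) (auto simp: one_le_power)
      then show ?thesis by simp
    qed
    moreover have "r ^ 5 * (39 * L ^ 5) * L = r ^ 5 * (39 * L ^ 6)" by (simp add: eval_nat_numeral)
    ultimately show ?thesis by (simp add: right_diff_distrib)
  qed
  finally show ?thesis by simp
qed

text \<open>
  Instance \<open>s = r^3\<close>, \<open>T = 3 L\<close> of the upper bound.  By assumption at most \<open>r^5 / L^3\<close> vertices remain
  on average, hence \<open>B\<close> is of order \<open>r^2 / L^2\<close> and \<open>B T\<close> is below \<open>r^2 = 1 / p\<close>.
\<close>
lemma rprob_chromatic_gt:
  assumes k: "real k \<le> 4 * L * r\<^sup>2" and y_exp: "exp (- p * k) * y * L ^ 3 \<le> 1"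
  shows "rprob (nsets {1..n} 2) p (\<lambda>E. real k + r\<^sup>2 < clique_chromatic_number {1..n} E) \<le> 1 / L + 6 * exp (- L)"
proof -
  define T where "T = nat \<lceil>3 * L\<rceil>"
  define s where "s = nat \<lfloor>r ^ 3\<rfloor>"
  define q where "q = real n * exp (- p * k)"
  define B where "B = nat \<lceil>q * L / s\<rceil> + 1"
  have T: "3 * L \<le> T" "T \<le> 4 * L" using lam_pos unfolding T_def by linarith+
  have r3: "1 \<le> r ^ 3" using r_pos by simp
  have "1 \<le> \<lfloor>r ^ 3\<rfloor>" using r3 by (simp add: le_floor_iff)
  then have s_real: "real s = of_int \<lfloor>r ^ 3\<rfloor>" "1 \<le> s" unfolding s_def by linarith+
  then have s: "r ^ 3 / 2 \<le> s" "s \<le> r ^ 3" "1 \<le> s" by linarith+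
  have q: "0 \<le> q" "q * L ^ 3 \<le> r ^ 5"
  proof -
    show "0 \<le> q" by (simp add: q_def)
    have "q * L ^ 3 = r ^ 5 * (exp (- p * k) * y * L ^ 3)" by (simp add: q_def y(3))
    also have "\<dots> \<le> r ^ 5 * 1" using y_exp r_pos by (intro mult_left_mono) auto
    finally show "q * L ^ 3 \<le> r ^ 5" by simp
  qed
  have qs: "q * L / s \<le> 2 * r\<^sup>2 / L\<^sup>2"
  proof -
    have "q * L / s \<le> q * L / (r ^ 3 / 2)"
      using s q lam_pos r_pos by (intro divide_left_mono mult_nonneg_nonneg mult_pos_pos) auto
    also have "\<dots> = (q * L ^ 3) * (2 / (r ^ 3 * L\<^sup>2))"
      using r_pos lam_pos by (simp add: field_simps eval_nat_numeral)
    also have "\<dots> \<le> r ^ 5 * (2 / (r ^ 3 * L\<^sup>2))" using q r_pos by (intro mult_right_mono) auto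
    also have "\<dots> = 2 * r\<^sup>2 / L\<^sup>2" using r_pos by (simp add: field_simps eval_nat_numeral)
    finally show ?thesis .
  qed
  have qs0: "0 \<le> q * L / s" using q lam_pos by simp
  have B: "q * L / s \<le> B" "B \<le> 2 * r\<^sup>2 / L\<^sup>2 + 2" "1 \<le> B"
    using qs qs0 unfolding B_def by linarith+
  have r2: "L\<^sup>2 \<le> r" "r \<le> r\<^sup>2" using r_ge[of 2] r_pos by (auto simp: power2_eq_square)
  have colors: "real ((B + 1) * T) \<le> r\<^sup>2"
  proof -
    have "real ((B + 1) * T) \<le> (2 * r\<^sup>2 / L\<^sup>2 + 3) * (4 * L)"
      unfolding of_nat_mult using B T by (intro mult_mono) auto
    also have "\<dots> = 8 * r\<^sup>2 / L + 12 * L" using lam_pos by (simp add: field_simps power2_eq_square)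
    also have "\<dots> \<le> r\<^sup>2 / 2 + r\<^sup>2 / 2"
    proof (rule add_mono)
      have "8 * r\<^sup>2 / L \<le> 8 * r\<^sup>2 / 16" using lam by (intro divide_left_mono) auto
      then show "8 * r\<^sup>2 / L \<le> r\<^sup>2 / 2" by simp
      have "24 * L \<le> L\<^sup>2" using lam by (simp add: power2_eq_square)
      then show "12 * L \<le> r\<^sup>2 / 2" using r2 by simp
    qed
    finally show ?thesis by simp
  qed
  have ks: "k \<le> s"
  proof -
    have "8 * L \<le> L\<^sup>2" using lam by (simp add: power2_eq_square)
    then have "8 * L * r\<^sup>2 \<le> r * r\<^sup>2" using r2 by (intro mult_right_mono) auto
    also have "\<dots> = r ^ 3" by (simp add: power2_eq_square power3_eq_cube)
    finally have "real k \<le> real s" using k s(1) by linarith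
    then show ?thesis by simp
  qed
  have y1: "1 \<le> y" using y(1) lam_mono[of 0 7] by simp
  have r5: "r ^ 3 \<le> r ^ 5" "r ^ 5 \<le> real n"
    using r_pos y1 by (auto simp: y(3) intro: power_increasing)
  have sn: "real s \<le> real n" using s r5 by linarith
  have "9 * (real s)\<^sup>2 * p ^ 3 \<le> 2 * real T"
  proof -
    have "(real s)\<^sup>2 \<le> (r ^ 3)\<^sup>2" using s by (intro power_mono) auto
    then have "9 * (real s)\<^sup>2 * p ^ 3 \<le> 9 * (r ^ 3)\<^sup>2 * p ^ 3"
      using p_bounds by (intro mult_right_mono) auto
    also have "\<dots> = 9" using r_pos by (simp add: r(2) power_divide flip: power_mult)
    also have "\<dots> \<le> 2 * real T" using T lam by simp
    finally show ?thesis .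
  qed
  then have bound: "rprob (nsets {1..n} 2) p (\<lambda>E. k + (B + 1) * T < clique_chromatic_number {1..n} E)
    \<le> (real n)\<^sup>2 * exp (- p\<^sup>2 * (real n - 2)) + real s * exp (- real T)
      + real n * exp (- p * k) / (real B * real s) + real B * (real s * exp (- real T))"
    using ks sn s B p_bounds by (intro rprob_many_colors) auto
  have e1: "(real n)\<^sup>2 * exp (- p\<^sup>2 * (real n - 2)) \<le> exp (- L)"
  proof -
    have "real n * p\<^sup>2 = r * y"
      using r_pos by (simp add: r(2) y(3) power_divide eval_nat_numeral)
    moreover have "L\<^sup>2 * 1 \<le> r * y" using r2 r_pos y1 by (intro mult_mono) auto
    moreover have "10 ^ 7 * L \<le> L\<^sup>2" using lam by (simp add: power2_eq_square)
    moreover have "p\<^sup>2 \<le> 1" using p_bounds by (simp add: power_le_one)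
    ultimately have "3 * L \<le> p\<^sup>2 * (real n - 2)" using lam by (simp add: algebra_simps)
    then have "(real n)\<^sup>2 * exp (- p\<^sup>2 * (real n - 2)) \<le> (exp L)\<^sup>2 * exp (- (3 * L))"
      using lam(2) by (intro mult_mono) auto
    also have "\<dots> = exp (- L)" by (simp add: power2_eq_square flip: exp_add)
    finally show ?thesis .
  qed
  have e2: "real s * exp (- real T) \<le> exp (- L)"
  proof -
    have "real s * exp (- real T) \<le> exp L * exp (- (3 * L))"
      using sn lam(2) T by (intro mult_mono) auto
    also have "\<dots> \<le> exp (- L)" using lam_pos by (simp flip: exp_add)
    finally show ?thesis .
  qed
  have e3: "real n * exp (- p * k) / (real B * real s) \<le> 1 / L"
  proof -
    have "q / (real B * real s) \<le> 1 / L" using B(1,3) s(3) lam_pos by (simp add: field_simps)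
    then show ?thesis by (simp only: q_def)
  qed
  have e4: "real B * (real s * exp (- real T)) \<le> 4 * exp (- L)"
  proof -
    have "2 * r\<^sup>2 / L\<^sup>2 \<le> 2 * r\<^sup>2 / 1" using lam_pos by (intro divide_left_mono) auto
    then have "real B \<le> 4 * r\<^sup>2" using B r2 r_pos by linarith
    then have "real B * real s \<le> 4 * r\<^sup>2 * r ^ 3" using s by (intro mult_mono) auto
    also have "\<dots> = 4 * r ^ 5" by (simp add: eval_nat_numeral)
    also have "\<dots> \<le> 4 * exp L" using r5 lam(2) by simp
    finally have "real B * real s \<le> 4 * exp L" .
    then have "real B * real s * exp (- real T) \<le> 4 * exp L * exp (- (3 * L))"
      by (rule mult_mono) (use T in auto)
    also have "\<dots> \<le> 4 * exp (- L)" using lam_pos by (simp flip: exp_add)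
    finally show ?thesis by (simp add: mult.assoc)
  qed
  have main: "rprob (nsets {1..n} 2) p (\<lambda>E. k + (B + 1) * T < clique_chromatic_number {1..n} E) \<le> 1 / L + 6 * exp (- L)"
    using bound e1 e2 e3 e4 by linarith
  have "rprob (nsets {1..n} 2) p (\<lambda>E. real k + r\<^sup>2 < clique_chromatic_number {1..n} E) \<le>
      rprob (nsets {1..n} 2) p (\<lambda>E. k + (B + 1) * T < clique_chromatic_number {1..n} E)"
  proof (rule rprob_mono)
    fix E assume "real k + r\<^sup>2 < clique_chromatic_number {1..n} E"
    then have "real (k + (B + 1) * T) < real (clique_chromatic_number {1..n} E)"
      using colors by (simp only: of_nat_add)
    then show "k + (B + 1) * T < clique_chromatic_number {1..n} E" by (simp only: of_nat_less_iff)
  qed (simp add: finite_imp_finite_nsets)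
  then show ?thesis using main by linarith
qed

end

text \<open>
  Convergence for every fixed tolerance yields a vanishing tolerance: take the Ky Fan distance, plus \<open>1 / Suc n\<close> because
  the infimum need not be attained.
\<close>
lemma diagonal_tolerance:
  fixes f :: "nat \<Rightarrow> real \<Rightarrow> real"
  assumes f: "\<And>n e. 0 \<le> f n e" "\<And>n e. f n e \<le> 1" "\<And>n d e. d \<le> e \<Longrightarrow> f n d \<le> f n e"
    and lim: "\<And>e. 0 < e \<Longrightarrow> e \<le> 1 \<Longrightarrow> (\<lambda>n. f n e) \<longlonglongrightarrow> 1"
  shows "\<exists>\<eta>. \<eta> \<longlonglongrightarrow> 0 \<and> (\<lambda>n. f n (\<eta> n)) \<longlonglongrightarrow> 1"
proof -
  \<comment> \<open>The tolerances that also bound the failure probability.\<close>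
  define S where "S = (\<lambda>n. {e. 0 < e \<and> 1 - e \<le> f n e})"
  define \<rho> where "\<rho> = (\<lambda>n. Inf (S n))"
  define \<eta> where "\<eta> = (\<lambda>n. \<rho> n + 1 / real (Suc n))"
  have S1: "1 \<in> S n" for n using f(1) by (simp add: S_def)
  have bdd: "bdd_below (S n)" for n by (rule bdd_belowI[of _ 0]) (simp add: S_def)
  have ne: "S n \<noteq> {}" for n using S1[of n] by blast
  have \<rho>0: "0 \<le> \<rho> n" for n unfolding \<rho>_def by (rule cInf_greatest[OF ne]) (simp add: S_def)
  have \<rho>: "\<rho> \<longlonglongrightarrow> 0"
  proof (rule LIMSEQ_I)
    fix e :: real assume e: "0 < e"
    define d where "d = min (e / 2) 1"
    have d: "0 < d" "d \<le> 1" "d < e" using e by (auto simp: d_def)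
    have "eventually (\<lambda>n. 1 - d < f n d) sequentially"
      using order_tendstoD(1)[OF lim[OF d(1,2)], of "1 - d"] d(1) by simp
    then obtain N where N: "\<forall>n\<ge>N. 1 - d < f n d" unfolding eventually_sequentially by (rule exE)
    have "norm (\<rho> n - 0) < e" if "N \<le> n" for n
    proof -
      have "1 - d < f n d" using N that by simp
      then have "d \<in> S n" using d by (simp add: S_def)
      then have "\<rho> n \<le> d" unfolding \<rho>_def by (rule cInf_lower[OF _ bdd])
      then show ?thesis using \<rho>0[of n] d by simp
    qed
    then show "\<exists>N. \<forall>n\<ge>N. norm (\<rho> n - 0) < e" by blast
  qed
  have "(\<lambda>n. 1 / real (Suc n)) \<longlonglongrightarrow> 0" by real_asymp
  then have "\<eta> \<longlonglongrightarrow> 0 + 0" unfolding \<eta>_def by (intro tendsto_add \<rho>)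
  then have \<eta>: "\<eta> \<longlonglongrightarrow> 0" by simp
  have low: "1 - \<eta> n \<le> f n (\<eta> n)" for n
  proof -
    have "Inf (S n) < \<eta> n" by (simp add: \<eta>_def \<rho>_def)
    then have "\<exists>e\<in>S n. e < \<eta> n" by (rule cInf_lessD[OF ne])
    then obtain e where "e \<in> S n" "e < \<eta> n" by (rule bexE)
    then show ?thesis using f(3)[of e "\<eta> n" n] by (simp add: S_def)
  qed
  have "(\<lambda>n. 1 - \<eta> n) \<longlonglongrightarrow> 1 - 0" by (rule tendsto_diff[OF tendsto_const \<eta>])
  then have "(\<lambda>n. 1 - \<eta> n) \<longlonglongrightarrow> 1" by simp
  from tendsto_sandwich[OF _ _ this tendsto_const[of 1]]
  have "(\<lambda>n. f n (\<eta> n)) \<longlonglongrightarrow> 1" using low f(2) by simp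
  then show ?thesis using \<eta> by blast
qed

text \<open>
  The growth of \<open>\<omega>\<close> enters only through the first conclusion: \<open>n^(2/5) p\<close> exceeds every fixed power of \<open>ln n\<close>.
\<close>
lemma scaling_eventually:
  fixes p \<omega> :: "nat \<Rightarrow> real"
  assumes p: "\<And>n. 0 < p n \<and> p n < 1"
    and \<omega>: "filterlim \<omega> at_top at_top"
    and low: "eventually (\<lambda>n. ln (real n) powr \<omega> n * real n powr (- (2/5)) \<le> p n) at_top"
    and high: "p \<in> o(\<lambda>n. real n powr (- (1/3)))"
  shows "eventually (\<lambda>n. ln (real n) powr K \<le> real n powr (2/5) * p n) at_top"
    and "eventually (\<lambda>n. scaling n (p n) (p n powr (- 1/2)) ((real n powr (2/5) * p n) powr (5/2)) (ln (real n))) at_top"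
proof -
  show D: "eventually (\<lambda>n. ln (real n) powr K \<le> real n powr (2/5) * p n) at_top" for K
  proof -
    have "eventually (\<lambda>n. K \<le> \<omega> n) at_top" using \<omega> by (simp add: filterlim_at_top)
    moreover have "eventually (\<lambda>n::nat. 1 \<le> ln (real n)) at_top" by real_asymp
    ultimately show ?thesis using low eventually_gt_at_top[of 0]
    proof eventually_elim
      case (elim n)
      have "ln (real n) powr K \<le> ln (real n) powr \<omega> n" using elim by (intro powr_mono) auto
      also have "\<dots> = real n powr (2/5) * (ln (real n) powr \<omega> n * real n powr (- (2/5)))"
        using elim by (simp add: powr_minus field_simps)
      also have "\<dots> \<le> real n powr (2/5) * p n" using elim by (intro mult_left_mono) auto
      finally show ?case .
    qed
  qed
  have "eventually (\<lambda>n. norm (p n) \<le> 1 / 200 * norm (real n powr (- (1/3)))) at_top"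
    by (rule landau_o.smallD[OF high]) simp
  moreover have "eventually (\<lambda>n::nat. 10 ^ 7 \<le> ln (real n)) at_top" by real_asymp
  moreover have "eventually (\<lambda>n::nat. ln (real n) ^ 20 \<le> real n powr (1/6)) at_top" by real_asymp
  ultimately show "eventually (\<lambda>n. scaling n (p n) (p n powr (- 1/2)) ((real n powr (2/5) * p n) powr (5/2)) (ln (real n))) at_top"
    using D[of 7] eventually_gt_at_top[of 0]
  proof eventually_elim
    case (elim n)
    have p0: "0 < p n" and n0: "0 < real n" using p elim by auto
    define r where "r = p n powr (- 1/2)"
    define y where "y = (real n powr (2/5) * p n) powr (5/2)"
    have pn: "p n \<le> 1 / 200 * real n powr (- (1/3))" using elim p0 by simp
    then have pn': "p n \<le> real n powr (- (1/3))" using powr_ge_zero[of "real n" "- (1/3)"] by linarith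
    have r_pow: "r ^ j = p n powr (- real j / 2)" for j
      unfolding r_def using p0 by (subst powr_power) auto
    have y_eq: "y = real n * p n powr (5/2)"
      using p0 n0 by (simp add: y_def powr_mult powr_powr)
    show ?case
      unfolding r_def[symmetric] y_def[symmetric]
    proof
      show "10 ^ 7 \<le> ln (real n)" "exp (ln (real n)) = real n" using elim by auto
      have "real n powr (1/6) = (real n powr (- (1/3))) powr (- 1/2)" by (simp add: powr_powr)
      also have "\<dots> \<le> r" unfolding r_def using pn' p0 by (intro powr_mono2') auto
      finally show "ln (real n) ^ 20 \<le> r" using elim by linarith
      have "r\<^sup>2 = 1 / p n" using r_pow[of 2] p0 by (simp add: powr_minus_divide)
      then show "p n = 1 / r\<^sup>2" by simp
      have "p n powr (- (5/2)) * p n powr (5/2) = 1" using p0 by (simp flip: powr_add)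
      then show "real n = r ^ 5 * y" using r_pow[of 5] by (simp add: y_eq)
      have D: "ln (real n) ^ 7 \<le> real n powr (2/5) * p n"
        using elim by simp
      moreover have "1 \<le> ln (real n) ^ 7" using elim by (intro one_le_power) auto
      ultimately have "1 \<le> real n powr (2/5) * p n" by linarith
      then have "(real n powr (2/5) * p n) powr 1 \<le> y" unfolding y_def by (intro powr_mono) auto
      then show "ln (real n) ^ 7 \<le> y" using D p0 by simp
      have "real n * p n ^ 3 \<le> real n * (1 / 200 * real n powr (- (1/3))) ^ 3"
        using pn p0 by (intro mult_left_mono power_mono) auto
      also have "\<dots> = real n * real n powr (- 1) / 8000000"
      proof -
        have "(real n powr (- (1/3))) ^ 3 = real n powr (- 1)" using n0 by (subst powr_power) auto
        then show ?thesis by (simp add: power_divide)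
      qed
      also have "\<dots> = 1 / 8000000" using n0 by (simp add: powr_minus)
      finally have "real n * p n ^ 3 * r \<le> 1 / 8000000 * r" by (intro mult_right_mono) (auto simp: r_def)
      moreover have "y = real n * p n ^ 3 * r"
        using p0 powr_add[of "p n" 3 "- 1/2"] by (simp add: y_eq r_def)
      moreover have "0 \<le> r" by (simp add: r_def)
      ultimately show "4096000 * y \<le> r" by simp
    qed
  qed
qed

text \<open>
  With \<open>D = n^(2/5) p\<close> we have \<open>y = D^(5/2)\<close>, so \<open>k = (5/2 - e) ln D / p\<close> leaves a factor \<open>D^e\<close> in
  \<open>exp (- p k) * y\<close>, and \<open>k' = (5/2 + e/2) ln D / p\<close> a factor \<open>D^(-e/2)\<close>.  Both beat every power of \<open>L\<close>, since
  \<open>D \<ge> L powr (14 / e)\<close>.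
\<close>
lemma rprob_chromatic_number_near:
  fixes p \<omega> :: "nat \<Rightarrow> real"
  assumes p: "\<And>n. 0 < p n \<and> p n < 1"
    and \<omega>: "filterlim \<omega> at_top at_top"
    and low: "eventually (\<lambda>n. ln (real n) powr \<omega> n * real n powr (- (2/5)) \<le> p n) at_top"
    and high: "p \<in> o(\<lambda>n. real n powr (- (1/3)))"
    and e: "0 < e" "e \<le> 1"
  shows "(\<lambda>n. rprob (nsets {1..n} 2) (p n) (\<lambda>E.
      \<bar>real (clique_chromatic_number {1..n} E) * p n / ln (real n powr (2/5) * p n) - 5/2\<bar> \<le> e)) \<longlonglongrightarrow> 1"
proof -
  note ev = scaling_eventually[OF p \<omega> low high]
  let ?P = "\<lambda>n. rprob (nsets {1..n} 2) (p n)"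
  let ?X = "\<lambda>n E. real (clique_chromatic_number {1..n} E) * p n / ln (real n powr (2/5) * p n)"
  \<comment> \<open>The failure probability of the lower bound is at most \<open>14 / n\<close>, that of the upper bound \<open>1 / L + 6 / n\<close>.\<close>
  let ?b = "\<lambda>n::nat. 1 - (20 * exp (- ln (real n)) + 1 / ln (real n))"
  have bound: "eventually (\<lambda>n. ?b n \<le> ?P n (\<lambda>E. \<bar>?X n E - 5/2\<bar> \<le> e)) at_top"
    using ev(1)[of "14 / e"] ev(2) eventually_gt_at_top[of 0]
  proof eventually_elim
    case (elim n)
    define D where "D = real n powr (2/5) * p n"
    define l where "l = ln D"
    define L where "L = ln (real n)"
    define r where "r = p n powr (- 1/2)"
    define y where "y = D powr (5/2)"
    have sc: "scaling n (p n) r y L"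
      using elim by (simp add: r_def y_def D_def L_def)
    interpret scaling n "p n" r y L by (rule sc)
    have p0: "0 < p n" "p n \<le> 1" using p[of n] by auto
    have n1: "1 \<le> real n" using elim by simp
    have LK: "L powr (14 / e) \<le> D" using elim by (simp add: L_def D_def)
    have D0: "0 < D" using p0 n1 by (simp add: D_def)
    have lnL: "1 \<le> ln L"
    proof -
      have "exp 1 \<le> L" using exp_le lam_big by linarith
      then show ?thesis using lam_pos by (simp add: ln_ge_iff)
    qed
    have lge: "14 / e \<le> l"
    proof -
      have "14 / e * 1 \<le> 14 / e * ln L" using lnL e by (intro mult_left_mono) auto
      also have "\<dots> = ln (L powr (14 / e))" using lam_pos by (simp add: ln_powr)
      also have "\<dots> \<le> l" unfolding l_def using LK lam_pos D0 by (intro ln_mono) auto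
      finally show ?thesis by simp
    qed
    have l0: "0 < l" using lge e by (auto intro: less_le_trans[OF _ lge])
    have el: "2 \<le> e / 2 * l"
    proof -
      have "e / 2 * (14 / e) \<le> e / 2 * l" using lge e by (intro mult_left_mono) auto
      then show ?thesis using e by simp
    qed
    have lL: "l \<le> L"
    proof -
      have "D \<le> real n powr 1 * 1"
        unfolding D_def using n1 p0 by (intro mult_mono powr_mono) auto
      then show ?thesis unfolding l_def L_def using D0 n1 by (intro ln_mono) auto
    qed
    have Dpow: "exp (t * l) = D powr t" for t using D0 by (simp add: powr_def l_def)
    have De: "L ^ 7 \<le> D powr (e / 2)"
    proof -
      have "L ^ 7 = (L powr (14 / e)) powr (e / 2)"
        using e lam_pos by (simp add: powr_powr)
      also have "\<dots> \<le> D powr (e / 2)" using LK e by (intro powr_mono2) auto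
      finally show ?thesis .
    qed
    have D1: "1 \<le> D" using l0 D0 unfolding l_def by (simp add: ln_gt_zero_iff)
    define k where "k = nat \<lfloor>(5/2 - e) * l / p n\<rfloor>"
    define k' where "k' = nat \<lceil>(5/2 + e / 2) * l / p n\<rceil>"
    have "0 \<le> (5/2 + e / 2) * l / p n" using l0 e p0 by simp
    then have k'_le: "real k' \<le> (5/2 + e / 2) * l / p n + 1" unfolding k'_def by linarith
    have "?P n (\<lambda>E. \<not> \<bar>?X n E - 5/2\<bar> \<le> e) \<le>
        ?P n (\<lambda>E. clique_chromatic_number {1..n} E \<le> k \<or> real k' + r\<^sup>2 < clique_chromatic_number {1..n} E)"
    proof (rule rprob_mono)
      fix E assume far: "\<not> \<bar>?X n E - 5/2\<bar> \<le> e"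
      define x where "x = clique_chromatic_number {1..n} E"
      have "real x * p n / l < 5/2 - e \<or> 5/2 + e < real x * p n / l"
        using far unfolding x_def[symmetric] D_def[symmetric] l_def[symmetric] by linarith
      then have "real x \<le> (5/2 - e) * l / p n \<or> (5/2 + e) * l / p n < real x"
        using p0 l0 by (auto simp: field_simps)
      moreover have "x \<le> k" if "real x \<le> (5/2 - e) * l / p n"
        unfolding k_def using that by (rule le_nat_floor)
      moreover have "real k' + r\<^sup>2 \<le> (5/2 + e) * l / p n"
      proof -
        have "1 \<le> 1 / p n" using p0 by simp
        moreover have "r\<^sup>2 = 1 / p n" using r(2) r_pos by simp
        moreover have "(5/2 + e / 2) * l / p n + 2 / p n \<le> (5/2 + e) * l / p n"
        proof -
          have "(5/2 + e / 2) * l + 2 \<le> (5/2 + e) * l" using el by (simp add: algebra_simps)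
          from divide_right_mono[OF this less_imp_le[OF p0(1)]] show ?thesis
            by (simp only: add_divide_distrib)
        qed
        ultimately show ?thesis using k'_le by simp
      qed
      ultimately show "clique_chromatic_number {1..n} E \<le> k \<or> real k' + r\<^sup>2 < clique_chromatic_number {1..n} E"
        unfolding x_def by linarith
    qed (simp add: finite_imp_finite_nsets)
    also have "\<dots> \<le> ?P n (\<lambda>E. clique_chromatic_number {1..n} E \<le> k) +
        ?P n (\<lambda>E. real k' + r\<^sup>2 < clique_chromatic_number {1..n} E)"
      by (rule rprob_disj)
    also have "?P n (\<lambda>E. clique_chromatic_number {1..n} E \<le> k) \<le> 14 * exp (- L)"
    proof (rule rprob_chromatic_le)
      have k0: "0 \<le> (5/2 - e) * l / p n" using e l0 p0 by simp
      then have "real k \<le> (5/2 - e) * l / p n" unfolding k_def by (rule of_nat_floor)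
      then show "p n * real k \<le> (5/2 - e) * l" using p0 by (simp add: field_simps)
      have "(5/2 - e) * l \<le> 3 * l" using l0 e by (intro mult_right_mono) auto
      then show "(5/2 - e) * l \<le> 3 * L" using lL by linarith
      have "L ^ 7 \<le> D powr e"
        using De D1 e powr_mono[of "e / 2" e D] by linarith
      also have "\<dots> = D powr (- (5/2 - e)) * y" by (simp add: y_def flip: powr_add)
      also have "\<dots> = exp (- ((5/2 - e) * l)) * y" unfolding Dpow[symmetric] by (simp only: minus_mult_left)
      finally show "L ^ 7 \<le> exp (- ((5/2 - e) * l)) * y" .
    qed
    also have "?P n (\<lambda>E. real k' + r\<^sup>2 < clique_chromatic_number {1..n} E) \<le> 1 / L + 6 * exp (- L)"
    proof (rule rprob_chromatic_gt)
      have r2: "r\<^sup>2 = 1 / p n" using r(2) r_pos by simp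
      note k'_le
      also have "(5/2 + e / 2) * l / p n \<le> 3 * L / p n"
        using lL l0 e p0 lam_pos by (intro divide_right_mono mult_mono) auto
      also have "3 * L / p n + 1 \<le> 4 * L * r\<^sup>2"
      proof -
        have "1 \<le> L / p n" using p0 lam_pos by (simp add: field_simps)
        then show ?thesis by (simp add: r2)
      qed
      finally show "real k' \<le> 4 * L * r\<^sup>2" by simp
      have "(5/2 + e / 2) * l / p n \<le> real k'" unfolding k'_def by linarith
      then have "(5/2 + e / 2) * l \<le> p n * real k'" using p0 by (simp add: field_simps)
      then have "exp (- p n * real k') \<le> exp (- (5/2 + e / 2) * l)"
        by (simp only: exp_le_cancel_iff neg_le_iff_le flip: minus_mult_left)
      also have "\<dots> = D powr (- (5/2 + e / 2))" by (rule Dpow)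
      finally have "exp (- p n * real k') * y * L ^ 3 \<le> D powr (- (5/2 + e / 2)) * y * L ^ 3"
        using lam_pos by (intro mult_right_mono) (auto simp: y_def)
      also have "\<dots> = D powr (- (e / 2)) * L ^ 3" by (simp add: y_def flip: powr_add)
      also have "\<dots> \<le> D powr (- (e / 2)) * D powr (e / 2)"
        using De lam_mono[of 3 7] by (intro mult_left_mono) auto
      also have "\<dots> = 1" using D0 by (simp flip: powr_add)
      finally show "exp (- p n * real k') * y * L ^ 3 \<le> 1" .
    qed
    finally have "?P n (\<lambda>E. \<not> \<bar>?X n E - 5/2\<bar> \<le> e) \<le> 20 * exp (- L) + 1 / L" by simp
    then show ?case unfolding rprob_not L_def by linarith
  qed
  have lim: "?b \<longlonglongrightarrow> 1" by real_asymp
  show ?thesis by (rule tendsto_sandwich[OF bound _ lim tendsto_const]) simp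
qed

theorem theorem1p3:
  fixes p \<omega> :: "nat \<Rightarrow> real"
  assumes "\<And>n. 0 < p n \<and> p n < 1"
    and "filterlim \<omega> at_top at_top"
    and "eventually (\<lambda>n. ln (real n) powr \<omega> n * real n powr (- (2/5)) \<le> p n) at_top"
    and "p \<in> o(\<lambda>n. real n powr (- (1/3)))"
  shows "\<exists>\<eta> :: nat \<Rightarrow> real. \<eta> \<longlonglongrightarrow> 0 \<and>
    (\<lambda>n. measure_pmf.prob (binomial_random_graph n (p n))
       {E. \<bar>real (clique_chromatic_number {1..n} E) * p n / ln (real n powr (2/5) * p n) - 5/2\<bar>
             \<le> \<eta> n}) \<longlonglongrightarrow> 1"
proof -
  let ?X = "\<lambda>n E. \<bar>real (clique_chromatic_number {1..n} E) * p n / ln (real n powr (2/5) * p n) - 5/2\<bar>"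
  define f where "f = (\<lambda>n e. rprob (nsets {1..n} 2) (p n) (\<lambda>E. ?X n E \<le> e))"
  have "\<exists>\<eta>. \<eta> \<longlonglongrightarrow> 0 \<and> (\<lambda>n. f n (\<eta> n)) \<longlonglongrightarrow> 1"
  proof (rule diagonal_tolerance)
    show "0 \<le> f n e" "f n e \<le> 1" for n e by (simp_all add: f_def)
    show "f n d \<le> f n e" if "d \<le> e" for n d e
      unfolding f_def using that by (intro rprob_mono) (auto simp: finite_imp_finite_nsets)
    show "(\<lambda>n. f n e) \<longlonglongrightarrow> 1" if "0 < e" "e \<le> 1" for e
      unfolding f_def by (rule rprob_chromatic_number_near[OF assms that])
  qed
  moreover have "binomial_random_graph n q = random_subset (nsets {1..n} 2) q" for n q
    by (simp add: binomial_random_graph_def random_subset_def)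
  ultimately show ?thesis unfolding f_def rprob_def by simp
qed

end
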